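(* Let $\alpha\colon\Gamma\to\mathrm{GL}_2(\mathbf{C})$ be an irreducible representation of $\Gamma=\mathrm{SL}_2(\mathbf{Z})$ such that $\mathrm{Sym}^3\alpha$ is irreducible, let $L$ be a choice of exponents for $\alpha$, and let $S^3L$ be the symmetric cube exponents. Let $k_1=6\operatorname{Tr}(L)-1$ (the minimal weight for $(\alpha,L)$) and let $A=(f,g)^T\in M_{k_1}(\alpha,L)$ be nonzero. Then: (1) the $M(1)\langle D\rangle$-module $M(\mathrm{Sym}^3\alpha,S^3L)$ is cyclic; (2) the minimal weight for $M(\mathrm{Sym}^3\alpha,S^3L)$ is $3k_1$; (3) with $F=(f^3,f^2g,fg^2,g^3)^T$, the forms $F,DF,D^2F,D^3F$ form an $M(1)$-basis of $M(\mathrm{Sym}^3\alpha,S^3L)$.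
   Context: $T=\begin{pmatrix}1&1\\0&1\end{pmatrix}$. For $\rho\colon\Gamma\to\mathrm{GL}_d(\mathbf{C})$, a choice of exponents is $L$ with $\rho(T)=e^{2\pi iL}$; $M_k(\rho,L)$ is the space of holomorphic $F\colon\mathfrak H\to\mathbf{C}^d$ with $F(\gamma\tau)=(c\tau+d)^k\rho(\gamma)F(\tau)$ for $\gamma=\begin{pmatrix}a&b\\c&d\end{pmatrix}\in\Gamma$ such that $e^{-2\pi iL\tau}F(\tau)$ has a $q$-expansion in nonnegative powers of $q=e^{2\pi i\tau}$; $M(\rho,L)=\bigoplus_kM_k(\rho,L)$, a free module over $M(1)=\mathbf{C}[E_4,E_6]$. The minimal weight is the least $k$ with $M_k(\rho,L)\neq0$; it is known that for irreducible $2$-dimensional $\alpha$ this equals $6\operatorname{Tr}(L)-1$. $\mathrm{Sym}^3\colon\mathrm{GL}_2(\mathbf{C})\to\mathrm{GL}_4(\mathbf{C})$ is the homomorphism determined by $\mathrm{Sym}^3(M)(v_1^3,v_1^2v_2,v_1v_2^2,v_2^3)^T=(w_1^3,w_1^2w_2,w_1w_2^2,w_2^3)^T$ where $w=Mv$; $\mathrm{Sym}^3\alpha=\mathrm{Sym}^3\circ\alpha$, and $S^3L=\frac{1}{2\pi i}\frac{d}{d\tau}\mathrm{Sym}^3(e^{2\pi iL\tau})\big|_{\tau=0}$ (a choice of exponents for $\mathrm{Sym}^3\alpha$). The modular derivative is $D_kF=q\frac{dF}{dq}-\frac{k}{12}E_2F$ in weight $k$ ($E_2=1-24\sum\sigma_1(n)q^n$);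 $M(1)\langle D\rangle$ is the ring of operators generated by $M(1)$ and $D$, and cyclic means generated by a single element. *)

theory Defs
  imports "HOL-Analysis.Analysis"
begin

section \<open>The modular group and its representations\<close>

definition SL2Z :: "(int^2^2) set"
  where "SL2Z = {\<gamma>. det \<gamma> = 1}"

definition T_mat :: "int^2^2"
  where "T_mat = vector [vector [1, 1], vector [0, 1]]"

definition representation :: "(int^2^2 \<Rightarrow> complex^'d^'d) \<Rightarrow> bool"
  where "representation \<rho> \<longleftrightarrow>
    (\<forall>\<gamma>\<in>SL2Z. invertible (\<rho> \<gamma>)) \<and>
    (\<forall>\<gamma>\<in>SL2Z. \<forall>\<delta>\<in>SL2Z. \<rho> (\<gamma> ** \<delta>) = \<rho> \<gamma> ** \<rho> \<delta>)"

text \<open>The underlying space is never zero, since index types are nonempty.\<close>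

definition irreducible_rep :: "(int^2^2 \<Rightarrow> complex^'d^'d) \<Rightarrow> bool"
  where "irreducible_rep \<rho> \<longleftrightarrow> representation \<rho> \<and>
    (\<forall>W. vec.subspace W \<and> (\<forall>\<gamma>\<in>SL2Z. \<forall>w\<in>W. \<rho> \<gamma> *v w \<in> W) \<longrightarrow> W = {0} \<or> W = UNIV)"

text \<open>Multiplication and powers on the vector type are componentwise, so the matrix exponential
  is given by its own power series. Complex multiples of a matrix \<open>X\<close> are written \<open>mat c ** X\<close>.\<close>

definition mat_exp :: "complex^'d^'d \<Rightarrow> complex^'d^'d"
  where "mat_exp X = (\<Sum>n. (1 / fact n) *\<^sub>R (((**) X ^^ n) (mat 1)))"

definition choice_of_exponents ::
    "(int^2^2 \<Rightarrow> complex^'d^'d) \<Rightarrow> complex^'d^'d \<Rightarrow> bool"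
  where "choice_of_exponents \<rho> L \<longleftrightarrow> \<rho> T_mat = mat_exp (mat (2 * of_real pi * \<i>) ** L)"


section \<open>Vector valued modular forms\<close>

definition qpar :: "complex \<Rightarrow> complex"
  where "qpar \<tau> = exp (2 * of_real pi * \<i> * \<tau>)"

text \<open>Functions on the upper half plane are total functions that vanish off the upper half plane,
  so that equality of such functions is HOL equality. Weights are arbitrary integers.\<close>

definition modular_forms ::
    "(int^2^2 \<Rightarrow> complex^'d^'d) \<Rightarrow> complex^'d^'d \<Rightarrow> int \<Rightarrow> (complex \<Rightarrow> complex^'d) set"
  where "modular_forms \<rho> L k = {F.
    (\<forall>\<tau>. Im \<tau> \<le> 0 \<longrightarrow> F \<tau> = 0) \<and>
    (\<forall>i. (\<lambda>\<tau>. F \<tau> $ i) holomorphic_on {\<tau>. Im \<tau> > 0}) \<and>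
    (\<forall>\<gamma>\<in>SL2Z. \<forall>\<tau>. Im \<tau> > 0 \<longrightarrow>
      F ((of_int (\<gamma> $ 1 $ 1) * \<tau> + of_int (\<gamma> $ 1 $ 2)) /
         (of_int (\<gamma> $ 2 $ 1) * \<tau> + of_int (\<gamma> $ 2 $ 2))) =
      ((of_int (\<gamma> $ 2 $ 1) * \<tau> + of_int (\<gamma> $ 2 $ 2)) powi k) *s (\<rho> \<gamma> *v F \<tau>)) \<and>
    (\<exists>a :: nat \<Rightarrow> complex^'d. \<forall>\<tau>. Im \<tau> > 0 \<longrightarrow>
      (\<lambda>n. (qpar \<tau> ^ n) *s a n) sums
        (mat_exp (mat (- 2 * of_real pi * \<i> * \<tau>) ** L) *v F \<tau>))}"

definition minimal_weight ::
    "(int^2^2 \<Rightarrow> complex^'d^'d) \<Rightarrow> complex^'d^'d \<Rightarrow> int \<Rightarrow> bool"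
  where "minimal_weight \<rho> L k \<longleftrightarrow>
    modular_forms \<rho> L k \<noteq> {\<lambda>\<tau>. 0} \<and> (\<forall>j<k. modular_forms \<rho> L j = {\<lambda>\<tau>. 0})"


section \<open>The graded ring of scalar forms and graded modules\<close>

definition eisenstein_series :: "complex \<Rightarrow> nat \<Rightarrow> complex \<Rightarrow> complex"
  where "eisenstein_series c r \<tau> =
    1 + c * (\<Sum>n. of_nat (\<Sum>d | d dvd Suc n. d ^ r) * qpar \<tau> ^ Suc n)"

definition E2 :: "complex \<Rightarrow> complex" where "E2 = eisenstein_series (- 24) 1"
definition E4 :: "complex \<Rightarrow> complex" where "E4 = eisenstein_series 240 3"
definition E6 :: "complex \<Rightarrow> complex" where "E6 = eisenstein_series (- 504) 5"

text \<open>External direct sum over all weights: an element is the family of its homogeneous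
  components.\<close>

definition graded_sum :: "(int \<Rightarrow> (complex \<Rightarrow> 'v::zero) set) \<Rightarrow> (int \<Rightarrow> complex \<Rightarrow> 'v) set"
  where "graded_sum V = {F. (\<forall>k. F k \<in> V k) \<and> finite {k. F k \<noteq> (\<lambda>\<tau>. 0)}}"

definition homogeneous :: "int \<Rightarrow> (complex \<Rightarrow> 'v::zero) \<Rightarrow> int \<Rightarrow> complex \<Rightarrow> 'v"
  where "homogeneous k F = (\<lambda>j. if j = k then F else (\<lambda>\<tau>. 0))"

text \<open>The weight \<open>k\<close> part of \<open>\<complex>[E\<^sub>4, E\<^sub>6]\<close> consists of the linear combinations of the monomials
  \<open>E\<^sub>4^a E\<^sub>6^b\<close> of weight \<open>4 a + 6 b = k\<close>, of which there are finitely many.\<close>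

definition M1_weight :: "int \<Rightarrow> (complex \<Rightarrow> complex) set"
  where "M1_weight k = {\<phi>. \<exists>c :: nat \<times> nat \<Rightarrow> complex. \<phi> = (\<lambda>\<tau>. if Im \<tau> > 0
    then \<Sum>(a, b) | 4 * int a + 6 * int b = k. c (a, b) * E4 \<tau> ^ a * E6 \<tau> ^ b else 0)}"

definition M1 :: "(int \<Rightarrow> complex \<Rightarrow> complex) set"
  where "M1 = graded_sum M1_weight"

definition M_module ::
    "(int^2^2 \<Rightarrow> complex^'d^'d) \<Rightarrow> complex^'d^'d \<Rightarrow> (int \<Rightarrow> complex \<Rightarrow> complex^'d) set"
  where "M_module \<rho> L = graded_sum (modular_forms \<rho> L)"

definition M1_scale ::
    "(int \<Rightarrow> complex \<Rightarrow> complex) \<Rightarrow> (int \<Rightarrow> complex \<Rightarrow> complex^'d) \<Rightarrow> int \<Rightarrow> complex \<Rightarrow> complex^'d"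
  where "M1_scale \<phi> F = (\<lambda>k \<tau>. \<Sum>i | \<phi> i \<noteq> (\<lambda>\<tau>. 0). \<phi> i \<tau> *s F (k - i) \<tau>)"

definition M1_basis ::
    "(int \<Rightarrow> complex \<Rightarrow> complex^'d) set \<Rightarrow> nat \<Rightarrow> (nat \<Rightarrow> int \<Rightarrow> complex \<Rightarrow> complex^'d) \<Rightarrow> bool"
  where "M1_basis M n b \<longleftrightarrow>
    (\<forall>i<n. b i \<in> M) \<and>
    (\<forall>G\<in>M. \<exists>\<phi>. (\<forall>i<n. \<phi> i \<in> M1) \<and> G = (\<lambda>k \<tau>. \<Sum>i<n. M1_scale (\<phi> i) (b i) k \<tau>)) \<and>
    (\<forall>\<phi>. (\<forall>i<n. \<phi> i \<in> M1) \<and> (\<lambda>k \<tau>. \<Sum>i<n. M1_scale (\<phi> i) (b i) k \<tau>) = (\<lambda>k \<tau>. 0) \<longrightarrow>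
      (\<forall>i<n. \<phi> i = (\<lambda>k \<tau>. 0)))"


section \<open>The modular derivative\<close>

text \<open>With \<open>q = exp (2 \<pi> \<i> \<tau>)\<close>, the operator \<open>q d/dq\<close> is \<open>1 / (2 \<pi> \<i>)\<close> times the derivative
  with respect to \<open>\<tau>\<close>.\<close>

definition mod_deriv :: "int \<Rightarrow> (complex \<Rightarrow> complex^'d) \<Rightarrow> complex \<Rightarrow> complex^'d"
  where "mod_deriv k F \<tau> = (if Im \<tau> > 0
    then (\<chi> i. deriv (\<lambda>z. F z $ i) \<tau> / (2 * of_real pi * \<i>) - of_int k / 12 * E2 \<tau> * F \<tau> $ i)
    else 0)"

text \<open>The degree 2 operator that acts as \<open>mod_deriv k\<close> on the weight \<open>k\<close> component.\<close>

definition graded_deriv :: "(int \<Rightarrow> complex \<Rightarrow> complex^'d) \<Rightarrow> int \<Rightarrow> complex \<Rightarrow> complex^'d"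
  where "graded_deriv F = (\<lambda>k. mod_deriv (k - 2) (F (k - 2)))"

text \<open>The ring of operators generated by \<open>M1\<close> and the modular derivative. It contains negatives and
  the identity because \<open>M1\<close> contains the constants.\<close>

inductive_set diff_ops ::
    "((int \<Rightarrow> complex \<Rightarrow> complex^'d) \<Rightarrow> int \<Rightarrow> complex \<Rightarrow> complex^'d) set"
  where
    scale: "\<phi> \<in> M1 \<Longrightarrow> M1_scale \<phi> \<in> diff_ops"
  | deriv: "graded_deriv \<in> diff_ops"
  | add: "P \<in> diff_ops \<Longrightarrow> Q \<in> diff_ops \<Longrightarrow> (\<lambda>F k \<tau>. P F k \<tau> + Q F k \<tau>) \<in> diff_ops"
  | comp: "P \<in> diff_ops \<Longrightarrow> Q \<in> diff_ops \<Longrightarrow> P \<circ> Q \<in> diff_ops"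

definition cyclic_module :: "(int \<Rightarrow> complex \<Rightarrow> complex^'d) set \<Rightarrow> bool"
  where "cyclic_module M \<longleftrightarrow> (\<exists>F\<in>M. M = (\<lambda>P. P F) ` diff_ops)"


section \<open>The symmetric cube\<close>

definition cubic_monomials :: "complex^2 \<Rightarrow> complex^4"
  where "cubic_monomials v =
    vector [v $ 1 ^ 3, v $ 1 ^ 2 * v $ 2, v $ 1 * v $ 2 ^ 2, v $ 2 ^ 3]"

text \<open>Every linear form on cubic binary forms that vanishes on all \<open>cubic_monomials v\<close> is zero, so a
  matrix is determined by its values there; the lemmas below show that the description in
  \<open>Sym3\<close> is satisfied.\<close>

definition Sym3 :: "complex^2^2 \<Rightarrow> complex^4^4"
  where "Sym3 X = (THE S. \<forall>v. S *v cubic_monomials v = cubic_monomials (X *v v))"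

lemma cubic_monomials_nth [simp]:
  "cubic_monomials v $ 1 = v $ 1 ^ 3"
  "cubic_monomials v $ 2 = v $ 1 ^ 2 * v $ 2"
  "cubic_monomials v $ 3 = v $ 1 * v $ 2 ^ 2"
  "cubic_monomials v $ 4 = v $ 2 ^ 3"
  by (simp_all add: cubic_monomials_def vector_def)

lemma Sym3_ex:
  "\<exists>S. \<forall>v. S *v cubic_monomials v = cubic_monomials (X *v v)"
proof -
  let ?a = "X $ 1 $ 1" and ?b = "X $ 1 $ 2" and ?c = "X $ 2 $ 1" and ?d = "X $ 2 $ 2"
  define S :: "complex^4^4" where "S = (\<chi> i.
    if i = 1 then vector [?a^3, 3*?a^2*?b, 3*?a*?b^2, ?b^3]
    else if i = 2 then vector [?a^2*?c, ?a^2*?d + 2*?a*?b*?c, 2*?a*?b*?d + ?b^2*?c, ?b^2*?d]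
    else if i = 3 then vector [?a*?c^2, 2*?a*?c*?d + ?b*?c^2, ?a*?d^2 + 2*?b*?c*?d, ?b*?d^2]
    else vector [?c^3, 3*?c^2*?d, 3*?c*?d^2, ?d^3])"
  have "S *v cubic_monomials v = cubic_monomials (X *v v)" for v
    unfolding vec_eq_iff forall_4
    by (simp add: S_def matrix_vector_mult_def sum_4 sum_2 vector_def
        power2_eq_square power3_eq_cube algebra_simps)
  then show ?thesis by blast
qed

lemma Sym3_unique:
  assumes "\<forall>v. S *v cubic_monomials v = S' *v cubic_monomials v"
  shows "S = S'"
proof -
  define R where "R = S - S'"
  have R: "R $ i $ 1 * x ^ 3 + R $ i $ 2 * (x ^ 2 * y) + R $ i $ 3 * (x * y ^ 2) + R $ i $ 4 * y ^ 3 = 0"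
    for i and x y :: complex
  proof -
    have "(S *v cubic_monomials (vector [x, y])) $ i = (S' *v cubic_monomials (vector [x, y])) $ i"
      using assms by simp
    then show ?thesis
      by (simp add: R_def matrix_vector_mult_def sum_4 algebra_simps)
  qed
  have "R $ i $ 1 = 0 \<and> R $ i $ 2 = 0 \<and> R $ i $ 3 = 0 \<and> R $ i $ 4 = 0" for i
  proof -
    have 1: "R $ i $ 1 = 0" using R[of i 1 0] by simp
    have 4: "R $ i $ 4 = 0" using R[of i 0 1] by simp
    have a: "R $ i $ 2 + R $ i $ 3 = 0" using R[of i 1 1] 1 4 by simp
    have b: "R $ i $ 3 - R $ i $ 2 = 0" using R[of i "-1" 1] R[of i 1 "-1"] 1 4
      by (simp add: algebra_simps)
    have "2 * R $ i $ 3 = 0" using a b by (simp add: algebra_simps)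
    with a have "R $ i $ 3 = 0" "R $ i $ 2 = 0" by simp_all
    with 1 4 show ?thesis by simp
  qed
  then show ?thesis
    unfolding vec_eq_iff forall_4 by (simp add: R_def)
qed

lemma Sym3_cubic_monomials: "Sym3 X *v cubic_monomials v = cubic_monomials (X *v v)"
proof -
  have "\<exists>!S. \<forall>v. S *v cubic_monomials v = cubic_monomials (X *v v)"
    using Sym3_ex[of X] by (metis (no_types, lifting) Sym3_unique)
  from theI'[OF this] show ?thesis
    by (simp add: Sym3_def)
qed

definition Sym3_exponents :: "complex^2^2 \<Rightarrow> complex^4^4"
  where "Sym3_exponents L = (\<chi> i j.
    deriv (\<lambda>\<tau>. Sym3 (mat_exp (mat (2 * of_real pi * \<i> * \<tau>) ** L)) $ i $ j) 0 / (2 * of_real pi * \<i>))"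

end

theory Submission
  imports Defs "HOL-Complex_Analysis.Complex_Analysis"
begin

text \<open>Let \<open>X = (A, D A)\<close> be the \<open>2 \<times> 2\<close> Wronskian matrix. Since \<open>k\<^sub>1 + 1 = 6 Tr L\<close>, the functions
  \<open>det X\<^sup>6\<close> and \<open>\<Delta>\<^bsup>k\<^sub>1+1\<^esup>\<close> have the same weight, the same (trivial) character and the same order at the
  cusp, so their ratio is a nonzero constant and \<open>det X\<close> vanishes neither on the upper half plane nor,
  suitably normalised, at the cusp. Hence \<open>Sym3 (X\<inverse>) G\<close> has level one forms as components for every
  \<open>G\<close> in \<open>M(Sym\<^sup>3 \<alpha>, S\<^sup>3 L)\<close>, i.e. the columns of \<open>Sym3 X\<close> form a basis over \<open>\<complex>[E\<^sub>4, E\<^sub>6]\<close>. The same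
  argument for \<open>\<alpha>\<close> itself gives \<open>D\<^sup>2 A = c E\<^sub>4 A\<close>, and therefore \<open>F, D F, D\<^sup>2 F, D\<^sup>3 F\<close> arise from these
  columns by an invertible triangular matrix.

  The modularity of \<open>E\<^sub>2, E\<^sub>4, E\<^sub>6\<close> comes from the Taylor coefficients at \<open>0\<close> of the zeta function of a
  lattice, written as a Lambert series, and level one forms are treated with the maximum modulus
  principle in the disc \<open>|q| < 1\<close>, using that every orbit has a point with \<open>Im \<tau> \<ge> 1/2\<close>.\<close>

subsection \<open>Series in \<open>q\<close>\<close>

text \<open>The weight closes the argument: 6 Tr(L) = k_1 + 1 is an integer, so det \<alpha> takes
  sixth roots of unity as values on S and T, and det X, of weight 2 k_1 + 2, has a sixth power of
  weight 12 (k_1 + 1), that of \<Delta>^(k_1 + 1). Irreducibility of \<alpha> makes the components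
  of A independent, hence the Wronskian nonzero. The obstacle is the cusp: X itself has no
  q-expansion, only e^(-2 pi i L tau) X does, and it is the determinant of the latter that must not
  vanish at q = 0. The coordinates of a form are then pairings in which e^(2 pi i L tau) and e^(-2
  pi i L tau) cancel. This passes to the cube because Sym3 is multiplicative and Sym3 (e^(2 pi i L
  tau)) is the exponential attached to S^3 L. For G of weight l the coordinates have weights l - 3
  k_1 - 2 i with i = 0, ..., 3; as forms of negative weight vanish, this yields the minimal weight
  too. Working with a Lambert series instead of lattice sums avoids the conditional convergence
  behind E_2, whose failure to be modular becomes the linear term 2 pi i z / tau.\<close>

lemma qpar_add: "qpar (z + w) = qpar z * qpar w"
  by (simp add: qpar_def exp_add ring_distribs)

lemma qpar_nonzero [simp]: "qpar z \<noteq> 0"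
  by (simp add: qpar_def)

lemma qpar_0 [simp]: "qpar 0 = 1"
  by (simp add: qpar_def)

lemma qpar_minus: "qpar (- z) = inverse (qpar z)"
  by (simp add: qpar_def exp_minus)

lemma qpar_of_int [simp]: "qpar (of_int n) = 1"
  using exp_integer_2pi[of "of_int n"] by (simp add: qpar_def mult_ac)

lemma qpar_1 [simp]: "qpar 1 = 1"
  using qpar_of_int[of 1] by simp

lemma norm_qpar: "norm (qpar z) = exp (- 2 * pi * Im z)"
  by (simp add: qpar_def)

lemma norm_qpar_less_1: "norm (qpar z) < 1 \<longleftrightarrow> Im z > 0"
  by (simp add: norm_qpar zero_less_mult_iff)

lemma has_field_derivative_qpar [derivative_intros]:
  "(f has_field_derivative f') (at z within A) \<Longrightarrow>
   ((\<lambda>z. qpar (f z)) has_field_derivative (2 * of_real pi * \<i> * f' * qpar (f z))) (at z within A)"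
  unfolding qpar_def by (auto intro!: derivative_eq_intros)

lemma holomorphic_on_qpar [holomorphic_intros]:
  "f holomorphic_on A \<Longrightarrow> (\<lambda>z. qpar (f z)) holomorphic_on A"
  unfolding qpar_def by (intro holomorphic_intros)

lemma continuous_on_qpar [continuous_intros]:
  "continuous_on A f \<Longrightarrow> continuous_on A (\<lambda>z. qpar (f z))"
  unfolding qpar_def by (intro continuous_intros)

lemma qpar_surj:
  assumes "x \<noteq> 0" "norm x < 1"
  obtains \<tau> where "Im \<tau> > 0" "qpar \<tau> = x"
proof -
  define \<tau> where "\<tau> = Ln x / (2 * of_real pi * \<i>)"
  have "qpar \<tau> = x"
    using assms(1) by (simp add: qpar_def \<tau>_def)
  moreover from this have "Im \<tau> > 0"
    using assms(2) norm_qpar_less_1[of \<tau>] by simp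
  ultimately show ?thesis using that by blast
qed

lemma open_upper_half_plane [simp]: "open {\<tau>. Im \<tau> > 0}"
  by (rule open_halfspace_Im_gt)

lemma convex_upper_half_plane [simp]: "convex {\<tau>. Im \<tau> > 0}"
  by (rule convex_halfspace_Im_gt)

lemma Im_minus_inverse: "Im (- 1 / \<tau>) = Im \<tau> / (norm \<tau>)\<^sup>2"
  by (simp add: Im_divide cmod_power2)

lemma Im_minus_inverse_pos: "Im \<tau> > 0 \<Longrightarrow> Im (- 1 / \<tau>) > 0"
  unfolding Im_minus_inverse by (rule divide_pos_pos) auto

lemma summable_mult_of_nat_powser:
  fixes a :: "nat \<Rightarrow> complex"
  assumes "\<And>x. norm x < R \<Longrightarrow> summable (\<lambda>m. a m * x ^ m)" "norm x < R"
  shows "summable (\<lambda>m. of_nat m * a m * x ^ m)"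
proof -
  have "summable (\<lambda>m. diffs a m * x ^ m)"
    using termdiff_converges[of x R a] assms by blast
  hence "summable (\<lambda>m. diffs a m * x ^ m * x)"
    by (rule summable_mult2)
  hence "summable (\<lambda>m. of_nat (Suc m) * a (Suc m) * x ^ Suc m)"
    by (simp add: diffs_def mult_ac)
  thus ?thesis by (subst (asm) summable_Suc_iff)
qed

text \<open>On a series in \<open>qpar z\<close> the derivative acts as 2 pi i x d/dx. The radius
  \<open>R\<close> is left free because the Lambert series below are expanded at z = 0, where
  \<open>qpar z\<close> = 1 lies inside their disc of radius exp (2 pi Im \<tau>) but not inside the
  unit disc.\<close>

lemma has_field_derivative_qpar_series:
  fixes a :: "nat \<Rightarrow> complex"
  assumes sm: "\<And>x. norm x < R \<Longrightarrow> summable (\<lambda>m. a m * x ^ m)" and z: "norm (qpar z) < R"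
  shows "((\<lambda>z. \<Sum>m. a m * qpar z ^ m) has_field_derivative
           2 * of_real pi * \<i> * (\<Sum>m. of_nat m * a m * qpar z ^ m)) (at z)"
proof -
  have 1: "((\<lambda>x. \<Sum>m. a m * x ^ m) has_field_derivative (\<Sum>m. diffs a m * qpar z ^ m)) (at (qpar z))"
    using termdiffs_strong'[of R a "qpar z"] assms by blast
  have 2: "(\<Sum>m. diffs a m * qpar z ^ m) * qpar z = (\<Sum>m. of_nat m * a m * qpar z ^ m)"
  proof -
    have "summable (\<lambda>m. diffs a m * qpar z ^ m)"
      using termdiff_converges[of "qpar z" R a] assms by blast
    hence "(\<Sum>m. diffs a m * qpar z ^ m) * qpar z = (\<Sum>m. diffs a m * qpar z ^ m * qpar z)"
      by (rule suminf_mult2)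
    also have "\<dots> = (\<Sum>m. of_nat (Suc m) * a (Suc m) * qpar z ^ Suc m)"
      by (simp add: diffs_def mult_ac)
    also have "\<dots> = (\<Sum>m. of_nat m * a m * qpar z ^ m)"
      using suminf_split_head[OF summable_mult_of_nat_powser[OF sm z]] by simp
    finally show ?thesis .
  qed
  have "((\<lambda>z. \<Sum>m. a m * qpar z ^ m) has_field_derivative
     (\<Sum>m. diffs a m * qpar z ^ m) * (2 * of_real pi * \<i> * 1 * qpar z)) (at z)"
    by (rule DERIV_chain2[where f = "\<lambda>x. \<Sum>m. a m * x ^ m" and g = qpar, OF 1])
       (auto intro!: derivative_eq_intros)
  thus ?thesis unfolding 2[symmetric] by (simp add: mult_ac)
qed

lemma higher_deriv_qpar_series:
  fixes a :: "nat \<Rightarrow> complex"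
  assumes "\<And>x. norm x < R \<Longrightarrow> summable (\<lambda>m. a m * x ^ m)" "norm (qpar z) < R"
  shows "(deriv ^^ n) (\<lambda>z. \<Sum>m. a m * qpar z ^ m) z =
           (2 * of_real pi * \<i>) ^ n * (\<Sum>m. of_nat m ^ n * a m * qpar z ^ m)"
  using assms
proof (induction n arbitrary: a z)
  case (Suc n)
  let ?c = "2 * of_real pi * \<i> :: complex"
  have op: "open {z. norm (qpar z) < R}"
    by (intro open_Collect_less continuous_intros)
  have sm': "summable (\<lambda>m. of_nat m * a m * x ^ m)" if "norm x < R" for x
    using summable_mult_of_nat_powser[OF Suc.prems(1) that] by blast
  have an: "(\<lambda>z. \<Sum>m. of_nat m * a m * qpar z ^ m) analytic_on {z}"
  proof -
    have "(\<lambda>z. \<Sum>m. of_nat m * a m * qpar z ^ m) holomorphic_on {z. norm (qpar z) < R}"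
      unfolding holomorphic_on_open[OF op]
      by (intro ballI exI, rule has_field_derivative_qpar_series[of R "\<lambda>m. of_nat m * a m", OF sm']) auto
    thus ?thesis unfolding analytic_at using op Suc.prems(2) by blast
  qed
  have "(deriv ^^ Suc n) (\<lambda>z. \<Sum>m. a m * qpar z ^ m) z =
        (deriv ^^ n) (deriv (\<lambda>z. \<Sum>m. a m * qpar z ^ m)) z"
    by (simp add: funpow_Suc_right del: funpow.simps)
  also have "\<dots> = (deriv ^^ n) (\<lambda>z. ?c * (\<Sum>m. of_nat m * a m * qpar z ^ m)) z"
  proof (rule higher_deriv_cong_ev)
    have "eventually (\<lambda>z. z \<in> {z. norm (qpar z) < R}) (nhds z)"
      using op Suc.prems(2) by (intro eventually_nhds_in_open) auto
    thus "\<forall>\<^sub>F z in nhds z. deriv (\<lambda>z. \<Sum>m. a m * qpar z ^ m) z =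
              ?c * (\<Sum>m. of_nat m * a m * qpar z ^ m)"
      by eventually_elim (simp add: DERIV_imp_deriv[OF has_field_derivative_qpar_series[OF Suc.prems(1)]])
  qed auto
  also have "\<dots> = ?c * (deriv ^^ n) (\<lambda>z. \<Sum>m. of_nat m * a m * qpar z ^ m) z"
    by (rule higher_deriv_cmult'[OF an])
  also have "\<dots> = ?c * (?c ^ n * (\<Sum>m. of_nat m ^ n * (of_nat m * a m) * qpar z ^ m))"
    using Suc.IH[of "\<lambda>m. of_nat m * a m" z] sm' Suc.prems(2) by simp
  finally show ?case by (simp add: mult_ac)
qed auto

lemma divisor_sum_le: "(\<Sum>d | d dvd Suc n. d ^ r) \<le> Suc n ^ (r + 1)"
proof -
  have "{d. d dvd Suc n} \<subseteq> {1..Suc n}"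
    using dvd_imp_le[of _ "Suc n"] dvd_pos_nat[of "Suc n"] by (auto simp: Suc_le_eq)
  hence "(\<Sum>d | d dvd Suc n. d ^ r) \<le> (\<Sum>d = 1..Suc n. d ^ r)"
    by (intro sum_mono2) auto
  also have "\<dots> \<le> (\<Sum>d = 1..Suc n. Suc n ^ r)"
    by (intro sum_mono power_mono) auto
  finally show ?thesis by simp
qed

lemma summable_power_powser:
  fixes x :: complex
  assumes "norm x < 1"
  shows "summable (\<lambda>m. of_nat m ^ r * x ^ m)"
proof -
  have "\<forall>x::complex. norm x < 1 \<longrightarrow> summable (\<lambda>m. of_nat m ^ r * x ^ m)"
  proof (induction r)
    case (Suc r)
    show ?case
      using summable_mult_of_nat_powser[of 1 "\<lambda>m. of_nat m ^ r"] Suc by (simp add: mult_ac)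
  qed (auto intro: summable_geometric)
  thus ?thesis using assms by blast
qed

lemma norm_summable_divisor_series:
  fixes q :: complex
  assumes "norm q < 1"
  shows "summable (\<lambda>n. norm (of_nat (\<Sum>d | d dvd Suc n. d ^ r) * q ^ Suc n))"
proof -
  have "summable (\<lambda>m. norm (of_nat m ^ (r + 1) * q ^ m))"
  proof -
    have "summable (\<lambda>m. of_nat m ^ (r + 1) * complex_of_real (norm q) ^ m)"
      using assms by (intro summable_power_powser) auto
    hence "summable (\<lambda>m. complex_of_real (of_nat m ^ (r + 1) * norm q ^ m))"
      by simp
    hence "summable (\<lambda>m. of_nat m ^ (r + 1) * norm q ^ m)"
      by (simp only: summable_complex_of_real)
    thus ?thesis by (simp add: norm_mult norm_power)
  qed
  hence s: "summable (\<lambda>n. norm (of_nat (Suc n) ^ (r + 1) * q ^ Suc n))"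
    by (subst summable_Suc_iff)
  show ?thesis
  proof (rule summable_comparison_test'[OF s])
    fix n :: nat
    have "real (\<Sum>d | d dvd Suc n. d ^ r) \<le> real (Suc n ^ (r + 1))"
      using divisor_sum_le by (subst of_nat_le_iff)
    thus "norm (norm (complex_of_nat (\<Sum>d | d dvd Suc n. d ^ r) * q ^ Suc n))
            \<le> norm (complex_of_nat (Suc n) ^ (r + 1) * q ^ Suc n)"
      unfolding real_norm_def abs_mult abs_norm_cancel norm_mult norm_of_nat of_nat_power[symmetric]
        abs_of_nat
      by (rule mult_right_mono) (rule norm_ge_zero)
  qed
qed

lemma suminf_eq_infsum_atLeast_1:
  fixes f :: "nat \<Rightarrow> complex"
  assumes "summable (\<lambda>n. norm (f (Suc n)))"
  shows "(\<Sum>n. f (Suc n)) = infsum f {1..}"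
proof -
  have "infsum (\<lambda>n. f (Suc n)) UNIV = (\<Sum>n. f (Suc n))"
    by (rule infsumI, rule norm_summable_imp_has_sum[OF assms summable_sums[OF summable_norm_cancel[OF assms]]])
  moreover have "infsum (\<lambda>n. f (Suc n)) UNIV = infsum f {1..}"
    by (rule infsum_reindex_bij_witness[of _ "\<lambda>n. n - 1" Suc]) auto
  ultimately show ?thesis by simp
qed

text \<open>Both sides rearrange the double series of m^r q^(m j) over m, j >= 1: summing over j
  first gives geometric series, collecting the pairs with m j = N gives divisor sums. Absolute
  summability is proved on the divisor side, where the inner sums are finite, and carried over by
  the bijection sending (m, j) to (m j, m).\<close>

lemma Lambert_series:
  fixes q :: complex
  assumes q: "norm q < 1"
  shows "(\<Sum>m. of_nat m ^ r * (q ^ m / (1 - q ^ m))) =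
         (\<Sum>n. of_nat (\<Sum>d | d dvd Suc n. d ^ r) * q ^ Suc n)"
proof -
  define g :: "nat \<times> nat \<Rightarrow> complex" where "g = (\<lambda>(N, d). of_nat d ^ r * q ^ N)"
  define h :: "nat \<times> nat \<Rightarrow> complex" where "h = (\<lambda>(m, j). of_nat m ^ r * q ^ (m * j))"
  have fin: "finite {d. d dvd N}" if "N \<in> {1..}" for N :: nat
    using that by (intro finite_divisors_nat) auto
  have inner: "infsum (\<lambda>d. g (N, d)) {d. d dvd N} = of_nat (\<Sum>d | d dvd N. d ^ r) * q ^ N"
    if "N \<in> {1..}" for N
    using fin[OF that] by (simp add: g_def sum_distrib_right)
  have inner': "infsum (\<lambda>d. norm (g (N, d))) {d. d dvd N} =
                norm (of_nat (\<Sum>d | d dvd N. d ^ r) * q ^ N)" if "N \<in> {1..}" for N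
  proof -
    have "infsum (\<lambda>d. norm (g (N, d))) {d. d dvd N} = (\<Sum>d | d dvd N. norm (g (N, d)))"
      by (rule infsum_finite[OF fin[OF that]])
    also have "\<dots> = (\<Sum>d | d dvd N. real (d ^ r) * norm (q ^ N))"
      by (simp add: g_def norm_mult norm_power)
    also have "\<dots> = real (\<Sum>d | d dvd N. d ^ r) * norm (q ^ N)"
      by (simp only: of_nat_sum sum_distrib_right)
    also have "\<dots> = norm (of_nat (\<Sum>d | d dvd N. d ^ r) * q ^ N)"
      by (simp only: norm_mult norm_of_nat)
    finally show ?thesis .
  qed
  have "(\<lambda>N. norm (of_nat (\<Sum>d | d dvd N. d ^ r) * q ^ N)) summable_on {1..}"
  proof -
    have "(\<lambda>n. norm (of_nat (\<Sum>d | d dvd Suc n. d ^ r) * q ^ Suc n)) summable_on UNIV"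
      using norm_summable_divisor_series[OF q, of r] by (intro norm_summable_imp_summable_on) simp
    thus ?thesis
      by (subst (asm) summable_on_reindex_bij_betw[where g = Suc and B = "{1..}" and
             f = "\<lambda>N. norm (of_nat (\<Sum>d | d dvd N. d ^ r) * q ^ N)"])
         (rule bij_betwI[of _ _ _ "\<lambda>n. n - 1"]; simp)
  qed
  moreover have "norm (infsum (\<lambda>d. norm (g (N, d))) {d. d dvd N}) =
      norm (of_nat (\<Sum>d | d dvd N. d ^ r) * q ^ N)" if "N \<in> {1..}" for N
    unfolding inner'[OF that] real_norm_def abs_norm_cancel ..
  ultimately have outer: "(\<lambda>N. norm (infsum (\<lambda>d. norm (g (N, d))) {d. d dvd N})) summable_on {1..}"
    by (subst summable_on_cong)
  have abs: "(\<lambda>x. norm (g x)) summable_on (SIGMA N:{1..}. {d. d dvd N})"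
    unfolding Infinite_Sum.abs_summable_on_Sigma_iff
  proof (intro conjI ballI outer)
    fix N :: nat assume "N \<in> {1..}"
    thus "(\<lambda>d. norm (g (N, d))) summable_on {d. d dvd N}"
      by (rule summable_on_finite[OF fin])
  qed
  have sg: "g summable_on (SIGMA N:{1..}. {d. d dvd N})"
    by (rule Infinite_Sum.abs_summable_summable[OF abs])
  have bij: "bij_betw (\<lambda>(m::nat, j). (m * j, m)) ({1..} \<times> {1..}) (SIGMA N:{1..}. {d. d dvd N})"
  proof (rule bij_betwI[where g = "\<lambda>(N, d). (d, N div d)"])
    show "(\<lambda>(N::nat, d). (d, N div d)) \<in> (SIGMA N:{1..}. {d. d dvd N}) \<rightarrow> {1..} \<times> {1..}"
      by (auto elim!: dvdE)
  qed auto
  have h_g: "h = (\<lambda>x. g ((\<lambda>(m, j). (m * j, m)) x))"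
    by (auto simp: h_def g_def)
  have sh: "h summable_on ({1..} \<times> {1..})"
    unfolding h_g using summable_on_reindex_bij_betw[OF bij, of g] sg by simp
  have inf_hg: "infsum h ({1..} \<times> {1..}) = infsum g (SIGMA N:{1..}. {d. d dvd N})"
    unfolding h_g by (rule infsum_reindex_bij_betw[OF bij])
  have geo: "infsum (\<lambda>j. h (m, j)) {1..} = of_nat m ^ r * (q ^ m / (1 - q ^ m))"
    if "m \<in> {1..}" for m
  proof -
    have m: "norm (q ^ m) < 1"
      using q that by (simp add: norm_power power_less_one_iff)
    have "summable (\<lambda>n. norm ((q ^ m) ^ n))"
      using m by (simp add: norm_power summable_geometric)
    hence "summable (\<lambda>n. norm (of_nat m ^ r * q ^ m) * norm ((q ^ m) ^ n))"
      by (rule summable_mult)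
    hence s: "summable (\<lambda>n. norm (h (m, Suc n)))"
      by (simp add: h_def norm_mult norm_power power_mult power_add mult_ac)
    have "infsum (\<lambda>j. h (m, j)) {1..} = (\<Sum>n. h (m, Suc n))"
      using suminf_eq_infsum_atLeast_1[OF s] by simp
    also have "\<dots> = (\<Sum>n. (of_nat m ^ r * q ^ m) * (q ^ m) ^ n)"
      by (simp add: h_def power_mult power_add mult_ac)
    also have "\<dots> = (of_nat m ^ r * q ^ m) * (1 / (1 - q ^ m))"
      using m by (subst suminf_mult) (auto simp: suminf_geometric summable_geometric)
    finally show ?thesis by simp
  qed
  have "(\<Sum>n. of_nat (\<Sum>d | d dvd Suc n. d ^ r) * q ^ Suc n) =
        infsum (\<lambda>N. of_nat (\<Sum>d | d dvd N. d ^ r) * q ^ N) {1..}"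
    by (rule suminf_eq_infsum_atLeast_1[of "\<lambda>N. of_nat (\<Sum>d | d dvd N. d ^ r) * q ^ N"])
       (rule norm_summable_divisor_series[OF q])
  also have "\<dots> = infsum (\<lambda>N. infsum (\<lambda>d. g (N, d)) {d. d dvd N}) {1..}"
    by (intro infsum_cong inner[symmetric])
  also have "\<dots> = infsum g (SIGMA N:{1..}. {d. d dvd N})"
    by (rule infsum_Sigma_banach[OF sg])
  also have "\<dots> = infsum h ({1..} \<times> {1..})" by (rule inf_hg[symmetric])
  also have "\<dots> = infsum (\<lambda>m. infsum (\<lambda>j. h (m, j)) {1..}) {1..}"
    by (rule infsum_Sigma_banach[OF sh, symmetric])
  also have "\<dots> = infsum (\<lambda>m. of_nat m ^ r * (q ^ m / (1 - q ^ m))) {1..}"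
    by (intro infsum_cong geo)
  also have "\<dots> = (\<Sum>m. of_nat m ^ r * (q ^ m / (1 - q ^ m)))"
    (is "infsum ?f _ = _")
  proof -
    have "?f summable_on {1..}"
    proof -
      have "(\<lambda>m. infsum (\<lambda>j. h (m, j)) {1..}) summable_on {1..}"
        by (rule summable_on_Sigma_banach) (use sh in simp)
      thus ?thesis by (subst (asm) summable_on_cong[OF geo])
    qed
    \<comment> \<open>Index 0 contributes nothing, since q^0 / (1 - q^0) = 1 / 0 = 0.\<close>
    moreover have "infsum ?f {1..} = infsum ?f UNIV"
      by (rule infsum_cong_neutral) (auto simp: not_le)
    moreover have "?f summable_on {1..} \<longleftrightarrow> ?f summable_on UNIV"
      by (rule summable_on_cong_neutral) (auto simp: not_le)
    ultimately have "?f sums infsum ?f {1..}"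
      using has_sum_imp_sums[OF has_sum_infsum, of ?f] by simp
    thus ?thesis by (rule sums_unique)
  qed
  finally show ?thesis ..
qed

subsection \<open>The inversion formulas for Eisenstein series\<close>

text \<open>For m >= 1 the denominators are at least 1 - |q| in absolute value, which leaves a
  geometric series in x q. For m = 0 the quotient is 1 / 0 = 0.\<close>

lemma norm_summable_geometric_quotient:
  fixes q x :: complex
  assumes q: "norm q < 1" and x: "norm (x * q) < 1"
  shows "summable (\<lambda>m. q ^ m / (1 - q ^ m) * x ^ m)"
proof (rule summable_comparison_test')
  show "summable (\<lambda>m. 1 / (1 - norm q) * norm (x * q) ^ m)"
    using x by (intro summable_mult summable_geometric) auto
  fix m :: nat
  show "norm (q ^ m / (1 - q ^ m) * x ^ m) \<le> 1 / (1 - norm q) * norm (x * q) ^ m"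
  proof (cases "m = 0")
    case False
    hence "norm q ^ m \<le> norm q"
      using q by (metis less_eq_real_def norm_ge_zero power_decreasing power_one_right One_nat_def Suc_leI neq0_conv)
    hence "1 - norm q \<le> norm (1 - q ^ m)"
      using norm_triangle_ineq2[of 1 "q ^ m"] by (simp add: norm_power)
    hence "norm (x * q) ^ m / norm (1 - q ^ m) \<le> norm (x * q) ^ m / (1 - norm q)"
      using q by (intro divide_left_mono mult_pos_pos) auto
    thus ?thesis by (simp add: norm_mult norm_divide norm_power power_mult_distrib mult_ac)
  qed (use q in auto)
qed

text \<open>Passing from y to y q multiplies the m-th term by q^m, so the difference cancels the
  denominator 1 - q^m and leaves a geometric series starting at m = 1. For y = \<open>qpar z\<close>
  this is the translation of z by \<tau>.\<close>

lemma geometric_quotient_shift: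
  fixes q y :: complex
  assumes q: "norm q < 1" and y: "norm (y * q) < 1"
  shows "(\<Sum>m. q ^ m / (1 - q ^ m) * y ^ m) - (\<Sum>m. q ^ m / (1 - q ^ m) * (y * q) ^ m) =
           y * q / (1 - y * q)"
proof -
  have "norm (y * q * q) \<le> norm (y * q)"
    using q by (simp add: norm_mult mult_left_le)
  hence yq: "norm (y * q * q) < 1" using y by linarith
  have "(\<Sum>m. q ^ m / (1 - q ^ m) * y ^ m) - (\<Sum>m. q ^ m / (1 - q ^ m) * (y * q) ^ m) =
        (\<Sum>m. q ^ m / (1 - q ^ m) * y ^ m - q ^ m / (1 - q ^ m) * (y * q) ^ m)"
    by (rule suminf_diff norm_summable_geometric_quotient q y yq)+
  also have "\<dots> = (\<Sum>m. if m = 0 then 0 else (y * q) ^ m)"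
  proof (rule suminf_cong)
    fix m :: nat
    show "q ^ m / (1 - q ^ m) * y ^ m - q ^ m / (1 - q ^ m) * (y * q) ^ m =
            (if m = 0 then 0 else (y * q) ^ m)"
    proof (cases "m = 0")
      case False
      hence "norm (q ^ m) < 1" using q by (simp add: norm_power power_less_one_iff)
      hence "1 - q ^ m \<noteq> 0" by auto
      thus ?thesis using False by (simp add: divide_simps power_mult_distrib) (simp add: algebra_simps)
    qed auto
  qed
  also have "\<dots> = (\<Sum>m. (y * q) ^ Suc m)"
  proof -
    have "summable (\<lambda>m. if m = 0 then 0 else (y * q) ^ m)"
      by (subst summable_Suc_iff[symmetric]) (use y in \<open>auto intro!: summable_mult summable_geometric\<close>)
    from suminf_split_head[OF this] show ?thesis by simp
  qed
  also have "\<dots> = y * q * (\<Sum>m. (y * q) ^ m)"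
    using y by (simp only: power_Suc) (intro suminf_mult summable_geometric)
  finally show ?thesis using y by (simp add: suminf_geometric)
qed

section \<open>The cotangent and its Taylor coefficients\<close>

lemma pi_cot_eq:
  assumes "sin (of_real pi * z) \<noteq> 0"
  shows "of_real pi * cos (of_real pi * z) / sin (of_real pi * z) =
           - of_real pi * \<i> - 2 * of_real pi * \<i> * (qpar z / (1 - qpar z))"
    and "qpar z \<noteq> 1"
proof -
  define e where "e = exp (\<i> * (of_real pi * z))"
  have e: "e \<noteq> 0" by (simp add: e_def)
  have q: "qpar z = e ^ 2"
    by (simp add: qpar_def e_def power2_eq_square exp_add[symmetric] mult_ac)
  have s: "sin (of_real pi * z) = (e - 1 / e) / (2 * \<i>)"
    by (simp add: sin_exp_eq e_def exp_minus field_simps)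
  have c: "cos (of_real pi * z) = (e + 1 / e) / 2"
    by (simp add: cos_exp_eq e_def exp_minus field_simps)
  show "qpar z \<noteq> 1"
    using assms e unfolding q s by (auto simp: field_simps power2_eq_square)
  hence "e ^ 2 \<noteq> 1" unfolding q .
  hence ne: "1 - e ^ 2 \<noteq> 0" "e * e \<noteq> 1" by (auto simp: power2_eq_square)
  have "of_real pi * cos (of_real pi * z) / sin (of_real pi * z) =
        of_real pi * \<i> * (e ^ 2 + 1) / (e ^ 2 - 1)"
    unfolding s c using e ne by (simp add: divide_simps) (simp add: algebra_simps power2_eq_square)
  also have "\<dots> = - of_real pi * \<i> - 2 * of_real pi * \<i> * (e ^ 2 / (1 - e ^ 2))"
    using ne by (simp add: divide_simps) (simp add: algebra_simps power2_eq_square)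
  finally show "of_real pi * cos (of_real pi * z) / sin (of_real pi * z) =
           - of_real pi * \<i> - 2 * of_real pi * \<i> * (qpar z / (1 - qpar z))"
    unfolding q .
qed

text \<open>The coefficients come from the Riccati equation \<open>z k' + 2 k + z k\<^sup>2 + \<pi>\<^sup>2 z = 0\<close> satisfied by
  \<open>k z = \<pi> cot (\<pi> z) - 1 / z\<close>.\<close>

lemma pi_cot_expansion:
  defines "V \<equiv> {z. z = 0 \<or> sin (of_real pi * z) \<noteq> 0}"
  obtains k :: "complex \<Rightarrow> complex" where
    "k holomorphic_on V" "open V"
    "\<And>z. sin (of_real pi * z) \<noteq> 0 \<Longrightarrow>
        of_real pi * cos (of_real pi * z) / sin (of_real pi * z) = 1 / z + k z"
    "deriv k 0 = - (of_real pi ^ 2 / 3)"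
    "(deriv ^^ 3) k 0 = - (2 * of_real pi ^ 4 / 15)"
    "(deriv ^^ 5) k 0 = - (16 * of_real pi ^ 6 / 63)"
proof -
  let ?p = "of_real pi :: complex"
  \<comment> \<open>\<open>s\<close> is sin (pi z) / z with its removable singularity filled in, so
    \<open>b\<close> below is z pi cot (pi z), with value 1 at 0. Its difference quotient at 0 is
    the cotangent without the pole 1 / z.\<close>
  define s where "s = (\<lambda>z. if z = 0 then deriv (\<lambda>z. sin (?p * z)) 0
                           else (sin (?p * z) - sin (?p * 0)) / (z - 0))"
  have s_holo: "s holomorphic_on UNIV"
    unfolding s_def by (intro pole_lemma_open holomorphic_intros) auto
  have "((\<lambda>z. sin (?p * z)) has_field_derivative ?p) (at 0)"
    by (auto intro!: derivative_eq_intros)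
  hence s0: "s 0 = ?p" by (simp add: s_def DERIV_imp_deriv)
  have s_nz: "s z = sin (?p * z) / z" if "z \<noteq> 0" for z
    using that by (simp add: s_def)
  have V_eq: "V = {z. s z \<noteq> 0}"
  proof -
    have "z = 0 \<or> sin (?p * z) \<noteq> 0 \<longleftrightarrow> s z \<noteq> 0" for z
      by (cases "z = 0") (simp_all add: s0 s_nz)
    thus ?thesis by (simp add: V_def)
  qed
  have cont_s: "continuous_on UNIV s"
    using s_holo by (rule holomorphic_on_imp_continuous_on)
  have V: "open V"
    unfolding V_eq by (intro open_Collect_neq cont_s continuous_intros)
  define b where "b = (\<lambda>z. ?p * cos (?p * z) / s z)"
  have b_holo: "b holomorphic_on V"
    unfolding b_def by (intro holomorphic_intros holomorphic_on_subset[OF s_holo]) (auto simp: V_eq)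
  define k where "k = (\<lambda>z. if z = 0 then deriv b 0 else (b z - b 0) / (z - 0))"
  have k_holo: "k holomorphic_on V"
    unfolding k_def by (intro pole_lemma_open b_holo V)
  have b0: "b 0 = 1" by (simp add: b_def s0)
  have k_eq: "?p * cos (?p * z) / sin (?p * z) = 1 / z + k z" if "sin (?p * z) \<noteq> 0" for z
  proof -
    have "z \<noteq> 0" using that by auto
    thus ?thesis by (simp add: k_def b0, simp add: b_def s_nz diff_divide_distrib)
  qed
  have V0: "0 \<in> V" by (simp add: V_def)
  define \<phi> where "\<phi> = (\<lambda>z. z * deriv k z + 2 * k z + z * (k z * k z) + ?p ^ 2 * z)"
  have phi_nz: "\<phi> z = 0" if z: "z \<in> V" "z \<noteq> 0" for z
  proof -
    have sz: "sin (?p * z) \<noteq> 0" using z by (simp add: V_def)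
    define S C where "S = sin (?p * z)" and "C = cos (?p * z)"
    have d: "((\<lambda>z. ?p * cos (?p * z) / sin (?p * z) - 1 / z) has_field_derivative
            ((- (?p * ?p * S * S) - ?p * ?p * C * C) / (S * S) + 1 / (z * z))) (at z)"
      using sz z unfolding S_def C_def by (auto intro!: derivative_eq_intros)
    have "eventually (\<lambda>w. w \<in> V - {0}) (nhds z)"
      using V z by (intro eventually_nhds_in_open) auto
    hence ev: "eventually (\<lambda>w. ?p * cos (?p * w) / sin (?p * w) - 1 / w = k w) (nhds z)"
    proof eventually_elim
      case (elim w)
      hence "sin (?p * w) \<noteq> 0" by (auto simp: V_def)
      from k_eq[OF this] show ?case by simp
    qed
    have "(k has_field_derivative ((- (?p * ?p * S * S) - ?p * ?p * C * C) / (S * S) + 1 / (z * z))) (at z)"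
      by (rule DERIV_cong_ev[OF refl ev refl, THEN iffD1, OF d])
    hence dk: "deriv k z = (- (?p * ?p * S * S) - ?p * ?p * C * C) / (S * S) + 1 / (z * z)" by (rule DERIV_imp_deriv)
    have kz: "k z = ?p * C / S - 1 / z"
      using k_eq[OF sz] by (simp add: S_def C_def)
    have "S \<noteq> 0" using sz by (simp add: S_def)
    thus ?thesis using z unfolding \<phi>_def dk kz
      by (simp add: divide_simps) (simp add: power2_eq_square algebra_simps)
  qed
  have phi_cont: "isCont \<phi> 0"
  proof -
    have "\<phi> holomorphic_on V"
      unfolding \<phi>_def by (intro holomorphic_intros k_holo V)
    thus ?thesis using V V0 by (meson continuous_on_eq_continuous_at holomorphic_on_imp_continuous_on)
  qed
  have phi0: "\<phi> 0 = 0"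
  proof -
    have "eventually (\<lambda>z. z \<in> V) (nhds 0)" using V V0 by (rule eventually_nhds_in_open)
    hence "eventually (\<lambda>z. \<phi> z = 0) (at 0)"
      unfolding eventually_at_filter by eventually_elim (simp add: phi_nz)
    hence "\<phi> \<midarrow>0\<rightarrow> 0" by (rule tendsto_eventually)
    with phi_cont show ?thesis unfolding isCont_def by (rule LIM_unique)
  qed
  define K where "K = fps_expansion k 0"
  have K: "k has_fps_expansion K"
    unfolding K_def using V V0 k_holo by blast
  have "\<phi> has_fps_expansion fps_X * fps_deriv K + 2 * K + fps_X * (K * K) + fps_const (?p ^ 2) * fps_X"
    unfolding \<phi>_def by (intro fps_expansion_intros K)
  moreover have "\<phi> has_fps_expansion 0"
  proof -
    have "eventually (\<lambda>z. z \<in> V) (nhds 0)" using V V0 by (rule eventually_nhds_in_open)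
    hence "eventually (\<lambda>z. \<phi> z = 0) (nhds 0)"
    proof eventually_elim
      case (elim z)
      thus ?case using phi_nz phi0 by (cases "z = 0") auto
    qed
    thus ?thesis by (simp add: has_fps_expansion_0_iff)
  qed
  ultimately have eq: "fps_X * fps_deriv K + 2 * K + fps_X * (K * K) + fps_const (?p ^ 2) * fps_X = 0"
    by (rule fps_expansion_unique_complex)
  let ?k = "fps_nth K"
  \<comment> \<open>This is the coefficient of z^n in the Riccati equation. The products only
    involve smaller indices, so the coefficients are determined one after the other.\<close>
  have nth: "(of_nat n + 2) * ?k n + (if n = 0 then 0 else \<Sum>i=0..n-1. ?k i * ?k (n - 1 - i)) +
               (if n = 1 then ?p ^ 2 else 0) = 0" for n
  proof -
    have "fps_nth (fps_X * fps_deriv K + 2 * K + fps_X * (K * K) + fps_const (?p ^ 2) * fps_X) n = 0"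
      unfolding eq by simp
    moreover have "fps_nth (fps_X * fps_deriv K) n = of_nat n * ?k n" by (cases n) simp_all
    moreover have "fps_nth (2 * K) n = 2 * ?k n" by (simp add: numeral_fps_const)
    moreover have "fps_nth (fps_X * (K * K)) n =
        (if n = 0 then 0 else \<Sum>i=0..n-1. ?k i * ?k (n - 1 - i))"
      by (simp only: fps_X_mult_nth fps_mult_nth[of K K])
    moreover have "fps_nth (fps_const (?p ^ 2) * fps_X) n = (if n = 1 then ?p ^ 2 else 0)"
      by (simp add: fps_X_def)
    ultimately show ?thesis by (simp add: ring_distribs)
  qed
  have atm: "{0..1::nat} = {0, 1}" "{0..2::nat} = {0, 1, 2}" "{0..3::nat} = {0, 1, 2, 3}"
    "{0..4::nat} = {0, 1, 2, 3, 4}"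
    by auto
  have k0: "?k 0 = 0" using nth[of 0] by simp
  have k1: "3 * ?k 1 + ?p ^ 2 = 0" using nth[of 1] k0 by simp
  have k2: "?k 2 = 0" using nth[of 2] k0 by (simp add: atm)
  have k3: "5 * ?k 3 + ?k 1 * ?k 1 = 0" using nth[of 3] k0 k2 by (simp add: atm)
  have k4: "?k 4 = 0" using nth[of 4] k0 k2 by (simp add: atm)
  have k5: "7 * ?k 5 + 2 * (?k 1 * ?k 3) = 0" using nth[of 5] k0 k2 k4 by (simp add: atm)
  have c1: "?k 1 = - (?p ^ 2 / 3)" using k1 by (simp add: field_simps eq_neg_iff_add_eq_0)
  have c3: "?k 3 = - (?p ^ 4 / 45)" using k3 unfolding c1
    by (simp add: field_simps eq_neg_iff_add_eq_0 power2_eq_square power4_eq_xxxx)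
  have c5: "?k 5 = - (2 * ?p ^ 6 / 945)" using k5 unfolding c1 c3
    by (simp add: field_simps eq_neg_iff_add_eq_0 flip: power_add)
  have "(deriv ^^ n) k 0 = fact n * ?k n" for n
    using fps_nth_fps_expansion[OF K, of n] by simp
  from this[of 1] this[of 3] this[of 5] c1 c3 c5
  have "deriv k 0 = - (?p ^ 2 / 3)" "(deriv ^^ 3) k 0 = - (2 * ?p ^ 4 / 15)"
    "(deriv ^^ 5) k 0 = - (16 * ?p ^ 6 / 63)"
    by (simp_all add: fact_numeral)
  thus ?thesis using that[OF k_holo V k_eq] by simp
qed

text \<open>\<open>s\<close> and \<open>t\<close> are the real coordinates in z = s + t \<tau>.
  Translations by 1 and \<tau> bring every nonzero point of \<open>U\<close> into the compact part
  |s|, |t| <= 1/2, so |f| has its maximum over the open set \<open>U\<close> there and the maximum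
  modulus principle applies. Periodicity is asked for only away from 0 because in the application it
  is derived from functions with a pole at 0, which cancels only in the combination
  \<open>f\<close>.\<close>

lemma doubly_periodic_constant:
  fixes f :: "complex \<Rightarrow> complex" and \<tau> :: complex
  defines "t \<equiv> (\<lambda>z. Im z / Im \<tau>)" and "s \<equiv> (\<lambda>z. Re z - Im z / Im \<tau> * Re \<tau>)"
  defines "U \<equiv> {z. \<bar>s z\<bar> < 1 \<and> \<bar>t z\<bar> < 1}"
  assumes \<tau>: "Im \<tau> > 0" and f: "f holomorphic_on U"
    and p1: "\<And>z. z \<in> U \<Longrightarrow> z + 1 \<in> U \<Longrightarrow> z \<noteq> 0 \<Longrightarrow> z + 1 \<noteq> 0 \<Longrightarrow> f (z + 1) = f z"
    and p2: "\<And>z. z \<in> U \<Longrightarrow> z + \<tau> \<in> U \<Longrightarrow> z \<noteq> 0 \<Longrightarrow> z + \<tau> \<noteq> 0 \<Longrightarrow> f (z + \<tau>) = f z"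
  shows "open U" "f constant_on U"
proof -
  have cs: "continuous_on A s" and ct: "continuous_on A t" for A
    unfolding s_def t_def using \<tau> by (auto intro!: continuous_intros)
  have st_add: "s (z + w) = s z + s w" "t (z + w) = t z + t w" for z w
    by (simp_all add: s_def t_def add_divide_distrib ring_distribs)
  have st_diff: "s (z - w) = s z - s w" "t (z - w) = t z - t w" for z w
    by (simp_all add: s_def t_def diff_divide_distrib ring_distribs)
  have st_scale: "s (r *\<^sub>R z) = r * s z" "t (r *\<^sub>R z) = r * t z" for r z
    by (simp_all add: s_def t_def algebra_simps)
  have st1: "s 1 = 1" "t 1 = 0" "s \<tau> = 0" "t \<tau> = 1" "s 0 = 0" "t 0 = 0"
    using \<tau> by (simp_all add: s_def t_def)
  show U: "open U"
    unfolding U_def by (intro open_Collect_conj open_Collect_less continuous_intros cs ct)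
  have "convex U"
    unfolding convex_alt
  proof (intro ballI allI impI)
    fix x y :: complex and u :: real
    assume xy: "x \<in> U" "y \<in> U" and u: "0 \<le> u \<and> u \<le> 1"
    have "\<bar>(1 - u) * a + u * b\<bar> < 1" if "\<bar>a\<bar> < 1" "\<bar>b\<bar> < 1" for a b :: real
    proof -
      have "(1 - u) * a + u * b < 1" "(1 - u) * (-a) + u * (-b) < 1"
        by (rule convex_bound_lt; use that u in auto)+
      thus ?thesis by (simp add: abs_less_iff)
    qed
    thus "(1 - u) *\<^sub>R x + u *\<^sub>R y \<in> U"
      using xy by (simp add: U_def st_add st_scale)
  qed
  define P where "P = {z. \<bar>s z\<bar> \<le> 1 / 2 \<and> \<bar>t z\<bar> \<le> 1 / 2}"
  have P_U: "P \<subseteq> U" by (auto simp: P_def U_def)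
  have "bounded P"
  proof (rule boundedI)
    fix z assume "z \<in> P"
    hence st: "\<bar>s z\<bar> \<le> 1 / 2" "\<bar>t z\<bar> \<le> 1 / 2" by (auto simp: P_def)
    have "z = of_real (s z) + of_real (t z) * \<tau>"
      using \<tau> by (simp add: complex_eq_iff s_def t_def)
    also have "norm \<dots> \<le> \<bar>s z\<bar> + \<bar>t z\<bar> * norm \<tau>"
      by (rule order.trans[OF norm_triangle_ineq]) (simp add: norm_mult)
    also have "\<dots> \<le> 1 / 2 + 1 / 2 * norm \<tau>"
      using st by (intro add_mono mult_right_mono) auto
    finally show "norm z \<le> 1 / 2 + 1 / 2 * norm \<tau>" .
  qed
  moreover have "closed P"
    unfolding P_def by (intro closed_Collect_conj closed_Collect_le continuous_intros cs ct)
  ultimately have "compact P" by (simp add: compact_eq_bounded_closed)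
  moreover have "0 \<in> P" by (simp add: P_def st1)
  moreover have "continuous_on P (\<lambda>z. norm (f z))"
    using holomorphic_on_imp_continuous_on[OF holomorphic_on_subset[OF f P_U]]
    by (intro continuous_intros)
  ultimately obtain \<xi> where \<xi>: "\<xi> \<in> P" "\<And>z. z \<in> P \<Longrightarrow> norm (f z) \<le> norm (f \<xi>)"
    using continuous_attains_sup[of P "\<lambda>z. norm (f z)"] by blast
  \<comment> \<open>The coordinate \<open>s\<close> is corrected first. The new point must again be
    nonzero, because the translation by \<tau> is applied to it next.\<close>
  have red1: "\<exists>w\<in>U. w \<noteq> 0 \<and> f w = f z \<and> \<bar>s w\<bar> \<le> 1 / 2" if z: "z \<in> U" "z \<noteq> 0" for z
  proof -
    consider "\<bar>s z\<bar> \<le> 1 / 2" | "s z > 1 / 2" | "s z < - 1 / 2" by linarith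
    thus ?thesis
    proof cases
      case 2
      have "z - 1 \<in> U" using z 2 by (auto simp: U_def st_diff st1)
      moreover have "z - 1 \<noteq> 0" using z by (auto simp: U_def st1)
      ultimately show ?thesis using p1[of "z - 1"] z 2
        by (intro bexI[of _ "z - 1"]) (auto simp: st_diff st1 U_def)
    next
      case 3
      have "z + 1 \<in> U" using z 3 by (auto simp: U_def st_add st1)
      moreover have "z + 1 \<noteq> 0"
      proof
        assume "z + 1 = 0"
        hence "s (z + 1) = 0" by (simp add: st1)
        thus False using z by (auto simp: st_add st1 U_def)
      qed
      ultimately show ?thesis using p1[of z] z 3
        by (intro bexI[of _ "z + 1"]) (auto simp: st_add st1 U_def)
    qed (use z in blast)
  qed
  have red2: "\<exists>w\<in>P. f w = f z" if z: "z \<in> U" "z \<noteq> 0" "\<bar>s z\<bar> \<le> 1 / 2" for z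
  proof -
    consider "\<bar>t z\<bar> \<le> 1 / 2" | "t z > 1 / 2" | "t z < - 1 / 2" by linarith
    thus ?thesis
    proof cases
      case 1
      thus ?thesis using z by (intro bexI[of _ z]) (auto simp: P_def)
    next
      case 2
      have "z - \<tau> \<in> U" using z 2 by (auto simp: U_def st_diff st1)
      moreover have "z - \<tau> \<noteq> 0" using z by (auto simp: U_def st1)
      ultimately show ?thesis using p2[of "z - \<tau>"] z 2
        by (intro bexI[of _ "z - \<tau>"]) (auto simp: st_diff st1 U_def P_def)
    next
      case 3
      have "z + \<tau> \<in> U" using z 3 by (auto simp: U_def st_add st1)
      moreover have "z + \<tau> \<noteq> 0"
      proof
        assume "z + \<tau> = 0"
        hence "t (z + \<tau>) = 0" by (simp add: st1)
        thus False using z by (auto simp: st_add st1 U_def)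
      qed
      ultimately show ?thesis using p2[of z] z 3
        by (intro bexI[of _ "z + \<tau>"]) (auto simp: st_add st1 U_def P_def)
    qed
  qed
  have le: "norm (f z) \<le> norm (f \<xi>)" if z: "z \<in> U" for z
  proof (cases "z = 0")
    case True
    thus ?thesis using \<xi>(2)[of 0] \<open>0 \<in> P\<close> by simp
  next
    case False
    from red1[OF z False] obtain w where w: "w \<in> U" "w \<noteq> 0" "f w = f z" "\<bar>s w\<bar> \<le> 1 / 2" by blast
    from red2[OF w(1,2,4)] obtain v where "v \<in> P" "f v = f w" by blast
    thus ?thesis using \<xi>(2)[of v] w(3) by simp
  qed
  show "f constant_on U"
    by (rule maximum_modulus_principle[OF f U convex_connected[OF \<open>convex U\<close>] U order.refl _ le])
       (use \<xi>(1) P_U in auto)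
qed

section \<open>The zeta function of a lattice as a Lambert series\<close>

lemma sin_pi_eq_0_iff: "sin (of_real pi * z) = 0 \<longleftrightarrow> (\<exists>n::int. z = of_int n)" for z :: complex
proof -
  have "sin (of_real pi * z) = 0 \<longleftrightarrow> (\<exists>n::int. of_real pi * z = of_real (of_int n * pi))"
    by (simp add: sin_eq_0)
  also have "\<dots> \<longleftrightarrow> (\<exists>n::int. z = of_int n)"
    by (auto simp: field_simps)
  finally show ?thesis .
qed

text \<open>With q = \<open>qpar \<tau>\<close> and u = \<open>qpar z\<close> this is the sum of q^m
  (u^m - u^(-m)) / (1 - q^m), where m = 0 gives 1 / 0 = 0. It converges in the strip |Im z| < Im
  \<tau>.\<close>

definition lambert_odd :: "complex \<Rightarrow> complex \<Rightarrow> complex" where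
  "lambert_odd \<tau> z = (\<Sum>m. qpar \<tau> ^ m / (1 - qpar \<tau> ^ m) * qpar z ^ m) -
                     (\<Sum>m. qpar \<tau> ^ m / (1 - qpar \<tau> ^ m) * qpar (- z) ^ m)"

lemma lambert_coeff_summable:
  assumes "Im \<tau> > 0" "norm x < exp (2 * pi * Im \<tau>)"
  shows "summable (\<lambda>m. qpar \<tau> ^ m / (1 - qpar \<tau> ^ m) * x ^ m)"
proof (rule norm_summable_geometric_quotient)
  show "norm (qpar \<tau>) < 1" using assms by (simp add: norm_qpar_less_1)
  show "norm (x * qpar \<tau>) < 1"
    using assms by (simp add: norm_mult norm_qpar exp_minus field_simps)
qed

lemma lambert_odd_has_deriv:
  assumes "Im \<tau> > 0" "\<bar>Im z\<bar> < Im \<tau>"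
  shows "\<exists>D. (lambert_odd \<tau> has_field_derivative D) (at z)"
proof -
  have 1: "norm (qpar z) < exp (2 * pi * Im \<tau>)" "norm (qpar (- z)) < exp (2 * pi * Im \<tau>)"
    using assms mult_strict_left_mono[of "- Im z" "Im \<tau>" pi] by (auto simp: norm_qpar abs_less_iff)
  have d: "\<exists>D. ((\<lambda>z. \<Sum>m. qpar \<tau> ^ m / (1 - qpar \<tau> ^ m) * qpar z ^ m) has_field_derivative D) (at w)"
    if "norm (qpar w) < exp (2 * pi * Im \<tau>)" for w
    by (rule exI, rule has_field_derivative_qpar_series[OF lambert_coeff_summable[OF assms(1)] that])
  obtain D where D: "((\<lambda>z. \<Sum>m. qpar \<tau> ^ m / (1 - qpar \<tau> ^ m) * qpar z ^ m) has_field_derivative D) (at z)"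
    using d[OF 1(1)] by blast
  obtain D' where "((\<lambda>z. \<Sum>m. qpar \<tau> ^ m / (1 - qpar \<tau> ^ m) * qpar z ^ m) has_field_derivative D') (at (- z))"
    using d[OF 1(2)] by blast
  hence "((\<lambda>z. \<Sum>m. qpar \<tau> ^ m / (1 - qpar \<tau> ^ m) * qpar (- z) ^ m) has_field_derivative D' * - 1) (at z)"
    by (rule DERIV_chain2[where g = uminus]) (rule DERIV_minus[OF DERIV_ident])
  from DERIV_diff[OF D this] show ?thesis
    unfolding lambert_odd_def[abs_def] by blast
qed

lemma lambert_odd_holomorphic:
  assumes "Im \<tau> > 0"
  shows "lambert_odd \<tau> holomorphic_on {z. \<bar>Im z\<bar> < Im \<tau>}"
proof -
  have op: "open {z. \<bar>Im z\<bar> < Im \<tau>}"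
    by (intro open_Collect_less continuous_intros)
  show ?thesis
    unfolding holomorphic_on_open[OF op] using lambert_odd_has_deriv[OF assms] by simp
qed

text \<open>The reflection of z changes the sign of a derivative of odd order at 0, so the two
  series contribute equally. Each derivative multiplies the m-th term by 2 pi i m, and at z = 0 a
  Lambert series remains.\<close>

lemma higher_deriv_lambert_odd:
  assumes \<tau>: "Im \<tau> > 0" and n: "odd n"
  shows "(deriv ^^ n) (lambert_odd \<tau>) 0 = 2 * (2 * of_real pi * \<i>) ^ n *
           (\<Sum>m. of_nat (\<Sum>d | d dvd Suc m. d ^ n) * qpar \<tau> ^ Suc m)"
proof -
  define f where "f = (\<lambda>z. \<Sum>m. qpar \<tau> ^ m / (1 - qpar \<tau> ^ m) * qpar z ^ m)"
  define R where "R = exp (2 * pi * Im \<tau>)"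
  define T where "T = {z. norm (qpar z) < R}"
  have R: "1 < R" using \<tau> by (simp add: R_def)
  have sm: "\<And>x. norm x < R \<Longrightarrow> summable (\<lambda>m. qpar \<tau> ^ m / (1 - qpar \<tau> ^ m) * x ^ m)"
    unfolding R_def by (rule lambert_coeff_summable[OF \<tau>])
  have opT: "open T" unfolding T_def by (intro open_Collect_less continuous_intros)
  have f: "f holomorphic_on T"
    unfolding holomorphic_on_open[OF opT]
    by (intro ballI exI, unfold f_def, rule has_field_derivative_qpar_series[OF sm]) (auto simp: T_def)
  have opT': "open {z. - z \<in> T}"
    unfolding T_def mem_Collect_eq by (intro open_Collect_less continuous_intros)
  have 0: "0 \<in> T" "0 \<in> {z. - z \<in> T}" using R by (auto simp: T_def)
  have "(deriv ^^ n) (\<lambda>z. f (- 1 * z)) 0 = (- 1) ^ n * (deriv ^^ n) f (- 1 * 0)"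
    by (rule higher_deriv_compose_linear[OF f opT' opT 0(2)]) auto
  hence neg: "(deriv ^^ n) (\<lambda>z. f (- z)) 0 = - (deriv ^^ n) f 0"
    using n by simp
  have f': "(\<lambda>z. f (- z)) holomorphic_on {z. - z \<in> T}"
    by (rule holomorphic_on_compose_gen[OF _ f, unfolded o_def]) (auto intro!: holomorphic_intros)
  have "(deriv ^^ n) (lambert_odd \<tau>) 0 = (deriv ^^ n) (\<lambda>z. f z - f (- z)) 0"
    by (simp add: lambert_odd_def[abs_def] f_def)
  also have "\<dots> = (deriv ^^ n) f 0 - (deriv ^^ n) (\<lambda>z. f (- z)) 0"
    using f f' opT opT' 0 by (intro higher_deriv_diff_at) (auto simp: analytic_at)
  also have "\<dots> = 2 * (deriv ^^ n) f 0" unfolding neg by simp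
  also have "(deriv ^^ n) f 0 = (2 * of_real pi * \<i>) ^ n *
      (\<Sum>m. of_nat m ^ n * (qpar \<tau> ^ m / (1 - qpar \<tau> ^ m)) * qpar 0 ^ m)"
    unfolding f_def by (rule higher_deriv_qpar_series[OF sm]) (use R in auto)
  also have "(\<Sum>m. of_nat m ^ n * (qpar \<tau> ^ m / (1 - qpar \<tau> ^ m)) * qpar 0 ^ m) =
      (\<Sum>m. of_nat (\<Sum>d | d dvd Suc m. d ^ n) * qpar \<tau> ^ Suc m)"
    using Lambert_series[of "qpar \<tau>" n] \<tau> by (simp add: norm_qpar_less_1)
  finally show ?thesis by (simp add: mult_ac)
qed

text \<open>Up to a linear term this is the Weierstrass zeta function of the lattice \<open>\<int> + \<int> \<tau>\<close>; its Taylor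
  coefficients at \<open>0\<close> are the Eisenstein series.\<close>

definition lattice_zeta :: "complex \<Rightarrow> complex \<Rightarrow> complex" where
  "lattice_zeta \<tau> z = of_real pi * cos (of_real pi * z) / sin (of_real pi * z)
                      - 2 * of_real pi * \<i> * lambert_odd \<tau> z"

lemma lattice_zeta_add_1: "lattice_zeta \<tau> (z + 1) = lattice_zeta \<tau> z"
proof -
  have "qpar (- (z + 1)) = qpar (- z)" "qpar (z + 1) = qpar z"
    by (simp_all only: qpar_minus qpar_add qpar_1 mult_1_right)
  moreover have "sin (of_real pi * (z + 1)) = - sin (of_real pi * z)"
    "cos (of_real pi * (z + 1)) = - cos (of_real pi * z)"
    by (simp_all add: sin_add cos_add distrib_left sin_of_real cos_of_real)
  ultimately show ?thesis by (simp add: lattice_zeta_def lambert_odd_def)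
qed

text \<open>The two strip conditions together say -Im \<tau> < Im z < 0. This is exactly where the
  shift of the geometric quotients is available for u and for 1 / (u q). The rational terms it
  produces cancel against the cotangents, written in terms of u and u q, up to a constant.\<close>

lemma lattice_zeta_add_tau:
  assumes \<tau>: "Im \<tau> > 0" and z: "\<bar>Im z\<bar> < Im \<tau>" "\<bar>Im (z + \<tau>)\<bar> < Im \<tau>"
    and s: "sin (of_real pi * z) \<noteq> 0" "sin (of_real pi * (z + \<tau>)) \<noteq> 0"
  shows "lattice_zeta \<tau> (z + \<tau>) = lattice_zeta \<tau> z - 2 * of_real pi * \<i>"
proof -
  define q u where "q = qpar \<tau>" and "u = qpar z"
  have z': "Im z < 0" "Im z + Im \<tau> > 0" using z by auto
  have q: "norm q < 1" using \<tau> by (simp add: q_def norm_qpar_less_1)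
  have qu: "q \<noteq> 0" "u \<noteq> 0" by (simp_all add: q_def u_def)
  have uq: "norm (u * q) < 1"
    using z'(2) by (simp add: u_def q_def flip: qpar_add) (simp add: norm_qpar_less_1)
  have iu: "norm (1 / (u * q) * q) < 1"
    using z'(1) norm_qpar_less_1[of "- z"] qu by (simp add: u_def qpar_minus inverse_eq_divide)
  define P where "P = (\<lambda>y. \<Sum>m. q ^ m / (1 - q ^ m) * y ^ m)"
  have P1: "P u - P (u * q) = u * q / (1 - u * q)"
    unfolding P_def by (rule geometric_quotient_shift[OF q uq])
  have "P (1 / (u * q)) - P (1 / (u * q) * q) = 1 / (u * q) * q / (1 - 1 / (u * q) * q)"
    unfolding P_def by (rule geometric_quotient_shift[OF q iu])
  moreover have "1 / (u * q) * q = 1 / u" using qu by simp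
  ultimately have P2: "P (1 / (u * q)) - P (1 / u) = 1 / u / (1 - 1 / u)" by simp
  have l1: "lambert_odd \<tau> z = P u - P (1 / u)"
    by (simp add: lambert_odd_def P_def u_def q_def qpar_minus inverse_eq_divide)
  have l2: "lambert_odd \<tau> (z + \<tau>) = P (u * q) - P (1 / (u * q))"
    by (simp add: lambert_odd_def P_def u_def q_def qpar_minus[of "z + \<tau>", unfolded qpar_add] qpar_add
        inverse_eq_divide del: minus_add_distrib)
  have u1: "u \<noteq> 1" using pi_cot_eq(2)[OF s(1)] by (simp add: u_def)
  have "1 / u / (1 - 1 / u) = - 1 - u / (1 - u)"
    using u1 qu by (simp add: divide_simps)
  hence "u * q / (1 - u * q) + (P (u * q) - P (1 / (u * q))) = u / (1 - u) + (P u - P (1 / u)) + 1"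
    using P1 P2 by (simp add: algebra_simps)
  hence "2 * of_real pi * \<i> * (u * q / (1 - u * q) + (P (u * q) - P (1 / (u * q)))) =
         2 * of_real pi * \<i> * (u / (1 - u) + (P u - P (1 / u)) + 1)"
    by simp
  thus ?thesis
    unfolding lattice_zeta_def pi_cot_eq(1)[OF s(1)] pi_cot_eq(1)[OF s(2)] l1 l2
    by (simp add: qpar_add u_def[symmetric] q_def[symmetric] algebra_simps)
qed

text \<open>Both sides below are the Taylor coefficients at \<open>0\<close> of functions of \<open>z\<close> with the same poles and,
  up to the linear function \<open>2 \<pi> \<i> z / \<tau>\<close>, the same periods.\<close>

lemma lattice_zeta_inversion:
  fixes k :: "complex \<Rightarrow> complex"
  defines "V \<equiv> {z. z = 0 \<or> sin (of_real pi * z) \<noteq> 0}"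
  assumes \<tau>: "Im \<tau> > 0" and k: "k holomorphic_on V" and V: "open V"
    and k_eq: "\<And>z. sin (of_real pi * z) \<noteq> 0 \<Longrightarrow>
        of_real pi * cos (of_real pi * z) / sin (of_real pi * z) = 1 / z + k z"
    and n: "odd n"
  shows "((deriv ^^ n) k 0 - 2 * of_real pi * \<i> * (deriv ^^ n) (lambert_odd (- 1 / \<tau>)) 0) / \<tau> ^ (n + 1) =
         (deriv ^^ n) k 0 - 2 * of_real pi * \<i> * (deriv ^^ n) (lambert_odd \<tau>) 0 +
         (if n = 1 then 2 * of_real pi * \<i> / \<tau> else 0)"
proof -
  let ?c = "2 * of_real pi * \<i> :: complex"
  define \<tau>' where "\<tau>' = - 1 / \<tau>"
  have \<tau>': "Im \<tau>' > 0" using Im_minus_inverse_pos[OF \<tau>] by (simp add: \<tau>'_def)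
  have \<tau>0: "\<tau> \<noteq> 0" using \<tau> by auto
  define t s where "t = (\<lambda>z. Im z / Im \<tau>)" and "s = (\<lambda>z. Re z - Im z / Im \<tau> * Re \<tau>)"
  define U where "U = {z. \<bar>s z\<bar> < 1 \<and> \<bar>t z\<bar> < 1}"
  have decomp: "z = of_real (s z) + of_real (t z) * \<tau>" for z
    using \<tau> by (simp add: complex_eq_iff s_def t_def)
  have decomp': "z / \<tau> = of_real (t z) - of_real (s z) * \<tau>'" for z
    by (subst decomp) (use \<tau>0 in \<open>simp add: \<tau>'_def field_simps\<close>)
  have U1: "\<bar>Im z\<bar> < Im \<tau>" if "z \<in> U" for z
    using that \<tau> by (simp add: U_def t_def abs_divide)
  have U2: "\<bar>Im (z / \<tau>)\<bar> < Im \<tau>'" if "z \<in> U" for z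
    using that \<tau>' unfolding decomp' by (simp add: U_def abs_mult)
  have sin1: "sin (of_real pi * z) \<noteq> 0" if "z \<in> U" "z \<noteq> 0" for z
  proof
    assume "sin (of_real pi * z) = 0"
    then obtain m :: int where m: "z = of_int m" by (auto simp: sin_pi_eq_0_iff)
    hence "\<bar>of_int m :: real\<bar> < 1" using that(1) by (simp add: U_def s_def t_def)
    hence "m = 0" by linarith
    thus False using m that(2) by simp
  qed
  have sin2: "sin (of_real pi * (z / \<tau>)) \<noteq> 0" if "z \<in> U" "z \<noteq> 0" for z
  proof
    assume "sin (of_real pi * (z / \<tau>)) = 0"
    then obtain m :: int where "z / \<tau> = of_int m" by (auto simp only: sin_pi_eq_0_iff)
    hence m: "z = of_int m * \<tau>" using \<tau>0 by (simp add: field_simps)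
    hence "\<bar>of_int m :: real\<bar> < 1" using that(1) \<tau> by (simp add: U_def s_def t_def abs_mult)
    hence "m = 0" by linarith
    thus False using m that(2) by simp
  qed
  define G where "G = (\<lambda>\<sigma> z. k z - ?c * lambert_odd \<sigma> z)"
  have zeta_G: "lattice_zeta \<sigma> z = 1 / z + G \<sigma> z" if "sin (of_real pi * z) \<noteq> 0" for \<sigma> z
    using k_eq[OF that] by (simp add: lattice_zeta_def G_def)
  define W where "W = (\<lambda>\<sigma>. V \<inter> {z. \<bar>Im z\<bar> < Im \<sigma>})"
  have W: "open (W \<sigma>)" for \<sigma>
    unfolding W_def by (intro open_Int V open_Collect_less continuous_intros)
  have G_holo: "G \<sigma> holomorphic_on W \<sigma>" if "Im \<sigma> > 0" for \<sigma>
    unfolding G_def W_def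
    by (intro holomorphic_intros holomorphic_on_subset[OF k]
        holomorphic_on_subset[OF lambert_odd_holomorphic[OF that]]) auto
  have W1: "z \<in> W \<tau>" if "z \<in> U" for z
    using U1[OF that] sin1[OF that] by (auto simp: W_def V_def)
  have W2: "z / \<tau> \<in> W \<tau>'" if "z \<in> U" for z
    using U2[OF that] sin2[OF that] by (cases "z = 0") (auto simp: W_def V_def)
  \<comment> \<open>The poles 1 / z cancel, since 1 / (z / \<tau>) / \<tau> = 1 / z. The linear term
    compensates both quasi-periods: it changes by 2 pi i / \<tau> under z + 1 and by 2 pi i under z
    + \<tau>.\<close>
  define f where "f = (\<lambda>z. G \<tau>' (z / \<tau>) / \<tau> - G \<tau> z - ?c / \<tau> * z)"
  have comp_holo: "(\<lambda>z. G \<tau>' (z / \<tau>)) holomorphic_on U"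
    by (rule holomorphic_on_compose_gen[OF _ G_holo[OF \<tau>'], unfolded o_def])
       (auto intro!: holomorphic_intros W2 simp: \<tau>0)
  have f: "f holomorphic_on U"
    unfolding f_def
    by (intro holomorphic_intros comp_holo holomorphic_on_subset[OF G_holo[OF \<tau>]]) (auto simp: \<tau>0 W1)
  have f_zeta: "f z = lattice_zeta \<tau>' (z / \<tau>) / \<tau> - lattice_zeta \<tau> z - ?c / \<tau> * z"
    if "z \<in> U" "z \<noteq> 0" for z
    unfolding f_def zeta_G[OF sin1[OF that]] zeta_G[OF sin2[OF that]]
    using that(2) \<tau>0 by (simp add: field_simps)
  have p1: "f (z + 1) = f z" if z: "z \<in> U" "z + 1 \<in> U" "z \<noteq> 0" "z + 1 \<noteq> 0" for z
  proof -
    have e: "z / \<tau> = (z + 1) / \<tau> + \<tau>'" by (simp add: \<tau>'_def add_divide_distrib)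
    have "lattice_zeta \<tau>' ((z + 1) / \<tau> + \<tau>') = lattice_zeta \<tau>' ((z + 1) / \<tau>) - ?c"
      by (rule lattice_zeta_add_tau[OF \<tau>' U2[OF z(2)] _ sin2[OF z(2,4)]])
         (use U2[OF z(1)] sin2[OF z(1,3)] in \<open>simp_all only: e[symmetric] not_False_eq_True\<close>)
    hence e2: "lattice_zeta \<tau>' ((z + 1) / \<tau>) = lattice_zeta \<tau>' (z / \<tau>) + ?c"
      by (simp only: e[symmetric]) simp
    show ?thesis using \<tau>0
      unfolding f_zeta[OF z(2,4)] f_zeta[OF z(1,3)] lattice_zeta_add_1 e2 by (simp add: field_simps)
  qed
  have p2: "f (z + \<tau>) = f z" if z: "z \<in> U" "z + \<tau> \<in> U" "z \<noteq> 0" "z + \<tau> \<noteq> 0" for z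
  proof -
    have "(z + \<tau>) / \<tau> = z / \<tau> + 1" using \<tau>0 by (simp add: field_simps)
    hence e2: "lattice_zeta \<tau>' ((z + \<tau>) / \<tau>) = lattice_zeta \<tau>' (z / \<tau>)"
      by (simp only: lattice_zeta_add_1)
    have e3: "lattice_zeta \<tau> (z + \<tau>) = lattice_zeta \<tau> z - ?c"
      by (rule lattice_zeta_add_tau[OF \<tau> U1[OF z(1)] U1[OF z(2)] sin1[OF z(1,3)] sin1[OF z(2,4)]])
    show ?thesis using \<tau>0
      unfolding f_zeta[OF z(2,4)] f_zeta[OF z(1,3)] e2 e3 by (simp add: field_simps)
  qed
  have U_eq: "U = {z. \<bar>Re z - Im z / Im \<tau> * Re \<tau>\<bar> < 1 \<and> \<bar>Im z / Im \<tau>\<bar> < 1}"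
    by (simp add: U_def s_def t_def)
  note dpc = doubly_periodic_constant[OF \<tau>, of f, folded U_eq, OF f p1 p2]
  have U: "open U" by (rule dpc(1))
  have U0: "0 \<in> U" by (simp add: U_def s_def t_def)
  obtain C where C: "\<And>z. z \<in> U \<Longrightarrow> f z = C" using dpc(2) by (auto simp: constant_on_def)
  have n0: "n \<noteq> 0" using n by (cases n) auto
  have an1: "G \<tau> analytic_on {0}" "lambert_odd \<tau> analytic_on {0}" "k analytic_on {0}"
    "lambert_odd \<tau>' analytic_on {0}" "(\<lambda>z. G \<tau>' (z / \<tau>)) analytic_on {0}"
  proof -
    have op: "open {z. \<bar>Im z\<bar> < Im \<sigma>}" for \<sigma>
      by (intro open_Collect_less continuous_intros)
    show "G \<tau> analytic_on {0}"
      unfolding analytic_at using G_holo[OF \<tau>] W W1[OF U0] by blast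
    show "lambert_odd \<tau> analytic_on {0}" "lambert_odd \<tau>' analytic_on {0}"
      unfolding analytic_at
      using lambert_odd_holomorphic[OF \<tau>] lambert_odd_holomorphic[OF \<tau>'] op \<tau> \<tau>' by force+
    show "k analytic_on {0}" unfolding analytic_at using k V by (auto simp: V_def)
    show "(\<lambda>z. G \<tau>' (z / \<tau>)) analytic_on {0}" unfolding analytic_at using comp_holo U U0 by blast
  qed
  have dG: "(deriv ^^ n) (G \<sigma>) 0 = (deriv ^^ n) k 0 - ?c * (deriv ^^ n) (lambert_odd \<sigma>) 0"
    if an: "lambert_odd \<sigma> analytic_on {0}" for \<sigma>
  proof -
    have "(\<lambda>z. ?c * lambert_odd \<sigma> z) analytic_on {0}"
      by (intro analytic_intros an)
    thus ?thesis
      unfolding G_def by (subst higher_deriv_diff_at) (simp_all add: an1 higher_deriv_cmult'[OF an])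
  qed
  have "(deriv ^^ n) (\<lambda>z. 1 / \<tau> * G \<tau>' (z / \<tau>)) 0 =
        (deriv ^^ n) (\<lambda>z. G \<tau> z + (?c / \<tau> * z + C)) 0"
  proof (rule higher_deriv_cong_ev)
    have "eventually (\<lambda>z. z \<in> U) (nhds 0)" using U U0 by (rule eventually_nhds_in_open)
    thus "\<forall>\<^sub>F z in nhds 0. 1 / \<tau> * G \<tau>' (z / \<tau>) = G \<tau> z + (?c / \<tau> * z + C)"
    proof eventually_elim
      case (elim z)
      from C[OF elim] show ?case unfolding f_def by (simp add: algebra_simps)
    qed
  qed auto
  also have "\<dots> = (deriv ^^ n) (G \<tau>) 0 + ((deriv ^^ n) (\<lambda>z. ?c / \<tau> * z) 0 + (deriv ^^ n) (\<lambda>z. C) 0)"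
    by (subst higher_deriv_add_at; (subst higher_deriv_add_at)?)
       (auto intro!: analytic_intros an1 simp: \<tau>0)
  also have "\<dots> = (deriv ^^ n) (G \<tau>) 0 + (if n = 1 then ?c / \<tau> else 0)"
    using n0 by (subst higher_deriv_linear) simp
  also have "(deriv ^^ n) (\<lambda>z. 1 / \<tau> * G \<tau>' (z / \<tau>)) 0 = 1 / \<tau> * (deriv ^^ n) (\<lambda>z. G \<tau>' (z / \<tau>)) 0"
    by (rule higher_deriv_cmult'[OF an1(5)])
  also have "(deriv ^^ n) (\<lambda>z. G \<tau>' (z / \<tau>)) 0 = (1 / \<tau>) ^ n * (deriv ^^ n) (G \<tau>') (1 / \<tau> * 0)"
    using higher_deriv_compose_linear[OF G_holo[OF \<tau>'] U W U0, of "1 / \<tau>" n] W2 by simp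
  finally have "1 / \<tau> * ((1 / \<tau>) ^ n * (deriv ^^ n) (G \<tau>') 0) =
      (deriv ^^ n) (G \<tau>) 0 + (if n = 1 then ?c / \<tau> else 0)" by simp
  thus ?thesis unfolding dG[OF an1(2)] dG[OF an1(4)] \<tau>'_def[symmetric]
    using \<tau>0 by (simp add: power_divide)
qed

text \<open>The derivatives of order 1, 3, 5 at 0 of the zeta function without its pole are -pi^2/3
  E_2, -2 pi^4/15 E_4 and -16 pi^6/63 E_6: dividing -2 (2 pi i)^(n+1) by the cotangent's share gives
  -24, 240 and -504. Only order 1 sees the linear term of the inversion formula, hence the extra
  summand for E_2.\<close>

lemma E246_inversion:
  assumes \<tau>: "Im \<tau> > 0"
  shows "E2 (- 1 / \<tau>) = \<tau> ^ 2 * E2 \<tau> + 12 * \<tau> / (2 * of_real pi * \<i>)"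
    and "E4 (- 1 / \<tau>) = \<tau> ^ 4 * E4 \<tau>"
    and "E6 (- 1 / \<tau>) = \<tau> ^ 6 * E6 \<tau>"
proof -
  obtain k where k: "k holomorphic_on {z. z = 0 \<or> sin (of_real pi * z) \<noteq> 0}"
    "open {z. z = 0 \<or> sin (of_real pi * z :: complex) \<noteq> 0}"
    "\<And>z. sin (of_real pi * z) \<noteq> 0 \<Longrightarrow>
        of_real pi * cos (of_real pi * z) / sin (of_real pi * z) = 1 / z + k z"
    and d: "deriv k 0 = - (of_real pi ^ 2 / 3)"
    "(deriv ^^ 3) k 0 = - (2 * of_real pi ^ 4 / 15)"
    "(deriv ^^ 5) k 0 = - (16 * of_real pi ^ 6 / 63)"
    by (rule pi_cot_expansion) (rule that; assumption)
  let ?p = "of_real pi :: complex"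
  have \<tau>0: "\<tau> \<noteq> 0" and \<tau>': "Im (- 1 / \<tau>) > 0" using \<tau> Im_minus_inverse_pos[OF \<tau>] by auto
  note inv = lattice_zeta_inversion[OF \<tau> k]
  have pi0: "?p \<noteq> 0" by simp
  have powi: "\<i> ^ 3 = - \<i>" "\<i> ^ 5 = \<i>"
    by (simp_all add: power3_eq_cube numeral_eq_Suc)
  have e2: "(deriv ^^ 1) k 0 - 2 * ?p * \<i> * (deriv ^^ 1) (lambert_odd \<sigma>) 0 = - (?p ^ 2 / 3) * E2 \<sigma>"
    if "Im \<sigma> > 0" for \<sigma>
    by (subst higher_deriv_lambert_odd[OF that])
       (simp_all add: d E2_def eisenstein_series_def algebra_simps power2_eq_square)
  have e4: "(deriv ^^ 3) k 0 - 2 * ?p * \<i> * (deriv ^^ 3) (lambert_odd \<sigma>) 0 = - (2 * ?p ^ 4 / 15) * E4 \<sigma>"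
    if "Im \<sigma> > 0" for \<sigma>
    by (subst higher_deriv_lambert_odd[OF that])
       (simp_all add: d E4_def eisenstein_series_def algebra_simps power_mult_distrib powi
          power3_eq_cube power4_eq_xxxx)
  have e6: "(deriv ^^ 5) k 0 - 2 * ?p * \<i> * (deriv ^^ 5) (lambert_odd \<sigma>) 0 = - (16 * ?p ^ 6 / 63) * E6 \<sigma>"
    if "Im \<sigma> > 0" for \<sigma>
  proof -
    define S where "S = (\<Sum>m. of_nat (\<Sum>d | d dvd Suc m. d ^ 5) * qpar \<sigma> ^ Suc m)"
    have "2 * ?p * \<i> * (deriv ^^ 5) (lambert_odd \<sigma>) 0 = 2 * ((2 * ?p * \<i>) * (2 * ?p * \<i>) ^ 5) * S"
      by (subst higher_deriv_lambert_odd[OF that]) (simp_all add: S_def)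
    also have "(2 * ?p * \<i>) * (2 * ?p * \<i>) ^ 5 = - 64 * ?p ^ 6"
      by (simp add: power_mult_distrib powi flip: power_Suc)
    finally have *: "2 * ?p * \<i> * (deriv ^^ 5) (lambert_odd \<sigma>) 0 = 2 * (- 64 * ?p ^ 6) * S" .
    show ?thesis
      unfolding d E6_def eisenstein_series_def S_def[symmetric] * by (simp add: field_simps)
  qed
  show "E2 (- 1 / \<tau>) = \<tau> ^ 2 * E2 \<tau> + 12 * \<tau> / (2 * ?p * \<i>)"
  proof -
    have *: "- (?p ^ 2 / 3) * E2 (- 1 / \<tau>) / \<tau> ^ 2 = - (?p ^ 2 / 3) * E2 \<tau> + 2 * ?p * \<i> / \<tau>"
      using inv[of 1] unfolding e2[OF \<tau>] e2[OF \<tau>'] by (simp add: power2_eq_square)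
    have "E2 (- 1 / \<tau>) = (- 3 * \<tau> ^ 2 / ?p ^ 2) * (- (?p ^ 2 / 3) * E2 (- 1 / \<tau>) / \<tau> ^ 2)"
      using \<tau>0 pi0 by simp
    also have "\<dots> = \<tau> ^ 2 * E2 \<tau> + 12 * \<tau> / (2 * ?p * \<i>)"
      unfolding * using \<tau>0 pi0 by (simp add: divide_simps power2_eq_square) (simp add: algebra_simps)
    finally show ?thesis .
  qed
  show "E4 (- 1 / \<tau>) = \<tau> ^ 4 * E4 \<tau>"
    using inv[of 3] \<tau>0 unfolding e4[OF \<tau>] e4[OF \<tau>'] by (simp add: field_simps)
  show "E6 (- 1 / \<tau>) = \<tau> ^ 6 * E6 \<tau>"
    using inv[of 5] \<tau>0 unfolding e6[OF \<tau>] e6[OF \<tau>'] by (simp add: field_simps)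
qed

subsection \<open>Modular forms of level one\<close>

text \<open>A q-expansion is encoded by a holomorphic function on the unit disc instead of a
  coefficient sequence. Closure under algebraic operations, removal of zeros at q = 0 and the
  maximum modulus principle then become directly available, and invariance under T is built
  in.\<close>

definition has_qexp :: "(complex \<Rightarrow> complex) \<Rightarrow> (complex \<Rightarrow> complex) \<Rightarrow> bool" where
  "has_qexp f g \<longleftrightarrow> g holomorphic_on ball 0 1 \<and> (\<forall>\<tau>. Im \<tau> > 0 \<longrightarrow> f \<tau> = g (qpar \<tau>))"

named_theorems qexp_intros

lemma has_qexp_const [qexp_intros]: "has_qexp (\<lambda>_. c) (\<lambda>_. c)"
  by (auto simp: has_qexp_def intro!: holomorphic_intros)

lemma has_qexp_add [qexp_intros]:
  "has_qexp f g \<Longrightarrow> has_qexp f' g' \<Longrightarrow> has_qexp (\<lambda>\<tau>. f \<tau> + f' \<tau>) (\<lambda>x. g x + g' x)"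
  by (auto simp: has_qexp_def intro!: holomorphic_intros)

lemma has_qexp_diff [qexp_intros]:
  "has_qexp f g \<Longrightarrow> has_qexp f' g' \<Longrightarrow> has_qexp (\<lambda>\<tau>. f \<tau> - f' \<tau>) (\<lambda>x. g x - g' x)"
  by (auto simp: has_qexp_def intro!: holomorphic_intros)

lemma has_qexp_mult [qexp_intros]:
  "has_qexp f g \<Longrightarrow> has_qexp f' g' \<Longrightarrow> has_qexp (\<lambda>\<tau>. f \<tau> * f' \<tau>) (\<lambda>x. g x * g' x)"
  by (auto simp: has_qexp_def intro!: holomorphic_intros)

lemma has_qexp_power [qexp_intros]:
  "has_qexp f g \<Longrightarrow> has_qexp (\<lambda>\<tau>. f \<tau> ^ n) (\<lambda>x. g x ^ n)"
  by (auto simp: has_qexp_def intro!: holomorphic_intros)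

lemma has_qexp_divide [qexp_intros]:
  "has_qexp f g \<Longrightarrow> has_qexp f' g' \<Longrightarrow> (\<And>x. norm x < 1 \<Longrightarrow> g' x \<noteq> 0) \<Longrightarrow>
     has_qexp (\<lambda>\<tau>. f \<tau> / f' \<tau>) (\<lambda>x. g x / g' x)"
  by (auto simp: has_qexp_def intro!: holomorphic_intros)

lemma has_qexp_cong:
  "has_qexp f g \<Longrightarrow> (\<And>\<tau>. Im \<tau> > 0 \<Longrightarrow> f \<tau> = f' \<tau>) \<Longrightarrow> has_qexp f' g"
  by (auto simp: has_qexp_def)

lemma has_qexp_imp_holomorphic:
  assumes "has_qexp f g"
  shows "f holomorphic_on {\<tau>. Im \<tau> > 0}"
proof -
  have "(\<lambda>\<tau>. g (qpar \<tau>)) holomorphic_on {\<tau>. Im \<tau> > 0}"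
    using assms
    by (intro holomorphic_on_compose_gen[where g = g and f = qpar, unfolded o_def])
       (auto simp: has_qexp_def norm_qpar_less_1 intro!: holomorphic_intros holomorphic_on_qpar)
  thus ?thesis
    by (rule holomorphic_transform) (use assms in \<open>auto simp: has_qexp_def\<close>)
qed

lemma has_qexp_shift:
  assumes "has_qexp f g" "Im \<tau> > 0"
  shows "f (\<tau> + of_int n) = f \<tau>"
  using assms by (simp add: has_qexp_def qpar_add)

lemma has_qexp_deriv:
  assumes "has_qexp f g"
  shows "has_qexp (\<lambda>\<tau>. deriv f \<tau> / (2 * of_real pi * \<i>)) (\<lambda>x. x * deriv g x)"
  unfolding has_qexp_def
proof (intro conjI allI impI)
  have g: "g holomorphic_on ball 0 1" using assms by (simp add: has_qexp_def)
  thus "(\<lambda>x. x * deriv g x) holomorphic_on ball 0 1" by (intro holomorphic_intros) auto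
  fix \<tau> :: complex assume \<tau>: "Im \<tau> > 0"
  have gd: "(g has_field_derivative deriv g (qpar \<tau>)) (at (qpar \<tau>))"
    using g \<tau> by (intro holomorphic_derivI[of _ "ball 0 1"]) (auto simp: norm_qpar_less_1)
  have qd: "(qpar has_field_derivative 2 * of_real pi * \<i> * 1 * qpar \<tau>) (at \<tau>)"
    by (intro has_field_derivative_qpar DERIV_ident)
  have ev: "eventually (\<lambda>z. f z = g (qpar z)) (nhds \<tau>)"
  proof -
    have "eventually (\<lambda>z. z \<in> {z. Im z > 0}) (nhds \<tau>)"
      using \<tau> by (intro eventually_nhds_in_open) auto
    thus ?thesis by eventually_elim (use assms in \<open>auto simp: has_qexp_def\<close>)
  qed
  have "((\<lambda>z. g (qpar z)) has_field_derivative deriv g (qpar \<tau>) * (2 * of_real pi * \<i> * 1 * qpar \<tau>)) (at \<tau>)"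
    by (rule DERIV_chain2[OF gd qd])
  hence "deriv f \<tau> = deriv g (qpar \<tau>) * (2 * of_real pi * \<i> * 1 * qpar \<tau>)"
    using deriv_cong_ev[OF ev refl] DERIV_imp_deriv by metis
  thus "deriv f \<tau> / (2 * of_real pi * \<i>) = qpar \<tau> * deriv g (qpar \<tau>)" by (simp add: field_simps)
qed

lemma holomorphic_divisible_by_var:
  fixes g :: "complex \<Rightarrow> complex"
  assumes "g holomorphic_on ball 0 1" "g 0 = 0"
  obtains h where "h holomorphic_on ball 0 1" "\<And>x. g x = x * h x" "h 0 = deriv g 0"
proof
  show "(\<lambda>z. if z = 0 then deriv g 0 else (g z - g 0) / (z - 0)) holomorphic_on ball 0 1"
    using assms by (intro pole_lemma_open) auto
qed (use assms in auto)

lemma powser_holomorphic: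
  fixes b :: "nat \<Rightarrow> complex"
  assumes "\<And>x. norm x < 1 \<Longrightarrow> summable (\<lambda>n. b n * x ^ n)"
  shows "(\<lambda>x. \<Sum>n. b n * x ^ n) holomorphic_on ball 0 1"
proof (rule power_series_holomorphic)
  fix w :: complex assume "w \<in> ball 0 1"
  thus "(\<lambda>n. b n * (w - 0) ^ n) sums (\<Sum>n. b n * w ^ n)"
    using summable_sums[OF assms[of w]] by simp
qed

lemma summable_divisor_series:
  fixes x :: complex
  assumes "norm x < 1"
  shows "summable (\<lambda>n. of_nat (\<Sum>d | d dvd Suc n. d ^ r) * x ^ Suc n)"
  by (rule summable_norm_cancel[OF norm_summable_divisor_series[OF assms]])

lemma has_qexp_eisenstein_series:
  obtains g where "has_qexp (eisenstein_series c r) g" "g 0 = 1" "deriv g 0 = c"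
proof -
  define b where "b = (\<lambda>n. case n of 0 \<Rightarrow> 1 | Suc m \<Rightarrow> c * of_nat (\<Sum>d | d dvd Suc m. d ^ r))"
  have sm': "summable (\<lambda>n. b (Suc n) * x ^ Suc n)" if "norm x < 1" for x
    using summable_mult[OF summable_divisor_series[OF that, of r], of c] by (simp add: b_def mult_ac)
  hence sm: "summable (\<lambda>n. b n * x ^ n)" if "norm x < 1" for x
    using that summable_Suc_iff[of "\<lambda>n. b n * x ^ n"] by blast
  define g where "g = (\<lambda>x. \<Sum>n. b n * x ^ n)"
  have eq: "eisenstein_series c r \<tau> = g (qpar \<tau>)" if "Im \<tau> > 0" for \<tau>
  proof -
    have q: "norm (qpar \<tau>) < 1" using that by (simp add: norm_qpar_less_1)
    have "g (qpar \<tau>) = b 0 + (\<Sum>n. b (Suc n) * qpar \<tau> ^ Suc n)"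
      using suminf_split_head[OF sm[OF q]] by (simp add: g_def)
    also have "(\<Sum>n. b (Suc n) * qpar \<tau> ^ Suc n) =
        (\<Sum>n. c * (of_nat (\<Sum>d | d dvd Suc n. d ^ r) * qpar \<tau> ^ Suc n))"
      by (simp add: b_def mult_ac)
    also have "\<dots> = c * (\<Sum>n. of_nat (\<Sum>d | d dvd Suc n. d ^ r) * qpar \<tau> ^ Suc n)"
      by (rule suminf_mult[OF summable_divisor_series[OF q]])
    finally show ?thesis by (simp add: eisenstein_series_def b_def)
  qed
  have "has_qexp (eisenstein_series c r) g"
    using powser_holomorphic[OF sm] eq by (simp add: has_qexp_def g_def)
  moreover have "g 0 = 1" by (simp add: g_def b_def)
  moreover have "deriv g 0 = c"
  proof -
    have "{d. d dvd Suc 0} = {1}" by auto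
    hence "b 1 = c" by (simp add: b_def)
    have "(g has_field_derivative (\<Sum>n. diffs b n * 0 ^ n)) (at 0)"
      unfolding g_def by (rule termdiffs_strong'[of 1, OF sm]) auto
    hence "deriv g 0 = diffs b 0" by (simp add: DERIV_imp_deriv)
    thus ?thesis using \<open>b 1 = c\<close> by (simp add: diffs_def)
  qed
  ultimately show ?thesis using that by blast
qed

text \<open>After a translation to |Re| <= 1/2, a point with Im < 1/2 has squared norm at most 1/2,
  so inversion at least doubles its imaginary part. The exponent \<open>n\<close> bounds the number
  of doublings still needed.\<close>

lemma has_qexp_imp_large_Im:
  assumes f: "has_qexp f g" and S: "\<And>\<tau>. Im \<tau> > 0 \<Longrightarrow> f (- 1 / \<tau>) = f \<tau>" and \<tau>: "Im \<tau> > 0"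
  shows "\<exists>\<tau>'. Im \<tau>' \<ge> 1 / 2 \<and> f \<tau>' = f \<tau>"
proof -
  obtain n where "1 / Im \<tau> < 2 ^ n"
    using real_arch_pow[of 2 "1 / Im \<tau>"] by auto
  hence "1 / 2 \<le> 2 ^ n * Im \<tau>" using \<tau> by (simp add: field_simps)
  thus ?thesis using \<tau>
  proof (induction n arbitrary: \<tau>)
    case (Suc n)
    show ?case
    proof (cases "Im \<tau> \<ge> 1 / 2")
      case False
      define \<sigma> where "\<sigma> = \<tau> + of_int (- round (Re \<tau>))"
      have Re: "\<bar>Re \<sigma>\<bar> \<le> 1 / 2"
        using of_int_round_abs_le[of "Re \<tau>"] by (simp add: \<sigma>_def abs_minus_commute)
      have Im: "Im \<sigma> = Im \<tau>" by (simp add: \<sigma>_def)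
      have "Re \<sigma> ^ 2 \<le> (1 / 2) ^ 2" "Im \<sigma> ^ 2 \<le> (1 / 2) ^ 2"
        using Re False Suc.prems(2) unfolding Im by (auto intro: power2_le_iff_abs_le[THEN iffD2])
      hence "(norm \<sigma>)\<^sup>2 \<le> 1 / 2" unfolding cmod_power2 by (simp add: power2_eq_square)
      moreover have "(norm \<sigma>)\<^sup>2 > 0" using Suc.prems(2) Im by auto
      ultimately have "Im \<sigma> / (norm \<sigma>)\<^sup>2 \<ge> Im \<sigma> / (1 / 2)"
        using Suc.prems(2) Im by (intro divide_left_mono) auto
      hence I: "Im (- 1 / \<sigma>) \<ge> 2 * Im \<tau>" unfolding Im_minus_inverse Im by simp
      hence "2 ^ n * Im (- 1 / \<sigma>) \<ge> 2 ^ n * (2 * Im \<tau>)" by (intro mult_left_mono) auto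
      hence "1 / 2 \<le> 2 ^ n * Im (- 1 / \<sigma>)" using Suc.prems(1) by simp
      from Suc.IH[OF this] obtain \<tau>' where "Im \<tau>' \<ge> 1 / 2" "f \<tau>' = f (- 1 / \<sigma>)"
        using I Suc.prems(2) by auto
      moreover have "f (- 1 / \<sigma>) = f \<tau>"
        using S[of \<sigma>] has_qexp_shift[OF f Suc.prems(2), of "- round (Re \<tau>)"] Im Suc.prems(2)
        by (simp add: \<sigma>_def)
      ultimately show ?thesis by auto
    qed auto
  qed auto
qed

lemma weight_0_constant:
  assumes f: "has_qexp f g" and S: "\<And>\<tau>. Im \<tau> > 0 \<Longrightarrow> f (- 1 / \<tau>) = f \<tau>" and \<tau>: "Im \<tau> > 0"
  shows "f \<tau> = g 0"
proof -
  have g: "g holomorphic_on ball 0 1" and fg: "\<And>\<tau>. Im \<tau> > 0 \<Longrightarrow> f \<tau> = g (qpar \<tau>)"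
    using f by (auto simp: has_qexp_def)
  \<comment> \<open>exp (-pi) is |q| on the line Im \<tau> = 1/2.\<close>
  define r where "r = exp (- pi)"
  have r: "0 < r" "r < 1" by (auto simp: r_def)
  have sub: "cball 0 r \<subseteq> ball (0::complex) 1" using r by auto
  have "continuous_on (cball 0 r) (\<lambda>z. norm (g z))"
    using holomorphic_on_imp_continuous_on[OF holomorphic_on_subset[OF g sub]]
    by (intro continuous_intros)
  then obtain \<xi> where \<xi>: "\<xi> \<in> cball 0 r" "\<And>z. z \<in> cball 0 r \<Longrightarrow> norm (g z) \<le> norm (g \<xi>)"
    using continuous_attains_sup[of "cball (0::complex) r" "\<lambda>z. norm (g z)"] r by auto
  have le: "norm (g x) \<le> norm (g \<xi>)" if x: "x \<in> ball 0 1" for x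
  proof (cases "x = 0")
    case True
    thus ?thesis using \<xi>(2)[of 0] r by simp
  next
    case False
    then obtain \<tau> where t: "Im \<tau> > 0" "qpar \<tau> = x" using qpar_surj[of x] x by auto
    obtain \<tau>' where t': "Im \<tau>' \<ge> 1 / 2" "f \<tau>' = f \<tau>"
      using has_qexp_imp_large_Im[OF f S t(1)] by blast
    have "g x = g (qpar \<tau>')" using fg[OF t(1)] fg[of \<tau>'] t t' by simp
    moreover have "- (2 * pi * Im \<tau>') \<le> - pi"
      using mult_left_mono[OF t'(1), of "2 * pi"] by simp
    hence "norm (qpar \<tau>') \<le> r" by (simp add: norm_qpar r_def)
    ultimately show ?thesis using \<xi>(2)[of "qpar \<tau>'"] by simp
  qed
  have "g constant_on ball 0 1"
    by (rule maximum_modulus_principle[OF g _ _ _ order.refl _ le]) (use \<xi>(1) sub in auto)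
  thus ?thesis using fg[OF \<tau>] \<tau> by (auto simp: constant_on_def norm_qpar_less_1)
qed

text \<open>Only S is tested: invariance under T is part of having a q-expansion, and the two
  generate the modular group. The law for all matrices is recovered in
  \<open>level1_moebius\<close>.\<close>

definition level1 :: "int \<Rightarrow> (complex \<Rightarrow> complex) \<Rightarrow> bool" where
  "level1 k f \<longleftrightarrow> (\<exists>g. has_qexp f g) \<and> (\<forall>\<tau>. Im \<tau> > 0 \<longrightarrow> f (- 1 / \<tau>) = \<tau> powi k * f \<tau>)"

lemma upper_half_plane_nonzero: "Im \<tau> > 0 \<Longrightarrow> \<tau> \<noteq> 0"
  by auto

lemma level1_mult:
  assumes "level1 k f" "level1 l g"
  shows "level1 (k + l) (\<lambda>\<tau>. f \<tau> * g \<tau>)"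
  using assms has_qexp_mult unfolding level1_def
  by (auto simp: power_int_add upper_half_plane_nonzero mult_ac) blast

lemma level1_add: "level1 k f \<Longrightarrow> level1 k g \<Longrightarrow> level1 k (\<lambda>\<tau>. f \<tau> + g \<tau>)"
  using has_qexp_add unfolding level1_def by (auto simp: ring_distribs) blast

lemma level1_diff: "level1 k f \<Longrightarrow> level1 k g \<Longrightarrow> level1 k (\<lambda>\<tau>. f \<tau> - g \<tau>)"
  using has_qexp_diff unfolding level1_def by (auto simp: ring_distribs) blast

lemma level1_const: "level1 0 (\<lambda>\<tau>. c)"
  using has_qexp_const unfolding level1_def by auto

lemma level1_cmult: "level1 k f \<Longrightarrow> level1 k (\<lambda>\<tau>. c * f \<tau>)"
  using level1_mult[OF level1_const] by simp

lemma level1_zero: "level1 k (\<lambda>\<tau>. 0)"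
  using has_qexp_const unfolding level1_def by auto

lemma level1_power: "level1 k f \<Longrightarrow> level1 (int n * k) (\<lambda>\<tau>. f \<tau> ^ n)"
proof (induction n)
  case (Suc n)
  thus ?case using level1_mult[of k f "int n * k" "\<lambda>\<tau>. f \<tau> ^ n"] by (simp add: algebra_simps)
qed (simp add: level1_const)

lemma level1_sum: "(\<And>i. i \<in> I \<Longrightarrow> level1 k (f i)) \<Longrightarrow> level1 k (\<lambda>\<tau>. \<Sum>i\<in>I. f i \<tau>)"
  by (induction I rule: infinite_finite_induct) (auto intro!: level1_add level1_zero)

lemma level1_cong: "level1 k f \<Longrightarrow> (\<And>\<tau>. Im \<tau> > 0 \<Longrightarrow> f \<tau> = g \<tau>) \<Longrightarrow> level1 k g"
  unfolding level1_def using has_qexp_cong Im_minus_inverse_pos by (metis (no_types, lifting))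

lemma level1_E4: "level1 4 E4" and level1_E6: "level1 6 E6"
proof -
  obtain g where g: "has_qexp (eisenstein_series 240 3) g"
    by (rule has_qexp_eisenstein_series[of 240 3])
  have "E4 (- 1 / \<tau>) = \<tau> powi 4 * E4 \<tau>" if "Im \<tau> > 0" for \<tau>
    using E246_inversion(2)[OF that] by simp
  thus "level1 4 E4" using g by (auto simp: level1_def E4_def)
  obtain g where g: "has_qexp (eisenstein_series (-504) 5) g"
    by (rule has_qexp_eisenstein_series[of "-504" 5])
  have "E6 (- 1 / \<tau>) = \<tau> powi 6 * E6 \<tau>" if "Im \<tau> > 0" for \<tau>
    using E246_inversion(3)[OF that] by simp
  thus "level1 6 E6" using g by (auto simp: level1_def E6_def)
qed

section \<open>The discriminant and division by it\<close>

text \<open>The discriminant in the form \<open>q exp (- 24 \<Sum> \<sigma>\<^sub>1(m)/m q^m)\<close>, which makes its nonvanishing and its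
  logarithmic derivative evident. The term for \<open>m = 0\<close> vanishes since \<open>x / 0 = 0\<close>.\<close>

definition log_coeff :: "nat \<Rightarrow> complex" where
  "log_coeff m = - 24 * (of_nat (\<Sum>d | d dvd m. d) / of_nat m)"

definition Disc :: "complex \<Rightarrow> complex" where
  "Disc \<tau> = qpar \<tau> * exp (\<Sum>m. log_coeff m * qpar \<tau> ^ m)"

lemma summable_log_coeff:
  assumes "norm x < 1"
  shows "summable (\<lambda>m. log_coeff m * x ^ m)"
proof -
  have "summable (\<lambda>n. 24 * norm (of_nat (\<Sum>d | d dvd Suc n. d ^ 1) * x ^ Suc n))"
    by (intro summable_mult norm_summable_divisor_series assms)
  hence "summable (\<lambda>n. log_coeff (Suc n) * x ^ Suc n)"
  proof (rule summable_comparison_test')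
    fix n :: nat
    let ?s = "real (\<Sum>d | d dvd Suc n. d)"
    have "norm (log_coeff (Suc n) * x ^ Suc n) = 24 * (?s / real (Suc n)) * norm (x ^ Suc n)"
      by (simp only: log_coeff_def norm_mult norm_divide norm_of_nat norm_minus_cancel norm_numeral)
    also have "?s / real (Suc n) \<le> ?s / 1" by (rule divide_left_mono) (simp_all only: of_nat_0_le_iff, auto)
    hence "?s / real (Suc n) \<le> ?s" by simp
    hence "24 * (?s / real (Suc n)) * norm (x ^ Suc n) \<le> 24 * ?s * norm (x ^ Suc n)"
      by (intro mult_right_mono mult_left_mono) auto
    also have "\<dots> = 24 * norm (of_nat (\<Sum>d | d dvd Suc n. d ^ 1) * x ^ Suc n)"
      by (simp only: norm_mult norm_of_nat power_one_right mult.assoc)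
    finally show "norm (log_coeff (Suc n) * x ^ Suc n) \<le> 24 * norm (of_nat (\<Sum>d | d dvd Suc n. d ^ 1) * x ^ Suc n)" .
  qed
  thus ?thesis using summable_Suc_iff[of "\<lambda>n. log_coeff n * x ^ n"] by blast
qed

lemma Disc_nonzero [simp]: "Disc \<tau> \<noteq> 0"
  by (simp add: Disc_def)

lemma has_qexp_Disc:
  obtains u where "has_qexp Disc (\<lambda>x. x * u x)" "u holomorphic_on ball 0 1" "\<And>x. u x \<noteq> 0" "u 0 = 1"
proof
  let ?u = "\<lambda>x. exp (\<Sum>m. log_coeff m * x ^ m)"
  show u: "?u holomorphic_on ball 0 1"
    by (intro holomorphic_on_exp[THEN holomorphic_on_compose, unfolded o_def] holomorphic_intros
        powser_holomorphic summable_log_coeff)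
  thus "has_qexp Disc (\<lambda>x. x * ?u x)"
    unfolding has_qexp_def Disc_def by (auto intro!: holomorphic_intros)
  show "?u x \<noteq> 0" for x by simp
  have "log_coeff 0 = 0" by (simp add: log_coeff_def)
  thus "?u 0 = 1" by simp
qed

lemma Disc_deriv:
  assumes "Im \<tau> > 0"
  shows "(Disc has_field_derivative 2 * of_real pi * \<i> * E2 \<tau> * Disc \<tau>) (at \<tau>)"
proof -
  let ?S = "\<Sum>m. of_nat m * log_coeff m * qpar \<tau> ^ m"
  have q: "norm (qpar \<tau>) < 1" using assms by (simp add: norm_qpar_less_1)
  have S: "?S = - 24 * (\<Sum>n. of_nat (\<Sum>d | d dvd Suc n. d ^ 1) * qpar \<tau> ^ Suc n)"
  proof -
    have "summable (\<lambda>m. of_nat m * log_coeff m * qpar \<tau> ^ m)"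
      by (rule summable_mult_of_nat_powser[OF summable_log_coeff q])
    from suminf_split_head[OF this]
    have "?S = (\<Sum>n. of_nat (Suc n) * log_coeff (Suc n) * qpar \<tau> ^ Suc n)" by simp
    also have "\<dots> = (\<Sum>n. - 24 * (of_nat (\<Sum>d | d dvd Suc n. d ^ 1) * qpar \<tau> ^ Suc n))"
      by (intro suminf_cong) (simp add: log_coeff_def del: of_nat_Suc of_nat_sum)
    also have "\<dots> = - 24 * (\<Sum>n. of_nat (\<Sum>d | d dvd Suc n. d ^ 1) * qpar \<tau> ^ Suc n)"
      by (rule suminf_mult[OF summable_divisor_series[OF q]])
    finally show ?thesis .
  qed
  have "((\<lambda>z. \<Sum>m. log_coeff m * qpar z ^ m) has_field_derivative 2 * of_real pi * \<i> * ?S) (at \<tau>)"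
    by (rule has_field_derivative_qpar_series[OF summable_log_coeff q])
  hence "((\<lambda>z. qpar z * exp (\<Sum>m. log_coeff m * qpar z ^ m)) has_field_derivative
     (2 * of_real pi * \<i> * 1 * qpar \<tau>) * exp (\<Sum>m. log_coeff m * qpar \<tau> ^ m) +
     (exp (\<Sum>m. log_coeff m * qpar \<tau> ^ m) * (2 * of_real pi * \<i> * ?S)) * qpar \<tau>) (at \<tau>)"
    by (intro DERIV_mult has_field_derivative_qpar DERIV_ident DERIV_fun_exp)
  thus ?thesis
    unfolding Disc_def[abs_def] E2_def eisenstein_series_def S by (simp add: algebra_simps)
qed

text \<open>The extra summand 12 \<tau> / (2 pi i) in the inversion of E_2 is the logarithmic
  derivative of \<tau>^12 in disguise, so the quotient of both sides has derivative 0. The constant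
  is found at the fixed point i of S, where i^12 = 1.\<close>

lemma Disc_inversion:
  assumes \<tau>: "Im \<tau> > 0"
  shows "Disc (- 1 / \<tau>) = \<tau> ^ 12 * Disc \<tau>"
proof -
  let ?c = "2 * of_real pi * \<i> :: complex"
  define R where "R = (\<lambda>\<tau>. Disc (- 1 / \<tau>) / (\<tau> ^ 12 * Disc \<tau>))"
  have R': "(R has_field_derivative 0) (at \<tau> within {\<tau>. Im \<tau> > 0})" if \<tau>: "Im \<tau> > 0" for \<tau>
  proof -
    have \<tau>0: "\<tau> \<noteq> 0" using \<tau> by auto
    have d1: "((\<lambda>\<tau>. - 1 / \<tau>) has_field_derivative 1 / \<tau> ^ 2) (at \<tau>)"
      using \<tau>0 by (auto intro!: derivative_eq_intros simp: power2_eq_square)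
    have d2: "((\<lambda>\<tau>. Disc (- 1 / \<tau>)) has_field_derivative ?c * E2 (- 1 / \<tau>) * Disc (- 1 / \<tau>) * (1 / \<tau> ^ 2)) (at \<tau>)"
      by (rule DERIV_chain2[OF Disc_deriv[OF Im_minus_inverse_pos[OF \<tau>]] d1])
    have d3: "((\<lambda>\<tau>. \<tau> ^ 12 * Disc \<tau>) has_field_derivative
        of_nat 12 * (1 * \<tau> ^ (12 - Suc 0)) * Disc \<tau> + ?c * E2 \<tau> * Disc \<tau> * \<tau> ^ 12) (at \<tau>)"
      by (intro DERIV_mult DERIV_power DERIV_ident Disc_deriv[OF \<tau>])
    have eq: "?c * E2 (- 1 / \<tau>) * Disc (- 1 / \<tau>) * (1 / \<tau> ^ 2) * (\<tau> ^ 12 * Disc \<tau>) =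
          Disc (- 1 / \<tau>) * (of_nat 12 * (1 * \<tau> ^ (12 - Suc 0)) * Disc \<tau> + ?c * E2 \<tau> * Disc \<tau> * \<tau> ^ 12)"
      unfolding E246_inversion(1)[OF \<tau>] using \<tau>0
      by (simp add: field_simps) (simp add: numeral_eq_Suc)
    have nz: "\<tau> ^ 12 * Disc \<tau> \<noteq> 0" using \<tau>0 by simp
    have "(R has_field_derivative 0) (at \<tau>)"
      using DERIV_divide[OF d2 d3 nz] unfolding R_def eq diff_self div_0 .
    thus ?thesis by (rule has_field_derivative_at_within)
  qed
  obtain c where c: "\<And>\<tau>. Im \<tau> > 0 \<Longrightarrow> R \<tau> = c"
    using has_field_derivative_zero_constant[OF convex_upper_half_plane, of R] R' by auto
  have "R \<i> = 1" by (simp add: R_def)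
  hence "R \<tau> = 1" using c[of \<i>] c[OF \<tau>] by simp
  thus ?thesis using \<tau> by (auto simp: R_def field_simps)
qed

lemma level1_Disc: "level1 12 Disc"
  unfolding level1_def using has_qexp_Disc Disc_inversion by (metis power_int_numeral)

text \<open>The discriminant is q times a unit on the disc, so a vanishing constant term is all that
  division requires. The unit has value 1 at 0, which makes the first coefficient of f the new
  constant term.\<close>

lemma level1_divide_Disc:
  assumes "level1 k f" "has_qexp f g" "g 0 = 0"
  obtains h where "level1 (k - 12) (\<lambda>\<tau>. f \<tau> / Disc \<tau>)" "has_qexp (\<lambda>\<tau>. f \<tau> / Disc \<tau>) h" "h 0 = deriv g 0"
proof -
  obtain h where h: "h holomorphic_on ball 0 1" "\<And>x. g x = x * h x" "h 0 = deriv g 0"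
    using holomorphic_divisible_by_var[of g] assms(2,3) by (auto simp: has_qexp_def)
  obtain u where u: "has_qexp Disc (\<lambda>x. x * u x)" "u holomorphic_on ball 0 1" "\<And>x. u x \<noteq> 0" "u 0 = 1"
    by (rule has_qexp_Disc) (rule that; assumption)
  have q: "has_qexp (\<lambda>\<tau>. f \<tau> / Disc \<tau>) (\<lambda>x. h x / u x)"
    using h u assms(2) unfolding has_qexp_def by (auto intro!: holomorphic_intros)
  moreover have "f (- 1 / \<tau>) / Disc (- 1 / \<tau>) = \<tau> powi (k - 12) * (f \<tau> / Disc \<tau>)" if "Im \<tau> > 0" for \<tau>
  proof -
    have "f (- 1 / \<tau>) = \<tau> powi k * f \<tau>" "\<tau> \<noteq> 0" using assms(1) that by (auto simp: level1_def)
    thus ?thesis unfolding Disc_inversion[OF that] by (simp add: power_int_diff)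
  qed
  ultimately have "level1 (k - 12) (\<lambda>\<tau>. f \<tau> / Disc \<tau>)" by (auto simp: level1_def)
  thus ?thesis using that q h(3) u(4) by simp
qed

text \<open>The product of f^12 and the discriminant to the power -k > 0 has weight 0, hence is
  constant, and it vanishes at the cusp.\<close>

lemma level1_neg_weight:
  assumes f: "level1 k f" and k: "k < 0" and \<tau>: "Im \<tau> > 0"
  shows "f \<tau> = 0"
proof -
  obtain g where g: "has_qexp f g" using f by (auto simp: level1_def)
  obtain u where u: "has_qexp Disc (\<lambda>x. x * u x)" by (rule has_qexp_Disc)
  define n where "n = nat (- k)"
  have n: "n > 0" "int n = - k" using k by (auto simp: n_def)
  let ?F = "\<lambda>\<tau>. f \<tau> ^ 12 * Disc \<tau> ^ n"
  have "level1 (int 12 * k + int n * 12) ?F"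
    by (intro level1_mult level1_power f level1_Disc)
  hence "level1 0 ?F" by (simp add: n)
  hence inv: "?F (- 1 / \<tau>) = ?F \<tau>" if "Im \<tau> > 0" for \<tau>
    using that by (simp add: level1_def)
  have q: "has_qexp ?F (\<lambda>x. g x ^ 12 * (x * u x) ^ n)"
    by (intro qexp_intros g u)
  have "?F \<tau> = g 0 ^ 12 * (0 * u 0) ^ n"
    by (rule weight_0_constant[OF q inv \<tau>])
  thus ?thesis using n by (simp add: zero_power)
qed

text \<open>Applying S twice returns to \<tau> with the factor (-1)^k, the effect of S^2 =
  -I.\<close>

lemma level1_odd_weight:
  assumes f: "level1 k f" and k: "odd k" and \<tau>: "Im \<tau> > 0"
  shows "f \<tau> = 0"
proof -
  have inv: "f (- 1 / \<tau>) = \<tau> powi k * f \<tau>" if "Im \<tau> > 0" for \<tau> using f that by (simp add: level1_def)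
  have \<tau>0: "\<tau> \<noteq> 0" using \<tau> by auto
  have "f \<tau> = f (- 1 / (- 1 / \<tau>))" using \<tau>0 by simp
  also have "\<dots> = (- 1 / \<tau>) powi k * (\<tau> powi k * f \<tau>)"
    unfolding inv[OF Im_minus_inverse_pos[OF \<tau>]] inv[OF \<tau>] ..
  also have "\<dots> = (- 1 / \<tau> * \<tau>) powi k * f \<tau>" by (simp only: power_int_mult_distrib mult.assoc)
  also have "(- 1 / \<tau> * \<tau>) powi k = - 1" using k \<tau>0 by simp
  finally show ?thesis by simp
qed

lemma E4_E6_relation:
  obtains c where "c \<noteq> 0" "\<And>\<tau>. Im \<tau> > 0 \<Longrightarrow> E4 \<tau> ^ 3 - E6 \<tau> ^ 2 = c * Disc \<tau>"
proof -
  let ?f = "\<lambda>\<tau>. E4 \<tau> ^ 3 - E6 \<tau> ^ 2"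
  obtain g4 where g4: "has_qexp E4 g4" "g4 0 = 1" "deriv g4 0 = 240"
    unfolding E4_def by (rule has_qexp_eisenstein_series)
  obtain g6 where g6: "has_qexp E6 g6" "g6 0 = 1" "deriv g6 0 = - 504"
    unfolding E6_def by (rule has_qexp_eisenstein_series)
  let ?g = "\<lambda>x. g4 x ^ 3 - g6 x ^ 2"
  have "level1 (int 3 * 4) (\<lambda>\<tau>. E4 \<tau> ^ 3)" "level1 (int 2 * 6) (\<lambda>\<tau>. E6 \<tau> ^ 2)"
    by (intro level1_power level1_E4 level1_E6)+
  hence l: "level1 12 ?f" by (intro level1_diff) auto
  have q: "has_qexp ?f ?g" by (intro qexp_intros g4 g6)
  have "(g4 has_field_derivative 240) (at 0)" "(g6 has_field_derivative - 504) (at 0)"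
    using g4 g6 holomorphic_derivI[of g4 "ball 0 1" 0] holomorphic_derivI[of g6 "ball 0 1" 0]
    by (auto simp: has_qexp_def)
  \<comment> \<open>1728 = 3 * 240 - 2 * (-504).\<close>
  hence "(?g has_field_derivative 1728) (at 0)"
    by (auto intro!: derivative_eq_intros simp: g4 g6)
  hence "deriv ?g 0 = 1728" by (rule DERIV_imp_deriv)
  then obtain h where h: "level1 (12 - 12) (\<lambda>\<tau>. ?f \<tau> / Disc \<tau>)" "has_qexp (\<lambda>\<tau>. ?f \<tau> / Disc \<tau>) h" "h 0 = 1728"
    using level1_divide_Disc[OF l q] g4 g6 by auto
  have "?f \<tau> / Disc \<tau> = 1728" if "Im \<tau> > 0" for \<tau>
    using weight_0_constant[OF h(2) _ that] h(1,3) by (simp add: level1_def)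
  thus ?thesis using that[of 1728] by (simp add: field_simps)
qed

text \<open>With constant term a, the forms f^2 - a^2 E_4 and f^3 - a^3 E_6 vanish at the cusp, and
  dividing them by the discriminant gives weights -8 and -6, so they are 0. Comparing f^6 computed
  in both ways gives a^6 (E_4^3 - E_6^2) = 0, and the second factor is a nonzero multiple of the
  discriminant.\<close>

lemma level1_weight_2:
  assumes f: "level1 2 f" and \<tau>: "Im \<tau> > 0"
  shows "f \<tau> = 0"
proof -
  obtain g where g: "has_qexp f g" using f by (auto simp: level1_def)
  obtain g4 where g4: "has_qexp E4 g4" "g4 0 = 1"
    unfolding E4_def by (rule has_qexp_eisenstein_series)
  obtain g6 where g6: "has_qexp E6 g6" "g6 0 = 1"
    unfolding E6_def by (rule has_qexp_eisenstein_series)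
  define a where "a = g 0"
  have 2: "f \<tau> ^ 2 = a ^ 2 * E4 \<tau>" if \<tau>: "Im \<tau> > 0" for \<tau>
  proof -
    have "level1 4 (\<lambda>\<tau>. f \<tau> ^ 2 - a ^ 2 * E4 \<tau>)"
      using level1_power[OF f, of 2] by (intro level1_diff level1_cmult level1_E4) auto
    moreover have "has_qexp (\<lambda>\<tau>. f \<tau> ^ 2 - a ^ 2 * E4 \<tau>) (\<lambda>x. g x ^ 2 - a ^ 2 * g4 x)"
      by (intro qexp_intros g g4)
    ultimately obtain h where "level1 (4 - 12) (\<lambda>\<tau>. (f \<tau> ^ 2 - a ^ 2 * E4 \<tau>) / Disc \<tau>)"
      by (rule level1_divide_Disc) (auto simp: a_def g4)
    from level1_neg_weight[OF this _ \<tau>] show ?thesis by simp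
  qed
  have 3: "f \<tau> ^ 3 = a ^ 3 * E6 \<tau>" if \<tau>: "Im \<tau> > 0" for \<tau>
  proof -
    have "level1 6 (\<lambda>\<tau>. f \<tau> ^ 3 - a ^ 3 * E6 \<tau>)"
      using level1_power[OF f, of 3] by (intro level1_diff level1_cmult level1_E6) auto
    moreover have "has_qexp (\<lambda>\<tau>. f \<tau> ^ 3 - a ^ 3 * E6 \<tau>) (\<lambda>x. g x ^ 3 - a ^ 3 * g6 x)"
      by (intro qexp_intros g g6)
    ultimately obtain h where "level1 (6 - 12) (\<lambda>\<tau>. (f \<tau> ^ 3 - a ^ 3 * E6 \<tau>) / Disc \<tau>)"
      by (rule level1_divide_Disc) (auto simp: a_def g6)
    from level1_neg_weight[OF this _ \<tau>] show ?thesis by simp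
  qed
  obtain c where c: "c \<noteq> 0" "\<And>\<tau>. Im \<tau> > 0 \<Longrightarrow> E4 \<tau> ^ 3 - E6 \<tau> ^ 2 = c * Disc \<tau>"
    by (rule E4_E6_relation) blast
  have "(f \<tau> ^ 2) ^ 3 = (f \<tau> ^ 3) ^ 2" by (simp flip: power_mult)
  hence "a ^ 6 * (E4 \<tau> ^ 3 - E6 \<tau> ^ 2) = 0"
    unfolding 2[OF \<tau>] 3[OF \<tau>] by (simp add: power_mult_distrib algebra_simps flip: power_mult)
  hence "a = 0" using c(1) unfolding c(2)[OF \<tau>] by simp
  thus ?thesis using 2[OF \<tau>] by simp
qed

section \<open>Generation of level one forms by E_4 and E_6\<close>

definition E46_span :: "int \<Rightarrow> (complex \<Rightarrow> complex) \<Rightarrow> bool" where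
  "E46_span k f \<longleftrightarrow> (\<exists>c :: nat \<times> nat \<Rightarrow> complex. \<forall>\<tau>. Im \<tau> > 0 \<longrightarrow>
     f \<tau> = (\<Sum>(a, b) | 4 * int a + 6 * int b = k. c (a, b) * E4 \<tau> ^ a * E6 \<tau> ^ b))"

lemma finite_weight_monomials: "finite {(a, b). 4 * int a + 6 * int b = k}"
  by (rule finite_subset[of _ "{..nat k} \<times> {..nat k}"]) auto

lemma E46_span_cong: "E46_span k f \<Longrightarrow> (\<And>\<tau>. Im \<tau> > 0 \<Longrightarrow> f \<tau> = g \<tau>) \<Longrightarrow> E46_span k g"
  by (simp add: E46_span_def)

lemma E46_span_zero: "E46_span k (\<lambda>_. 0)"
  unfolding E46_span_def by (intro exI[of _ "\<lambda>_. 0"]) (auto intro!: sum.neutral)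

lemma E46_span_add:
  assumes "E46_span k f" "E46_span k g"
  shows "E46_span k (\<lambda>\<tau>. f \<tau> + g \<tau>)"
proof -
  obtain c d where
    "\<And>\<tau>. Im \<tau> > 0 \<Longrightarrow> f \<tau> = (\<Sum>(a, b) | 4 * int a + 6 * int b = k. c (a, b) * E4 \<tau> ^ a * E6 \<tau> ^ b)"
    "\<And>\<tau>. Im \<tau> > 0 \<Longrightarrow> g \<tau> = (\<Sum>(a, b) | 4 * int a + 6 * int b = k. d (a, b) * E4 \<tau> ^ a * E6 \<tau> ^ b)"
    using assms unfolding E46_span_def by blast
  thus ?thesis unfolding E46_span_def
    by (intro exI[of _ "\<lambda>x. c x + d x"])
       (auto simp: sum.distrib[symmetric] ring_distribs intro!: sum.cong)
qed

lemma E46_span_cmult: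
  assumes "E46_span k f"
  shows "E46_span k (\<lambda>\<tau>. z * f \<tau>)"
proof -
  obtain c where
    "\<And>\<tau>. Im \<tau> > 0 \<Longrightarrow> f \<tau> = (\<Sum>(a, b) | 4 * int a + 6 * int b = k. c (a, b) * E4 \<tau> ^ a * E6 \<tau> ^ b)"
    using assms unfolding E46_span_def by blast
  thus ?thesis unfolding E46_span_def
    by (intro exI[of _ "\<lambda>x. z * c x"]) (auto simp: sum_distrib_left mult_ac intro!: sum.cong)
qed

lemma E46_span_monomial:
  assumes "4 * int a + 6 * int b = k"
  shows "E46_span k (\<lambda>\<tau>. E4 \<tau> ^ a * E6 \<tau> ^ b)"
  unfolding E46_span_def
proof (intro exI[of _ "\<lambda>x. if x = (a, b) then 1 else 0"] allI impI)
  fix \<tau> :: complex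
  show "E4 \<tau> ^ a * E6 \<tau> ^ b =
      (\<Sum>(a', b') | 4 * int a' + 6 * int b' = k.
         (if (a', b') = (a, b) then 1 else 0) * E4 \<tau> ^ a' * E6 \<tau> ^ b')"
  proof -
    have "(\<Sum>(a', b') | 4 * int a' + 6 * int b' = k.
             (if (a', b') = (a, b) then 1 else 0) * E4 \<tau> ^ a' * E6 \<tau> ^ b') =
          (\<Sum>x | 4 * int (fst x) + 6 * int (snd x) = k. if (a, b) = x then E4 \<tau> ^ a * E6 \<tau> ^ b else 0)"
      by (auto simp: case_prod_unfold intro!: sum.cong)
    also have "\<dots> = E4 \<tau> ^ a * E6 \<tau> ^ b"
      using assms finite_weight_monomials[of k] by (subst sum.delta') (auto simp: case_prod_unfold)
    finally show ?thesis ..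
  qed
qed

lemma E46_span_sum:
  "(\<And>i. i \<in> I \<Longrightarrow> E46_span k (f i)) \<Longrightarrow> E46_span k (\<lambda>\<tau>. \<Sum>i\<in>I. f i \<tau>)"
  by (induction I rule: infinite_finite_induct) (auto intro!: E46_span_add E46_span_zero)

lemma E46_span_mult_monomial:
  assumes "E46_span k f" "4 * int a + 6 * int b = l"
  shows "E46_span (k + l) (\<lambda>\<tau>. E4 \<tau> ^ a * E6 \<tau> ^ b * f \<tau>)"
proof -
  obtain c where
    c: "\<And>\<tau>. Im \<tau> > 0 \<Longrightarrow> f \<tau> = (\<Sum>(a, b) | 4 * int a + 6 * int b = k. c (a, b) * E4 \<tau> ^ a * E6 \<tau> ^ b)"
    using assms(1) unfolding E46_span_def by blast
  have "E46_span (k + l) (\<lambda>\<tau>. \<Sum>x | 4 * int (fst x) + 6 * int (snd x) = k.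
          c x * (E4 \<tau> ^ (a + fst x) * E6 \<tau> ^ (b + snd x)))"
    using assms(2) by (intro E46_span_sum E46_span_cmult E46_span_monomial) auto
  thus ?thesis
    by (rule E46_span_cong)
       (simp add: c sum_distrib_left power_add mult_ac case_prod_unfold)
qed

text \<open>A suitable multiple of one monomial removes the constant term, and the remainder is the
  discriminant times a form of weight k - 12. Induction handles that form, and the discriminant is
  itself a combination of E_4^3 and E_6^2. The weights without a monomial are those in which all
  forms vanish.\<close>

lemma level1_imp_E46_span:
  assumes "level1 k f"
  shows "E46_span k f"
  using assms
proof (induction "nat k" arbitrary: k f rule: less_induct)
  case less
  note f = less.prems
  consider "k < 0 \<or> odd k \<or> k = 2" | "k = 0" | "even k" "k \<ge> 4" by (cases "k = 1"; cases "k = 3") force+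
  thus ?case
  proof cases
    case 1
    hence "f \<tau> = 0" if "Im \<tau> > 0" for \<tau>
      using level1_neg_weight[OF f _ that] level1_odd_weight[OF f _ that] level1_weight_2[OF _ that] f
      by auto
    thus ?thesis using E46_span_cong[OF E46_span_zero] by simp
  next
    case 2
    obtain g where g: "has_qexp f g" using f by (auto simp: level1_def)
    have "f \<tau> = g 0" if "Im \<tau> > 0" for \<tau>
      using weight_0_constant[OF g _ that] f 2 by (simp add: level1_def)
    thus ?thesis
      using E46_span_cong[OF E46_span_cmult[OF E46_span_monomial[of 0 0 k]], of "g 0" f] 2 by simp
  next
    case 3
    \<comment> \<open>A power of E_4 if 4 divides k, otherwise E_6 times a power of E_4; either way
      the constant term is 1.\<close>
    obtain a b where ab: "4 * int a + 6 * int b = k"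
    proof (cases "4 dvd k")
      case True
      thus ?thesis using that[of "nat (k div 4)" 0] 3 by auto
    next
      case False
      hence "k \<noteq> 4" by auto
      hence "k \<ge> 6" using 3 by presburger
      moreover have "4 * ((k - 6) div 4) + 6 = k" using 3 False by presburger
      ultimately show ?thesis using that[of "nat ((k - 6) div 4)" 1] by auto
    qed
    obtain g where g: "has_qexp f g" using f by (auto simp: level1_def)
    obtain g4 where g4: "has_qexp E4 g4" "g4 0 = 1"
      unfolding E4_def by (rule has_qexp_eisenstein_series)
    obtain g6 where g6: "has_qexp E6 g6" "g6 0 = 1"
      unfolding E6_def by (rule has_qexp_eisenstein_series)
    define e where "e = (\<lambda>\<tau>. g 0 * (E4 \<tau> ^ a * E6 \<tau> ^ b))"
    have "level1 (int a * 4 + int b * 6) (\<lambda>\<tau>. E4 \<tau> ^ a * E6 \<tau> ^ b)"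
      by (intro level1_mult level1_power level1_E4 level1_E6)
    hence "level1 k (\<lambda>\<tau>. f \<tau> - e \<tau>)"
      unfolding e_def using ab by (intro level1_diff level1_cmult f) (simp add: mult_ac)
    moreover have "has_qexp (\<lambda>\<tau>. f \<tau> - e \<tau>) (\<lambda>x. g x - g 0 * (g4 x ^ a * g6 x ^ b))"
      unfolding e_def by (intro qexp_intros g g4 g6)
    ultimately have "level1 (k - 12) (\<lambda>\<tau>. (f \<tau> - e \<tau>) / Disc \<tau>)"
      by (rule level1_divide_Disc) (auto simp: g4 g6)
    hence h: "E46_span (k - 12) (\<lambda>\<tau>. (f \<tau> - e \<tau>) / Disc \<tau>)" (is "E46_span _ ?h")
      using 3 by (intro less.hyps) auto
    obtain c where c: "c \<noteq> 0" "\<And>\<tau>. Im \<tau> > 0 \<Longrightarrow> E4 \<tau> ^ 3 - E6 \<tau> ^ 2 = c * Disc \<tau>"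
      by (rule E4_E6_relation) blast
    have "E46_span (k - 12 + 12) (\<lambda>\<tau>. E4 \<tau> ^ 3 * E6 \<tau> ^ 0 * ?h \<tau>)"
      "E46_span (k - 12 + 12) (\<lambda>\<tau>. E4 \<tau> ^ 0 * E6 \<tau> ^ 2 * ?h \<tau>)"
      by (intro E46_span_mult_monomial h; simp)+
    hence "E46_span k (\<lambda>\<tau>. 1 / c * (E4 \<tau> ^ 3 * E6 \<tau> ^ 0 * ?h \<tau> + (- 1) * (E4 \<tau> ^ 0 * E6 \<tau> ^ 2 * ?h \<tau>)) +
                g 0 * (E4 \<tau> ^ a * E6 \<tau> ^ b))"
      by (intro E46_span_add E46_span_cmult E46_span_monomial[OF ab]) simp_all
    thus ?thesis
    proof (rule E46_span_cong)
      fix \<tau> :: complex assume \<tau>: "Im \<tau> > 0"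
      have "1 / c * (A ^ 3 * B ^ 0 * C + (- 1) * (A ^ 0 * B ^ 2 * C)) = 1 / c * ((A ^ 3 - B ^ 2) * C)"
        for A B C by (simp add: algebra_simps)
      hence "1 / c * (E4 \<tau> ^ 3 * E6 \<tau> ^ 0 * ?h \<tau> + (- 1) * (E4 \<tau> ^ 0 * E6 \<tau> ^ 2 * ?h \<tau>)) =
            1 / c * ((E4 \<tau> ^ 3 - E6 \<tau> ^ 2) * ?h \<tau>)" .
      also have "\<dots> = f \<tau> - e \<tau>" unfolding c(2)[OF \<tau>] using c(1) by simp
      finally show "1 / c * (E4 \<tau> ^ 3 * E6 \<tau> ^ 0 * ?h \<tau> + (- 1) * (E4 \<tau> ^ 0 * E6 \<tau> ^ 2 * ?h \<tau>)) +
                g 0 * (E4 \<tau> ^ a * E6 \<tau> ^ b) = f \<tau>" by (simp add: e_def)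
    qed
  qed
qed

text \<open>Since E_4 and E_6 generate all level one forms, membership in M(1) becomes an analytic
  condition. The coefficients in the basis theorem are found as level one functions, not as
  polynomials.\<close>

lemma M1_weight_iff: "\<phi> \<in> M1_weight k \<longleftrightarrow> level1 k \<phi> \<and> (\<forall>\<tau>. Im \<tau> \<le> 0 \<longrightarrow> \<phi> \<tau> = 0)"
proof
  assume "\<phi> \<in> M1_weight k"
  then obtain c where c: "\<phi> = (\<lambda>\<tau>. if Im \<tau> > 0
    then \<Sum>(a, b) | 4 * int a + 6 * int b = k. c (a, b) * E4 \<tau> ^ a * E6 \<tau> ^ b else 0)"
    by (auto simp: M1_weight_def)
  have "level1 k (\<lambda>\<tau>. \<Sum>x | 4 * int (fst x) + 6 * int (snd x) = k. c x * (E4 \<tau> ^ fst x * E6 \<tau> ^ snd x))"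
  proof (intro level1_sum level1_cmult)
    fix x :: "nat \<times> nat" assume "x \<in> {x. 4 * int (fst x) + 6 * int (snd x) = k}"
    moreover have "level1 (int (fst x) * 4 + int (snd x) * 6) (\<lambda>\<tau>. E4 \<tau> ^ fst x * E6 \<tau> ^ snd x)"
      by (intro level1_mult level1_power level1_E4 level1_E6)
    ultimately show "level1 k (\<lambda>\<tau>. E4 \<tau> ^ fst x * E6 \<tau> ^ snd x)" by (simp add: mult_ac)
  qed
  hence "level1 k \<phi>"
    by (rule level1_cong) (simp add: c case_prod_unfold mult_ac)
  thus "level1 k \<phi> \<and> (\<forall>\<tau>. Im \<tau> \<le> 0 \<longrightarrow> \<phi> \<tau> = 0)" by (simp add: c)
next
  assume \<phi>: "level1 k \<phi> \<and> (\<forall>\<tau>. Im \<tau> \<le> 0 \<longrightarrow> \<phi> \<tau> = 0)"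
  then obtain c where "\<And>\<tau>. Im \<tau> > 0 \<Longrightarrow>
      \<phi> \<tau> = (\<Sum>(a, b) | 4 * int a + 6 * int b = k. c (a, b) * E4 \<tau> ^ a * E6 \<tau> ^ b)"
    using level1_imp_E46_span[of k \<phi>] unfolding E46_span_def by blast
  thus "\<phi> \<in> M1_weight k"
    unfolding M1_weight_def mem_Collect_eq using \<phi>
    by (intro exI[of _ c] ext) (auto simp: not_less)
qed

section \<open>Transformation under all of the modular group\<close>

lemma moebius_denominator_nonzero:
  fixes a b c d :: int
  assumes "a * d - b * c = 1" "Im \<tau> > 0"
  shows "of_int c * \<tau> + of_int d \<noteq> 0"
proof
  assume 0: "of_int c * \<tau> + of_int d = 0"
  hence "Im (of_int c * \<tau> + of_int d) = 0" by simp
  hence "c = 0" using assms(2) by simp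
  moreover from this 0 have "d = 0" by simp
  ultimately show False using assms(1) by simp
qed

lemma moebius_Im_pos:
  fixes a b c d :: int
  assumes "a * d - b * c = 1" "Im \<tau> > 0"
  shows "Im ((of_int a * \<tau> + of_int b) / (of_int c * \<tau> + of_int d)) > 0"
proof -
  let ?j = "of_int c * \<tau> + of_int d"
  have j: "?j \<noteq> 0" by (rule moebius_denominator_nonzero[OF assms])
  have "real_of_int a * of_int d - of_int b * of_int c = of_int (a * d - b * c)" by simp
  hence ad: "real_of_int a * of_int d - of_int b * of_int c = 1" using assms(1) by simp
  have "Im ((of_int a * \<tau> + of_int b) / ?j) =
        Im \<tau> * (real_of_int a * of_int d - of_int b * of_int c) / (norm ?j)\<^sup>2"
    unfolding cmod_power2 by (simp add: Im_divide algebra_simps)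
  also have "\<dots> = Im \<tau> / (norm ?j)\<^sup>2" unfolding ad by simp
  also have "\<dots> > 0" using assms(2) j by (intro divide_pos_pos) auto
  finally show ?thesis .
qed

text \<open>Euclidean algorithm on the first column: \<open>S T^n\<close> replaces \<open>c\<close> by \<open>a mod c\<close>.\<close>

lemma level1_moebius:
  fixes a b c d :: int
  assumes f: "level1 k f" and "a * d - b * c = 1" and \<tau>: "Im \<tau> > 0"
  shows "f ((of_int a * \<tau> + of_int b) / (of_int c * \<tau> + of_int d)) =
         (of_int c * \<tau> + of_int d) powi k * f \<tau>"
  using assms(2)
proof (induction "nat \<bar>c\<bar>" arbitrary: a b c d rule: less_induct)
  case less
  obtain g where g: "has_qexp f g" using f by (auto simp: level1_def)
  show ?case
  proof (cases "c = 0")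
    case True
    hence "a * d = 1" using less.prems by simp
    hence "a = 1 \<and> d = 1 \<or> a = -1 \<and> d = -1" by (rule zmult_eq_1_iff[THEN iffD1])
    thus ?thesis
    proof
      assume "a = 1 \<and> d = 1"
      thus ?thesis using True has_qexp_shift[OF g \<tau>, of b] by simp
    next
      assume ad: "a = -1 \<and> d = -1"
      have "(- \<tau> + of_int b) / (- 1) = \<tau> + of_int (- b)" by simp
      hence "f ((- \<tau> + of_int b) / (- 1)) = f \<tau>"
        using has_qexp_shift[OF g \<tau>, of "- b"] by metis
      \<comment> \<open>For odd k both sides vanish.\<close>
      moreover have "f \<tau> = (- 1) powi k * f \<tau>"
        using level1_odd_weight[OF f _ \<tau>] by (cases "even k") auto
      ultimately show ?thesis using True ad by simp
    qed
  next
    case False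
    define n where "n = - (a div c)"
    define a' b' where "a' = a + n * c" and "b' = b + n * d"
    have a': "a' = a mod c" by (simp add: a'_def n_def minus_div_mult_eq_mod)
    have "\<bar>a'\<bar> < \<bar>c\<bar>" unfolding a' using False by (rule abs_mod_less)
    hence less': "nat \<bar>a'\<bar> < nat \<bar>c\<bar>" by simp
    have det1: "a' * d - b' * c = 1" using less.prems by (simp add: a'_def b'_def algebra_simps)
    have det2: "(- c) * b' - (- d) * a' = 1" using det1 by (simp add: algebra_simps)
    let ?X = "of_int a' * \<tau> + of_int b'" and ?Y = "of_int c * \<tau> + of_int d"
    define \<sigma> where "\<sigma> = ?X / ?Y"
    have X: "?X \<noteq> 0" using moebius_denominator_nonzero[OF det2 \<tau>] .
    have Y: "?Y \<noteq> 0" using moebius_denominator_nonzero[OF less.prems \<tau>] .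
    have \<sigma>: "Im \<sigma> > 0" unfolding \<sigma>_def by (rule moebius_Im_pos[OF det1 \<tau>])
    have "\<sigma> = (of_int a * \<tau> + of_int b) / ?Y + of_int n"
      unfolding \<sigma>_def a'_def b'_def using Y by (simp add: field_simps)
    hence 1: "f \<sigma> = f ((of_int a * \<tau> + of_int b) / ?Y)"
      using has_qexp_shift[OF g moebius_Im_pos[OF less.prems \<tau>], of n] by simp
    have "- 1 / \<sigma> = (of_int (- c) * \<tau> + of_int (- d)) / ?X"
      unfolding \<sigma>_def by simp
    hence "f (- 1 / \<sigma>) = ?X powi k * f \<tau>"
      using less.hyps[OF less' det2] by simp
    moreover have "f (- 1 / \<sigma>) = \<sigma> powi k * f \<sigma>" using f \<sigma> by (simp add: level1_def)
    ultimately have "\<sigma> powi k * f \<sigma> = ?X powi k * f \<tau>" by simp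
    moreover have "\<sigma> powi k = ?X powi k / ?Y powi k"
      unfolding \<sigma>_def by (rule power_int_divide_distrib)
    ultimately have "f \<sigma> = ?Y powi k * f \<tau>"
      using X Y by (simp add: field_simps power_int_not_zero)
    thus ?thesis unfolding 1 .
  qed
qed

lemma has_field_derivative_moebius:
  fixes a b c d :: int
  assumes "a * d - b * c = 1" "Im \<tau> > 0"
  shows "((\<lambda>\<tau>. (of_int a * \<tau> + of_int b) / (of_int c * \<tau> + of_int d)) has_field_derivative
           1 / (of_int c * \<tau> + of_int d) ^ 2) (at \<tau>)"
proof -
  let ?j = "of_int c * \<tau> + of_int d"
  have j: "?j \<noteq> 0" by (rule moebius_denominator_nonzero[OF assms])
  have "complex_of_int a * of_int d - of_int b * of_int c = of_int (a * d - b * c)" by simp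
  hence "complex_of_int a * of_int d - of_int b * of_int c = 1" using assms(1) by simp
  hence "complex_of_int a * ?j - (of_int a * \<tau> + of_int b) * of_int c = 1"
    by (simp add: algebra_simps)
  moreover have "((\<lambda>\<tau>. (of_int a * \<tau> + of_int b) / (of_int c * \<tau> + of_int d)) has_field_derivative
           (complex_of_int a * ?j - (of_int a * \<tau> + of_int b) * of_int c) / (?j * ?j)) (at \<tau>)"
    using j by (auto intro!: derivative_eq_intros)
  ultimately show ?thesis by (simp add: power2_eq_square)
qed

lemma eventually_upper_half_plane:
  assumes "Im \<tau> > 0"
  shows "eventually (\<lambda>z. Im z > 0) (nhds \<tau>)"
  using eventually_nhds_in_open[OF open_upper_half_plane, of \<tau>] assms by simp

text \<open>E_2 is the logarithmic derivative of the discriminant, so its transformation law follows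
  by differentiating that of the discriminant; the summand with c is the derivative of the factor
  j^12.\<close>

lemma E2_moebius:
  fixes a b c d :: int
  assumes det: "a * d - b * c = 1" and \<tau>: "Im \<tau> > 0"
  defines "j \<equiv> of_int c * \<tau> + of_int d"
  shows "E2 ((of_int a * \<tau> + of_int b) / j) = j ^ 2 * E2 \<tau> + 12 * of_int c * j / (2 * of_real pi * \<i>)"
proof -
  let ?p = "2 * of_real pi * \<i> :: complex"
  let ?m = "\<lambda>\<tau>. (of_int a * \<tau> + of_int b) / (of_int c * \<tau> + of_int d)"
  let ?j = "\<lambda>\<tau>. of_int c * \<tau> + of_int d"
  have j: "j \<noteq> 0" unfolding j_def by (rule moebius_denominator_nonzero[OF det \<tau>])
  have d1: "((\<lambda>z. Disc (?m z)) has_field_derivative ?p * E2 (?m \<tau>) * Disc (?m \<tau>) * (1 / ?j \<tau> ^ 2)) (at \<tau>)"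
    by (rule DERIV_chain2[OF Disc_deriv[OF moebius_Im_pos[OF det \<tau>]] has_field_derivative_moebius[OF det \<tau>]])
  have "((\<lambda>z. ?j z) has_field_derivative of_int c) (at \<tau>)"
    by (auto intro!: derivative_eq_intros)
  hence d2: "((\<lambda>z. ?j z ^ 12 * Disc z) has_field_derivative
      of_nat 12 * (of_int c * ?j \<tau> ^ (12 - Suc 0)) * Disc \<tau> + ?p * E2 \<tau> * Disc \<tau> * ?j \<tau> ^ 12) (at \<tau>)"
    by (intro DERIV_mult DERIV_power Disc_deriv[OF \<tau>])
  have eq: "Disc (?m z) = ?j z ^ 12 * Disc z" if "Im z > 0" for z
    using level1_moebius[OF level1_Disc det that] by simp
  have ev: "eventually (\<lambda>z. Disc (?m z) = ?j z ^ 12 * Disc z) (nhds \<tau>)"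
    using eventually_upper_half_plane[OF \<tau>] by eventually_elim (rule eq)
  have "?p * E2 (?m \<tau>) * Disc (?m \<tau>) * (1 / ?j \<tau> ^ 2) =
        of_nat 12 * (of_int c * ?j \<tau> ^ (12 - Suc 0)) * Disc \<tau> + ?p * E2 \<tau> * Disc \<tau> * ?j \<tau> ^ 12"
    by (rule DERIV_unique[OF d1 DERIV_cong_ev[OF refl ev refl, THEN iffD2, OF d2]])
  hence "?p * E2 (?m \<tau>) * (j ^ 12 * Disc \<tau>) * (1 / j ^ 2) =
        of_nat 12 * (of_int c * j ^ 11) * Disc \<tau> + ?p * E2 \<tau> * Disc \<tau> * j ^ 12"
    unfolding j_def[symmetric] eq[OF \<tau>, folded j_def] by simp
  moreover define J where "J = j ^ 10"
  moreover have "j ^ 12 = J * j ^ 2" "j ^ 11 = J * j"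
    by (simp_all add: J_def flip: power_add power_Suc2)
  ultimately have "?p * E2 (?m \<tau>) * (J * j ^ 2 * Disc \<tau>) * (1 / j ^ 2) =
        12 * (of_int c * (J * j)) * Disc \<tau> + ?p * E2 \<tau> * Disc \<tau> * (J * j ^ 2)"
    by (simp only: of_nat_numeral)
  moreover have "?p * E2 (?m \<tau>) * (J * j ^ 2 * Disc \<tau>) * (1 / j ^ 2) = (J * Disc \<tau>) * (?p * E2 (?m \<tau>))"
    using j by simp
  ultimately have "(J * Disc \<tau>) * (?p * E2 (?m \<tau>)) =
      (J * Disc \<tau>) * (12 * (of_int c * j) + ?p * E2 \<tau> * j ^ 2)"
    by (simp only: ring_distribs mult_ac)
  moreover have "J \<noteq> 0" using j by (simp add: J_def)
  ultimately have "?p * E2 (?m \<tau>) = 12 * (of_int c * j) + ?p * E2 \<tau> * j ^ 2"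
    unfolding mult_cancel_left by simp
  note * = this
  have "E2 (?m \<tau>) = (12 * (of_int c * j) + ?p * E2 \<tau> * j ^ 2) / ?p"
  proof -
    have "E2 (?m \<tau>) = ?p * E2 (?m \<tau>) / ?p" by (rule nonzero_mult_div_cancel_left[symmetric]) simp
    thus ?thesis unfolding * .
  qed
  thus ?thesis unfolding j_def[symmetric] by (simp add: add_divide_distrib mult_ac)
qed

section \<open>The Serre derivative of scalar functions\<close>

definition serre_deriv :: "int \<Rightarrow> (complex \<Rightarrow> complex) \<Rightarrow> complex \<Rightarrow> complex" where
  "serre_deriv k f \<tau> = deriv f \<tau> / (2 * of_real pi * \<i>) - of_int k / 12 * E2 \<tau> * f \<tau>"

text \<open>Differentiating j^k produces k c j^(k-1), and k/12 times the extra summand of E_2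
  cancels it. The right-hand side is a linear combination of functions \<open>h l\<close> so that
  \<open>r\<close> can be a row of \<rho>(\<gamma>) and \<open>h\<close> the components of a vector
  valued form; scalar forms are the case of a single index.\<close>

lemma serre_deriv_moebius:
  fixes a b c d :: int
  assumes det: "a * d - b * c = 1" and \<tau>: "Im \<tau> > 0"
    and f: "f holomorphic_on {\<tau>. Im \<tau> > 0}"
    and h: "\<And>l. l \<in> I \<Longrightarrow> h l holomorphic_on {\<tau>. Im \<tau> > 0}"
    and trans: "\<And>\<tau>. Im \<tau> > 0 \<Longrightarrow> f ((of_int a * \<tau> + of_int b) / (of_int c * \<tau> + of_int d)) =
          (of_int c * \<tau> + of_int d) powi k * (\<Sum>l\<in>I. r l * h l \<tau>)"
  shows "serre_deriv k f ((of_int a * \<tau> + of_int b) / (of_int c * \<tau> + of_int d)) =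
          (of_int c * \<tau> + of_int d) powi (k + 2) * (\<Sum>l\<in>I. r l * serre_deriv k (h l) \<tau>)"
proof -
  let ?p = "2 * of_real pi * \<i> :: complex"
  let ?m = "\<lambda>\<tau>. (of_int a * \<tau> + of_int b) / (of_int c * \<tau> + of_int d)"
  let ?j = "\<lambda>\<tau>. of_int c * \<tau> + of_int d"
  define j where "j = ?j \<tau>"
  have j: "j \<noteq> 0" unfolding j_def by (rule moebius_denominator_nonzero[OF det \<tau>])
  define s s' where "s = (\<Sum>l\<in>I. r l * h l \<tau>)" and "s' = (\<Sum>l\<in>I. r l * deriv (h l) \<tau>)"
  have "(f has_field_derivative deriv f (?m \<tau>)) (at (?m \<tau>))"
    using holomorphic_derivI[OF f open_upper_half_plane] moebius_Im_pos[OF det \<tau>] by simp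
  hence d1: "((\<lambda>z. f (?m z)) has_field_derivative deriv f (?m \<tau>) * (1 / j ^ 2)) (at \<tau>)"
    unfolding j_def by (rule DERIV_chain2[OF _ has_field_derivative_moebius[OF det \<tau>]])
  have dj: "(?j has_field_derivative of_int c) (at \<tau>)"
    by (auto intro!: derivative_eq_intros)
  have dp: "((\<lambda>z. ?j z powi k) has_field_derivative of_int k * j powi (k - 1) * of_int c) (at \<tau>)"
    unfolding j_def by (rule derivative_eq_intros dj refl)+ (use j in \<open>auto simp: j_def\<close>)
  have "((\<lambda>z. \<Sum>l\<in>I. r l * h l z) has_field_derivative s') (at \<tau>)"
    unfolding s'_def using holomorphic_derivI[OF h open_upper_half_plane] \<tau>
    by (intro DERIV_sum DERIV_cmult) auto
  from DERIV_mult[OF dp this]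
  have d2: "((\<lambda>z. ?j z powi k * (\<Sum>l\<in>I. r l * h l z)) has_field_derivative
      of_int k * j powi (k - 1) * of_int c * s + s' * j powi k) (at \<tau>)"
    by (simp add: s_def j_def)
  have ev: "eventually (\<lambda>z. f (?m z) = ?j z powi k * (\<Sum>l\<in>I. r l * h l z)) (nhds \<tau>)"
    using eventually_upper_half_plane[OF \<tau>] by eventually_elim (rule trans)
  have "deriv f (?m \<tau>) * (1 / j ^ 2) = of_int k * j powi (k - 1) * of_int c * s + s' * j powi k"
    by (rule DERIV_unique[OF d1 DERIV_cong_ev[OF refl ev refl, THEN iffD2, OF d2]])
  hence D: "deriv f (?m \<tau>) = j ^ 2 * (of_int k * j powi (k - 1) * of_int c * s + s' * j powi k)"
    using j by (simp add: field_simps)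
  have powi: "j powi (k - 1) = j powi k / j" "j powi (k + 2) = j powi k * j ^ 2"
    using j by (simp_all add: power_int_diff power_int_add)
  have sum: "(\<Sum>l\<in>I. r l * serre_deriv k (h l) \<tau>) = s' / ?p - of_int k / 12 * E2 \<tau> * s"
    unfolding s'_def s_def serre_deriv_def sum_divide_distrib sum_distrib_left sum_subtractf[symmetric]
    by (intro sum.cong) (simp_all add: algebra_simps)
  show ?thesis
    unfolding serre_deriv_def[of k f] sum j_def[symmetric] D[folded j_def] trans[OF \<tau>, folded j_def s_def] powi
      E2_moebius[OF det \<tau>, folded j_def]
    using j by (simp add: field_simps power2_eq_square)
qed

lemma has_qexp_E2: obtains g where "has_qexp E2 g"
  unfolding E2_def by (rule has_qexp_eisenstein_series)

lemma has_qexp_serre_deriv: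
  assumes "has_qexp f g"
  obtains g' where "has_qexp (serre_deriv k f) g'"
proof -
  obtain e where e: "has_qexp E2 e" by (rule has_qexp_E2)
  have "has_qexp (serre_deriv k f) (\<lambda>x. x * deriv g x - of_int k / 12 * e x * g x)"
    unfolding serre_deriv_def[abs_def] by (intro qexp_intros has_qexp_deriv assms e)
  thus ?thesis using that by blast
qed

lemma level1_serre_deriv:
  assumes f: "level1 k f"
  shows "level1 (k + 2) (serre_deriv k f)"
proof -
  obtain g where g: "has_qexp f g" using f by (auto simp: level1_def)
  have h: "f holomorphic_on {\<tau>. Im \<tau> > 0}" by (rule has_qexp_imp_holomorphic[OF g])
  have "serre_deriv k f (- 1 / \<tau>) = \<tau> powi (k + 2) * serre_deriv k f \<tau>" if "Im \<tau> > 0" for \<tau>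
    \<comment> \<open>The variables are filled in the order a, d, b, c in which the determinant
      mentions them, so this is the matrix S.\<close>
    using serre_deriv_moebius[of 0 0 "-1" 1 \<tau> f "{()}" "\<lambda>_. f" k "\<lambda>_. 1"] f h that
    by (simp add: level1_def)
  moreover obtain g' where "has_qexp (serre_deriv k f) g'" by (rule has_qexp_serre_deriv[OF g])
  ultimately show ?thesis by (auto simp: level1_def)
qed

subsection \<open>Matrix exponentials and the symmetric cube\<close>

lemma mat_mult_nth: "(mat c ** A) $ i $ j = c * A $ i $ j" for A :: "'a::comm_semiring_1 ^'n^'n"
  by (simp add: matrix_matrix_mult_def mat_def if_distrib[of "\<lambda>x. x * _"] cong: if_cong)

lemma matrix_mult_nth: "(A ** B) $ i $ j = (\<Sum>k\<in>UNIV. A $ i $ k * B $ k $ j)"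
  for A :: "'a::semiring_1 ^'n^'m" and B :: "'a ^'k^'n"
  by (simp add: matrix_matrix_mult_def)

abbreviation mpow :: "complex^'d^'d \<Rightarrow> nat \<Rightarrow> complex^'d^'d" where
  "mpow X n \<equiv> ((**) X ^^ n) (mat 1)"

lemma mpow_Suc': "mpow X (Suc n) = mpow X n ** X"
  by (induction n) (simp_all add: matrix_mul_assoc)

lemma mpow_mat_mult: "mpow (mat c ** X) n $ i $ j = c ^ n * mpow X n $ i $ j"
proof (induction n arbitrary: i j)
  case (Suc n)
  have "mpow (mat c ** X) (Suc n) $ i $ j = (\<Sum>k\<in>UNIV. c * X $ i $ k * mpow (mat c ** X) n $ k $ j)"
    by (simp only: funpow.simps o_apply matrix_mult_nth[of "mat c ** X"] mat_mult_nth)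
  also have "\<dots> = c ^ Suc n * (\<Sum>k\<in>UNIV. X $ i $ k * mpow X n $ k $ j)"
    unfolding Suc.IH sum_distrib_left by (intro sum.cong) (simp_all add: mult_ac)
  finally show ?case by (simp only: funpow.simps o_apply matrix_mult_nth)
qed simp

lemma norm_mpow_le: "norm (mpow X n $ i $ j) \<le> (\<Sum>i\<in>UNIV. \<Sum>j\<in>UNIV. norm (X $ i $ j)) ^ n"
proof (induction n arbitrary: i j)
  case 0
  show ?case by (simp add: mat_def)
next
  case (Suc n)
  let ?b = "\<Sum>i\<in>UNIV. \<Sum>j\<in>UNIV. norm (X $ i $ j)"
  have "norm (mpow X (Suc n) $ i $ j) \<le> (\<Sum>k\<in>UNIV. norm (X $ i $ k) * norm (mpow X n $ k $ j))"
    by (simp add: matrix_matrix_mult_def) (rule order.trans[OF norm_sum], simp add: norm_mult)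
  also have "\<dots> \<le> (\<Sum>k\<in>UNIV. norm (X $ i $ k) * ?b ^ n)"
    by (intro sum_mono mult_left_mono Suc.IH) auto
  also have "\<dots> = (\<Sum>k\<in>UNIV. norm (X $ i $ k)) * ?b ^ n"
    by (simp add: sum_distrib_right)
  also have "\<dots> \<le> ?b * ?b ^ n"
    by (intro mult_right_mono member_le_sum[of i UNIV "\<lambda>i. \<Sum>k\<in>UNIV. norm (X $ i $ k)"])
       (auto intro!: sum_nonneg zero_le_power)
  finally show ?case by simp
qed

lemma sums_vec_nth:
  fixes f :: "nat \<Rightarrow> 'a::real_normed_vector ^'n"
  assumes "\<And>i. (\<lambda>n. f n $ i) sums (s $ i)"
  shows "f sums s"
  using assms unfolding sums_def by (intro vec_tendstoI) simp

lemma mat_exp_nth: "(\<lambda>n. mpow X n $ i $ j / fact n) sums (mat_exp X $ i $ j)"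
proof -
  let ?b = "\<Sum>i\<in>UNIV. \<Sum>j\<in>UNIV. norm (X $ i $ j)"
  have sm: "summable (\<lambda>n. mpow X n $ i $ j / fact n)" for i j
  proof (rule summable_comparison_test')
    show "summable (\<lambda>n. inverse (fact n) * ?b ^ n)" by (rule summable_exp)
    show "norm (mpow X n $ i $ j / fact n) \<le> inverse (fact n) * ?b ^ n" for n
      using norm_mpow_le[where X = X and n = n and i = i and j = j] by (simp add: norm_divide field_simps)
  qed
  define S where "S = (\<chi> i j. \<Sum>n. mpow X n $ i $ j / fact n)"
  have "(\<lambda>n. (1 / fact n) *\<^sub>R mpow X n) sums S"
  proof (intro sums_vec_nth)
    fix i j
    have "((1 / fact n) *\<^sub>R mpow X n) $ i $ j = mpow X n $ i $ j / fact n" for n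
      by (simp only: vector_scaleR_component) (simp add: scaleR_conv_of_real)
    thus "(\<lambda>n. ((1 / fact n) *\<^sub>R mpow X n) $ i $ j) sums (S $ i $ j)"
      using summable_sums[OF sm] by (simp add: S_def)
  qed
  hence "mat_exp X = S" unfolding mat_exp_def by (rule sums_unique[symmetric])
  thus ?thesis using summable_sums[OF sm] by (simp add: S_def)
qed

definition expm :: "complex^'d^'d \<Rightarrow> complex \<Rightarrow> complex^'d^'d" where
  "expm L z = mat_exp (mat (2 * of_real pi * \<i> * z) ** L)"

lemma expm_sums:
  "(\<lambda>n. (2 * of_real pi * \<i>) ^ n * mpow L n $ i $ j / fact n * z ^ n) sums (expm L z $ i $ j)"
  using mat_exp_nth[of "mat (2 * of_real pi * \<i> * z) ** L" i j]
  unfolding expm_def mpow_mat_mult by (simp add: power_mult_distrib mult_ac)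

lemma expm_0: "expm L 0 = mat 1"
proof -
  have "expm L 0 $ i $ j = mat 1 $ i $ j" for i j
    using sums_unique2[OF expm_sums[of L i j 0] powser_sums_zero] by simp
  thus ?thesis by (simp add: vec_eq_iff)
qed

lemma expm_deriv:
  "((\<lambda>z. expm L z $ i $ j) has_field_derivative 2 * of_real pi * \<i> * (L ** expm L z) $ i $ j) (at z)"
proof -
  let ?c = "2 * of_real pi * \<i> :: complex"
  define a where "a = (\<lambda>i j n. ?c ^ n * mpow L n $ i $ j / fact n)"
  have a: "(\<lambda>n. a i j n * z ^ n) sums (expm L z $ i $ j)" for i j z
    using expm_sums[of L i j z] by (simp add: a_def)
  have eq: "expm L z $ i $ j = (\<Sum>n. a i j n * z ^ n)" for i j z
    using sums_unique[OF a] .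
  have "((\<lambda>z. expm L z $ i $ j) has_field_derivative (\<Sum>n. diffs (a i j) n * z ^ n)) (at z)"
    unfolding eq using sums_summable[OF a] by (intro termdiffs_strong_converges_everywhere)
  also have "(\<lambda>n. diffs (a i j) n * z ^ n) = (\<lambda>n. \<Sum>k\<in>UNIV. ?c * L $ i $ k * (a k j n * z ^ n))"
  proof
    fix n
    have "diffs (a i j) n = of_nat (Suc n) * (?c ^ Suc n * mpow L (Suc n) $ i $ j / fact (Suc n))"
      by (simp only: diffs_def a_def)
    also have "\<dots> = ?c ^ Suc n * mpow L (Suc n) $ i $ j / fact n"
      by (simp only: fact_Suc of_nat_mult) (simp add: field_simps del: of_nat_Suc power_Suc funpow.simps)
    also have "mpow L (Suc n) $ i $ j = (\<Sum>k\<in>UNIV. L $ i $ k * mpow L n $ k $ j)"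
      by (simp add: matrix_matrix_mult_def)
    finally show "diffs (a i j) n * z ^ n = (\<Sum>k\<in>UNIV. ?c * L $ i $ k * (a k j n * z ^ n))"
      by (simp add: a_def sum_distrib_left sum_distrib_right sum_divide_distrib mult_ac)
  qed
  also have "(\<Sum>n. \<Sum>k\<in>UNIV. ?c * L $ i $ k * (a k j n * z ^ n)) = (\<Sum>k\<in>UNIV. ?c * L $ i $ k * expm L z $ k $ j)"
    by (intro sums_unique[symmetric] sums_sum sums_mult a)
  also have "\<dots> = ?c * (L ** expm L z) $ i $ j"
    by (simp add: matrix_matrix_mult_def sum_distrib_left mult_ac)
  finally show ?thesis .
qed

lemma expm_commute: "L ** expm L z = expm L z ** L"
proof -
  let ?c = "2 * of_real pi * \<i> :: complex"
  have "(L ** expm L z) $ i $ j = (expm L z ** L) $ i $ j" for i j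
  proof -
    have "(\<lambda>n. \<Sum>k\<in>UNIV. L $ i $ k * (?c ^ n * mpow L n $ k $ j / fact n * z ^ n)) sums
            (\<Sum>k\<in>UNIV. L $ i $ k * expm L z $ k $ j)"
      by (intro sums_sum sums_mult expm_sums)
    moreover have "(\<lambda>n. \<Sum>k\<in>UNIV. ?c ^ n * mpow L n $ i $ k / fact n * z ^ n * L $ k $ j) sums
            (\<Sum>k\<in>UNIV. expm L z $ i $ k * L $ k $ j)"
      by (intro sums_sum sums_mult2 expm_sums)
    moreover have "(\<Sum>k\<in>UNIV. L $ i $ k * (?c ^ n * mpow L n $ k $ j / fact n * z ^ n)) =
        (\<Sum>k\<in>UNIV. ?c ^ n * mpow L n $ i $ k / fact n * z ^ n * L $ k $ j)" for n
    proof -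
      have "(\<Sum>k\<in>UNIV. L $ i $ k * (?c ^ n * mpow L n $ k $ j / fact n * z ^ n)) =
            ?c ^ n / fact n * z ^ n * (L ** mpow L n) $ i $ j"
        by (simp add: matrix_matrix_mult_def sum_distrib_left mult_ac)
      also have "L ** mpow L n = mpow L n ** L" using mpow_Suc'[where X = L and n = n] by simp
      also have "?c ^ n / fact n * z ^ n * (mpow L n ** L) $ i $ j =
          (\<Sum>k\<in>UNIV. ?c ^ n * mpow L n $ i $ k / fact n * z ^ n * L $ k $ j)"
        by (simp add: matrix_matrix_mult_def sum_distrib_left mult_ac)
      finally show ?thesis .
    qed
    ultimately show ?thesis
      by (simp add: matrix_matrix_mult_def) (metis (no_types, lifting) sums_unique2)
  qed
  thus ?thesis by (simp add: vec_eq_iff)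
qed

text \<open>In the product rule the two terms cancel because L commutes with its exponential.
  Inverses, the addition law and the comparison with the symmetric cube are all obtained by
  exhibiting a solution of this equation.\<close>

lemma linear_ode_invariant:
  fixes Y :: "complex \<Rightarrow> complex^'d^'d"
  assumes Y: "\<And>z i j. ((\<lambda>z. Y z $ i $ j) has_field_derivative 2 * of_real pi * \<i> * (L ** Y z) $ i $ j) (at z)"
  shows "expm L (- z) ** Y z = Y 0"
proof -
  let ?c = "2 * of_real pi * \<i> :: complex"
  have neg: "((\<lambda>z. expm L (- z) $ i $ j) has_field_derivative - (?c * (L ** expm L (- z)) $ i $ j)) (at z)"
    for i j z
    using DERIV_chain2[where g = uminus and x = z and s = UNIV, OF expm_deriv[of L i j "- z"] DERIV_minus[OF DERIV_ident]]
    by simp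
  have "(expm L (- z) ** Y z) $ i $ j = Y 0 $ i $ j" for i j
  proof -
    have "((\<lambda>z. (expm L (- z) ** Y z) $ i $ j) has_field_derivative 0) (at z)" for z
    proof -
      have "((\<lambda>z. \<Sum>k\<in>UNIV. expm L (- z) $ i $ k * Y z $ k $ j) has_field_derivative
          (\<Sum>k\<in>UNIV. - (?c * (L ** expm L (- z)) $ i $ k) * Y z $ k $ j +
                     ?c * (L ** Y z) $ k $ j * expm L (- z) $ i $ k)) (at z)"
        by (intro DERIV_sum DERIV_mult neg Y)
      also have "(\<Sum>k\<in>UNIV. - (?c * (L ** expm L (- z)) $ i $ k) * Y z $ k $ j +
                     ?c * (L ** Y z) $ k $ j * expm L (- z) $ i $ k) =
          ?c * ((expm L (- z) ** (L ** Y z)) $ i $ j - ((L ** expm L (- z)) ** Y z) $ i $ j)"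
        by (simp add: matrix_matrix_mult_def[of "expm L (- z)"] matrix_matrix_mult_def[of "L ** expm L (- z)"]
            sum_distrib_left sum_subtractf sum.distrib sum_negf right_diff_distrib mult_ac)
      also have "\<dots> = 0" by (simp add: expm_commute matrix_mul_assoc)
      finally show ?thesis by (simp add: matrix_matrix_mult_def)
    qed
    hence "\<exists>c. \<forall>z\<in>UNIV. (expm L (- z) ** Y z) $ i $ j = c"
      by (intro has_field_derivative_zero_constant) auto
    then obtain c where "\<And>z. (expm L (- z) ** Y z) $ i $ j = c" by blast
    from this[of z] this[of 0] show ?thesis by (simp add: expm_0)
  qed
  thus ?thesis by (simp add: vec_eq_iff)
qed

lemma expm_minus: "expm L (- z) ** expm L z = mat 1" "expm L z ** expm L (- z) = mat 1"
  using linear_ode_invariant[of "expm L", OF expm_deriv, of z]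
    linear_ode_invariant[of "expm L", OF expm_deriv, of "- z"] by (simp_all add: expm_0)

lemma linear_ode_unique:
  fixes Y :: "complex \<Rightarrow> complex^'d^'d"
  assumes "\<And>z i j. ((\<lambda>z. Y z $ i $ j) has_field_derivative 2 * of_real pi * \<i> * (L ** Y z) $ i $ j) (at z)"
  shows "Y z = expm L z ** Y 0"
proof -
  have "expm L z ** (expm L (- z) ** Y z) = expm L z ** Y 0"
    by (simp only: linear_ode_invariant[OF assms])
  thus ?thesis by (simp add: matrix_mul_assoc expm_minus)
qed

lemma expm_add: "expm L (z + w) = expm L z ** expm L w"
proof -
  have "((\<lambda>z. expm L (z + w) $ i $ j) has_field_derivative 2 * of_real pi * \<i> * (L ** expm L (z + w)) $ i $ j) (at z)"
    for z i j
    using expm_deriv[of L i j "z + w"] by (subst (asm) DERIV_shift)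
  from linear_ode_unique[of "\<lambda>z. expm L (z + w)", OF this, of z] show ?thesis by simp
qed

lemma expm_holomorphic: "(\<lambda>z. expm L z $ i $ j) holomorphic_on A"
  unfolding holomorphic_on_def field_differentiable_def
  using has_field_derivative_at_within[OF expm_deriv] by blast

text \<open>Liouville's formula: the determinant times the exponential of the negative trace has
  derivative 0.\<close>

lemma det_expm: "det (expm L z) = exp (2 * of_real pi * \<i> * trace L * z)" for L :: "complex^2^2"
proof -
  let ?c = "2 * of_real pi * \<i> :: complex"
  let ?E = "\<lambda>i j z. expm L z $ i $ j"
  define f where "f = (\<lambda>z. (?E 1 1 z * ?E 2 2 z - ?E 1 2 z * ?E 2 1 z) * exp (- (?c * trace L * z)))"
  have "(f has_field_derivative 0) (at z within UNIV)" for z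
  proof -
    have d: "(?E i j has_field_derivative ?c * (L $ i $ 1 * ?E 1 j z + L $ i $ 2 * ?E 2 j z)) (at z)" for i j
      using expm_deriv[of L i j z] by (simp add: matrix_matrix_mult_def sum_2)
    show ?thesis unfolding f_def
      by (rule derivative_eq_intros d refl)+ (simp add: trace_def sum_2 algebra_simps)
  qed
  hence "\<exists>c. \<forall>z\<in>UNIV. f z = c" by (intro has_field_derivative_zero_constant) auto
  then obtain c where c: "\<And>z. f z = c" by blast
  have "f 0 = 1" by (simp add: f_def expm_0 mat_def)
  hence "f z = 1" using c[of 0] c[of z] by simp
  thus ?thesis by (simp add: f_def det_2 exp_minus field_simps)
qed

section \<open>The symmetric cube and its exponents\<close>

lemma Sym3_eqI:
  assumes "\<And>v. S *v cubic_monomials v = cubic_monomials (X *v v)"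
  shows "Sym3 X = S"
  by (rule Sym3_unique) (simp add: assms Sym3_cubic_monomials)

lemma Sym3_mult: "Sym3 (X ** Y) = Sym3 X ** Sym3 Y"
  by (rule Sym3_eqI) (simp add: Sym3_cubic_monomials flip: matrix_vector_mul_assoc)

lemma Sym3_1: "Sym3 (mat 1) = mat 1"
  by (rule Sym3_eqI) simp

lemma Sym3_rows:
  fixes X :: "complex^2^2"
  defines "a \<equiv> X $ 1 $ 1" and "b \<equiv> X $ 1 $ 2" and "c \<equiv> X $ 2 $ 1" and "d \<equiv> X $ 2 $ 2"
  shows "Sym3 X $ 1 = vector [a^3, 3*a^2*b, 3*a*b^2, b^3]"
    and "Sym3 X $ 2 = vector [a^2*c, a^2*d + 2*a*b*c, 2*a*b*d + b^2*c, b^2*d]"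
    and "Sym3 X $ 3 = vector [a*c^2, 2*a*c*d + b*c^2, a*d^2 + 2*b*c*d, b*d^2]"
    and "Sym3 X $ 4 = vector [c^3, 3*c^2*d, 3*c*d^2, d^3]"
proof -
  define S :: "complex^4^4" where "S = (\<chi> i.
    if i = 1 then vector [a^3, 3*a^2*b, 3*a*b^2, b^3]
    else if i = 2 then vector [a^2*c, a^2*d + 2*a*b*c, 2*a*b*d + b^2*c, b^2*d]
    else if i = 3 then vector [a*c^2, 2*a*c*d + b*c^2, a*d^2 + 2*b*c*d, b*d^2]
    else vector [c^3, 3*c^2*d, 3*c*d^2, d^3])"
  have "Sym3 X = S"
  proof (rule Sym3_eqI)
    fix v :: "complex^2"
    show "S *v cubic_monomials v = cubic_monomials (X *v v)"
      unfolding vec_eq_iff forall_4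
      by (simp add: S_def a_def b_def c_def d_def matrix_vector_mult_def sum_4 sum_2 vector_def
          power2_eq_square power3_eq_cube algebra_simps)
  qed
  thus "Sym3 X $ 1 = vector [a^3, 3*a^2*b, 3*a*b^2, b^3]"
    "Sym3 X $ 2 = vector [a^2*c, a^2*d + 2*a*b*c, 2*a*b*d + b^2*c, b^2*d]"
    "Sym3 X $ 3 = vector [a*c^2, 2*a*c*d + b*c^2, a*d^2 + 2*b*c*d, b*d^2]"
    "Sym3 X $ 4 = vector [c^3, 3*c^2*d, 3*c*d^2, d^3]"
    by (simp_all add: S_def)
qed

lemma vector_4_nth [simp]:
  "(vector [w, x, y, z] :: 'a::zero^4) $ 1 = w"
  "(vector [w, x, y, z] :: 'a::zero^4) $ 2 = x"
  "(vector [w, x, y, z] :: 'a::zero^4) $ 3 = y"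
  "(vector [w, x, y, z] :: 'a::zero^4) $ 4 = z"
  by (simp_all add: vector_def)

text \<open>The entries of \<open>Sym3 X\<close> are polynomials in those of \<open>X\<close>, so they stay in any algebra of functions.\<close>

lemma Sym3_entry_closed:
  fixes X :: "complex \<Rightarrow> complex^2^2"
  assumes const: "\<And>c. Q (\<lambda>_. c)"
    and add: "\<And>f g. Q f \<Longrightarrow> Q g \<Longrightarrow> Q (\<lambda>z. f z + g z)"
    and mult: "\<And>f g. Q f \<Longrightarrow> Q g \<Longrightarrow> Q (\<lambda>z. f z * g z)"
    and X: "\<And>i j. Q (\<lambda>z. X z $ i $ j)"
  shows "Q (\<lambda>z. Sym3 (X z) $ i $ j)"
  using exhaust_4[of i] exhaust_4[of j]
  by (elim disjE)
     (simp_all add: Sym3_rows power2_eq_square power3_eq_cube X mult add const)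

text \<open>z -> Sym3 (e^(2 pi i L z)) is a one-parameter group whose derivative at 0 is 2 pi i S^3
  L by definition. The group law moves this derivative to every z, so the linear differential
  equation of the right-hand side holds and uniqueness applies.\<close>

lemma Sym3_expm: "Sym3 (expm L z) = expm (Sym3_exponents L) z"
proof -
  let ?c = "2 * of_real pi * \<i> :: complex"
  define Y where "Y = (\<lambda>z. Sym3 (expm L z))"
  have Y_add: "Y (z + w) = Y z ** Y w" for z w
    by (simp add: Y_def expm_add Sym3_mult)
  have Y0: "Y 0 = mat 1" by (simp add: Y_def expm_0 Sym3_1)
  have "(\<lambda>z. Y z $ i $ j) holomorphic_on UNIV" for i j
    unfolding Y_def
    by (rule Sym3_entry_closed[where Q = "\<lambda>f. f holomorphic_on UNIV"]) (intro holomorphic_intros expm_holomorphic; assumption)+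
  hence "((\<lambda>z. Y z $ i $ j) has_field_derivative deriv (\<lambda>z. Y z $ i $ j) 0) (at 0)" for i j
    by (rule holomorphic_derivI) auto
  moreover have "deriv (\<lambda>z. Y z $ i $ j) 0 = ?c * Sym3_exponents L $ i $ j" for i j
    by (simp add: Sym3_exponents_def Y_def expm_def)
  ultimately have d0: "((\<lambda>z. Y z $ i $ j) has_field_derivative ?c * Sym3_exponents L $ i $ j) (at 0)" for i j
    by simp
  have "((\<lambda>w. Y w $ i $ j) has_field_derivative ?c * (Sym3_exponents L ** Y z) $ i $ j) (at z)" for z i j
  proof -
    have "((\<lambda>h. \<Sum>k\<in>UNIV. Y h $ i $ k * Y z $ k $ j) has_field_derivative
            (\<Sum>k\<in>UNIV. ?c * Sym3_exponents L $ i $ k * Y z $ k $ j)) (at 0)"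
      by (intro DERIV_sum DERIV_cmult_right d0)
    hence "((\<lambda>h. Y (h + z) $ i $ j) has_field_derivative ?c * (Sym3_exponents L ** Y z) $ i $ j) (at 0)"
      unfolding Y_add by (simp add: matrix_matrix_mult_def sum_distrib_left mult_ac)
    thus ?thesis using DERIV_shift[of "\<lambda>w. Y w $ i $ j" _ 0 z] by simp
  qed
  from linear_ode_unique[OF this, of z] show ?thesis by (simp add: Y0 Y_def[symmetric]) (simp add: Y_def)
qed

subsection \<open>Vector valued modular forms\<close>

lemma matrix_vector_mult_nth: "(A *v x) $ i = (\<Sum>j\<in>UNIV. A $ i $ j * x $ j)"
  for A :: "'a::semiring_1 ^'n^'m"
  by (simp add: matrix_vector_mult_def)

section \<open>Regularity at the cusp\<close>

definition cusp_regular :: "(complex \<Rightarrow> complex) \<Rightarrow> bool" where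
  "cusp_regular f \<longleftrightarrow> (\<exists>g. has_qexp f g)"

lemma cusp_regularI: "has_qexp f g \<Longrightarrow> cusp_regular f"
  by (auto simp: cusp_regular_def)

lemma cusp_regular_const: "cusp_regular (\<lambda>_. c)"
  by (rule cusp_regularI[OF has_qexp_const])

lemma cusp_regular_add: "cusp_regular f \<Longrightarrow> cusp_regular g \<Longrightarrow> cusp_regular (\<lambda>\<tau>. f \<tau> + g \<tau>)"
  unfolding cusp_regular_def using has_qexp_add by blast

lemma cusp_regular_diff: "cusp_regular f \<Longrightarrow> cusp_regular g \<Longrightarrow> cusp_regular (\<lambda>\<tau>. f \<tau> - g \<tau>)"
  unfolding cusp_regular_def using has_qexp_diff by blast

lemma cusp_regular_mult: "cusp_regular f \<Longrightarrow> cusp_regular g \<Longrightarrow> cusp_regular (\<lambda>\<tau>. f \<tau> * g \<tau>)"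
  unfolding cusp_regular_def using has_qexp_mult by blast

lemma cusp_regular_sum:
  "(\<And>i. i \<in> I \<Longrightarrow> cusp_regular (f i)) \<Longrightarrow> cusp_regular (\<lambda>\<tau>. \<Sum>i\<in>I. f i \<tau>)"
  by (induction I rule: infinite_finite_induct) (auto intro!: cusp_regular_add cusp_regular_const)

lemma cusp_regular_cong: "cusp_regular f \<Longrightarrow> (\<And>\<tau>. Im \<tau> > 0 \<Longrightarrow> f \<tau> = g \<tau>) \<Longrightarrow> cusp_regular g"
  unfolding cusp_regular_def using has_qexp_cong by blast

lemma cusp_regular_deriv: "cusp_regular f \<Longrightarrow> cusp_regular (\<lambda>\<tau>. deriv f \<tau> / (2 * of_real pi * \<i>))"
  unfolding cusp_regular_def using has_qexp_deriv by blast

lemma cusp_regular_E2: "cusp_regular E2"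
  by (rule has_qexp_E2) (rule cusp_regularI)

lemma level1_imp_cusp_regular: "level1 k f \<Longrightarrow> cusp_regular f"
  by (simp add: level1_def cusp_regular_def)

text \<open>Every x with 0 < |x| < 1 is some \<open>qpar \<tau>\<close>, so convergence in the half
  plane is convergence of the power series in the disc; conversely a holomorphic function on the
  disc is its Taylor series. The sequence condition in \<open>modular_forms\<close> thus becomes a
  condition on components that is stable under sums, products and derivatives.\<close>

lemma qexpansion_iff_cusp_regular:
  fixes V :: "complex \<Rightarrow> complex^'d"
  shows "(\<exists>a :: nat \<Rightarrow> complex^'d. \<forall>\<tau>. Im \<tau> > 0 \<longrightarrow> (\<lambda>n. (qpar \<tau> ^ n) *s a n) sums V \<tau>) \<longleftrightarrow>
         (\<forall>i. cusp_regular (\<lambda>\<tau>. V \<tau> $ i))"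
proof
  assume "\<exists>a :: nat \<Rightarrow> complex^'d. \<forall>\<tau>. Im \<tau> > 0 \<longrightarrow> (\<lambda>n. (qpar \<tau> ^ n) *s a n) sums V \<tau>"
  then obtain a :: "nat \<Rightarrow> complex^'d"
    where a: "\<And>\<tau>. Im \<tau> > 0 \<Longrightarrow> (\<lambda>n. (qpar \<tau> ^ n) *s a n) sums V \<tau>" by blast
  show "\<forall>i. cusp_regular (\<lambda>\<tau>. V \<tau> $ i)"
  proof
    fix i
    have s: "(\<lambda>n. a n $ i * qpar \<tau> ^ n) sums (V \<tau> $ i)" if "Im \<tau> > 0" for \<tau>
    proof -
      have "(\<lambda>n. \<Sum>k<n. (qpar \<tau> ^ k) *s a k) \<longlonglongrightarrow> V \<tau>" using a[OF that] by (simp add: sums_def)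
      from tendsto_vec_nth[OF this, of i] show ?thesis by (simp add: sums_def mult.commute)
    qed
    have sm: "summable (\<lambda>n. a n $ i * x ^ n)" if "norm x < 1" for x
    proof (cases "x = 0")
      case False
      have "norm x < 1" by (rule that)
      with False obtain \<tau> where \<tau>: "Im \<tau> > 0" "qpar \<tau> = x" by (rule qpar_surj)
      from sums_summable[OF s[OF \<tau>(1)]] \<tau>(2) show ?thesis by simp
    qed auto
    have "has_qexp (\<lambda>\<tau>. V \<tau> $ i) (\<lambda>x. \<Sum>n. a n $ i * x ^ n)"
      unfolding has_qexp_def using powser_holomorphic[OF sm] sums_unique[OF s] by simp
    thus "cusp_regular (\<lambda>\<tau>. V \<tau> $ i)" by (rule cusp_regularI)
  qed
next
  assume "\<forall>i. cusp_regular (\<lambda>\<tau>. V \<tau> $ i)"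
  then obtain g where g: "\<And>i. has_qexp (\<lambda>\<tau>. V \<tau> $ i) (g i)"
    unfolding cusp_regular_def by metis
  define a :: "nat \<Rightarrow> complex^'d" where "a = (\<lambda>n. \<chi> i. (deriv ^^ n) (g i) 0 / fact n)"
  have "(\<lambda>n. (qpar \<tau> ^ n) *s a n) sums V \<tau>" if "Im \<tau> > 0" for \<tau>
  proof (rule sums_vec_nth)
    fix i
    have "(\<lambda>n. (deriv ^^ n) (g i) 0 / fact n * (qpar \<tau> - 0) ^ n) sums g i (qpar \<tau>)"
      using g[of i] that by (intro holomorphic_power_series[of _ _ 1]) (auto simp: has_qexp_def norm_qpar_less_1)
    moreover have "g i (qpar \<tau>) = V \<tau> $ i" using g[of i] that by (simp add: has_qexp_def)
    ultimately show "(\<lambda>n. ((qpar \<tau> ^ n) *s a n) $ i) sums (V \<tau> $ i)"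
      by (simp add: a_def mult.commute)
  qed
  thus "\<exists>a :: nat \<Rightarrow> complex^'d. \<forall>\<tau>. Im \<tau> > 0 \<longrightarrow> (\<lambda>n. (qpar \<tau> ^ n) *s a n) sums V \<tau>" by blast
qed

section \<open>Spaces of vector valued forms and the modular derivative\<close>

definition aut :: "int^2^2 \<Rightarrow> complex \<Rightarrow> complex" where
  "aut \<gamma> \<tau> = of_int (\<gamma> $ 2 $ 1) * \<tau> + of_int (\<gamma> $ 2 $ 2)"

definition act :: "int^2^2 \<Rightarrow> complex \<Rightarrow> complex" where
  "act \<gamma> \<tau> = (of_int (\<gamma> $ 1 $ 1) * \<tau> + of_int (\<gamma> $ 1 $ 2)) / aut \<gamma> \<tau>"

lemma SL2Z_det: "\<gamma> \<in> SL2Z \<Longrightarrow> \<gamma> $ 1 $ 1 * \<gamma> $ 2 $ 2 - \<gamma> $ 1 $ 2 * \<gamma> $ 2 $ 1 = 1"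
  by (simp add: SL2Z_def det_2)

lemma act_Im_pos: "\<gamma> \<in> SL2Z \<Longrightarrow> Im \<tau> > 0 \<Longrightarrow> Im (act \<gamma> \<tau>) > 0"
  unfolding act_def aut_def by (rule moebius_Im_pos[OF SL2Z_det])

lemma aut_nonzero: "\<gamma> \<in> SL2Z \<Longrightarrow> Im \<tau> > 0 \<Longrightarrow> aut \<gamma> \<tau> \<noteq> 0"
  unfolding aut_def by (rule moebius_denominator_nonzero[OF SL2Z_det])

lemma modular_forms_iff:
  "F \<in> modular_forms \<rho> L k \<longleftrightarrow>
     (\<forall>\<tau>. Im \<tau> \<le> 0 \<longrightarrow> F \<tau> = 0) \<and>
     (\<forall>i. (\<lambda>\<tau>. F \<tau> $ i) holomorphic_on {\<tau>. Im \<tau> > 0}) \<and>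
     (\<forall>\<gamma>\<in>SL2Z. \<forall>\<tau>. Im \<tau> > 0 \<longrightarrow> F (act \<gamma> \<tau>) = (aut \<gamma> \<tau> powi k) *s (\<rho> \<gamma> *v F \<tau>)) \<and>
     (\<forall>i. cusp_regular (\<lambda>\<tau>. (expm L (- \<tau>) *v F \<tau>) $ i))"
proof -
  have "mat_exp (mat (- 2 * of_real pi * \<i> * \<tau>) ** L) = expm L (- \<tau>)" for \<tau>
    by (simp add: expm_def)
  thus ?thesis
    unfolding modular_forms_def act_def aut_def by (simp add: qexpansion_iff_cusp_regular)
qed

lemma modular_formsD:
  fixes F :: "complex \<Rightarrow> complex^'d"
  assumes "F \<in> modular_forms \<rho> L k"
  shows "Im \<tau> \<le> 0 \<Longrightarrow> F \<tau> = 0"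
    and "(\<lambda>\<tau>. F \<tau> $ i) holomorphic_on {\<tau>. Im \<tau> > 0}"
    and "\<gamma> \<in> SL2Z \<Longrightarrow> Im \<tau> > 0 \<Longrightarrow> F (act \<gamma> \<tau>) = (aut \<gamma> \<tau> powi k) *s (\<rho> \<gamma> *v F \<tau>)"
    and "cusp_regular (\<lambda>\<tau>. (expm L (- \<tau>) *v F \<tau>) $ i)"
  using assms by (auto simp: modular_forms_iff)

lemma modular_forms_zero: "(\<lambda>\<tau>. 0) \<in> modular_forms \<rho> L k"
  by (auto simp: modular_forms_iff vec_eq_iff matrix_vector_mult_def intro: cusp_regular_const)

lemma modular_forms_add:
  assumes "F \<in> modular_forms \<rho> L k" "G \<in> modular_forms \<rho> L k"
  shows "(\<lambda>\<tau>. F \<tau> + G \<tau>) \<in> modular_forms \<rho> L k"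
  using assms
  by (auto simp: modular_forms_iff matrix_vector_right_distrib vector_add_ldistrib
      intro!: holomorphic_intros cusp_regular_add)

lemma modular_forms_sum:
  "(\<And>i. i \<in> I \<Longrightarrow> F i \<in> modular_forms \<rho> L k) \<Longrightarrow> (\<lambda>\<tau>. \<Sum>i\<in>I. F i \<tau>) \<in> modular_forms \<rho> L k"
  by (induction I rule: infinite_finite_induct) (auto intro!: modular_forms_add modular_forms_zero)

lemma modular_forms_scale:
  fixes F :: "complex \<Rightarrow> complex^'d"
  assumes \<phi>: "\<phi> \<in> M1_weight l" and F: "F \<in> modular_forms \<rho> L k"
  shows "(\<lambda>\<tau>. \<phi> \<tau> *s F \<tau>) \<in> modular_forms \<rho> L (l + k)"
  unfolding modular_forms_iff
proof (intro conjI allI ballI impI)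
  have l: "level1 l \<phi>" using \<phi> by (simp add: M1_weight_iff)
  note F = modular_formsD[OF F]
  show "\<phi> \<tau> *s F \<tau> = 0" if "Im \<tau> \<le> 0" for \<tau> using F(1)[OF that] by simp
  obtain g where "has_qexp \<phi> g" using l by (auto simp: level1_def)
  thus "(\<lambda>\<tau>. (\<phi> \<tau> *s F \<tau>) $ i) holomorphic_on {\<tau>. Im \<tau> > 0}" for i
    by (simp add: holomorphic_on_mult has_qexp_imp_holomorphic F(2))
  fix \<gamma> \<tau> assume \<gamma>: "\<gamma> \<in> SL2Z" and \<tau>: "Im \<tau> > 0"
  have "\<phi> (act \<gamma> \<tau>) = aut \<gamma> \<tau> powi l * \<phi> \<tau>"
    unfolding act_def aut_def by (rule level1_moebius[OF l SL2Z_det[OF \<gamma>] \<tau>])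
  thus "\<phi> (act \<gamma> \<tau>) *s F (act \<gamma> \<tau>) = (aut \<gamma> \<tau> powi (l + k)) *s (\<rho> \<gamma> *v (\<phi> \<tau> *s F \<tau>))"
    using aut_nonzero[OF \<gamma> \<tau>] F(3)[OF \<gamma> \<tau>]
    by (simp add: vec_eq_iff matrix_vector_mult_def power_int_add sum_distrib_left mult_ac)
next
  fix i
  have l: "level1 l \<phi>" using \<phi> by (simp add: M1_weight_iff)
  have "cusp_regular (\<lambda>\<tau>. \<phi> \<tau> * (expm L (- \<tau>) *v F \<tau>) $ i)"
    by (intro cusp_regular_mult level1_imp_cusp_regular[OF l] modular_formsD(4)[OF F])
  thus "cusp_regular (\<lambda>\<tau>. (expm L (- \<tau>) *v (\<phi> \<tau> *s F \<tau>)) $ i)"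
    by (rule cusp_regular_cong) (simp add: matrix_vector_mult_def sum_distrib_left mult_ac)
qed

lemma mod_deriv_nth:
  fixes F :: "complex \<Rightarrow> complex^'d"
  shows "Im \<tau> > 0 \<Longrightarrow> mod_deriv k F \<tau> $ i = serre_deriv k (\<lambda>z. F z $ i) \<tau>"
  by (simp add: mod_deriv_def serre_deriv_def)

lemma serre_deriv_holomorphic:
  assumes "f holomorphic_on {\<tau>. Im \<tau> > 0}"
  shows "serre_deriv k f holomorphic_on {\<tau>. Im \<tau> > 0}"
proof -
  obtain e where "has_qexp E2 e" by (rule has_qexp_E2)
  hence "E2 holomorphic_on {\<tau>. Im \<tau> > 0}" by (rule has_qexp_imp_holomorphic)
  thus ?thesis unfolding serre_deriv_def[abs_def] by (intro holomorphic_intros assms) auto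
qed

text \<open>The transformation law is \<open>serre_deriv_moebius\<close> for each row of
  \<rho>(\<gamma>). At the cusp, put V = e^(-2 pi i L tau) F: differentiating the exponential costs
  -L V, so e^(-2 pi i L tau) D F = q dV/dq + L V - k/12 E_2 V, whose components are regular.\<close>

lemma mod_deriv_modular_forms:
  fixes F :: "complex \<Rightarrow> complex^'d"
  assumes F: "F \<in> modular_forms \<rho> L k"
  shows "mod_deriv k F \<in> modular_forms \<rho> L (k + 2)"
  unfolding modular_forms_iff
proof (intro conjI allI ballI impI)
  let ?c = "2 * of_real pi * \<i> :: complex"
  note FD = modular_formsD[OF F]
  show "mod_deriv k F \<tau> = 0" if "Im \<tau> \<le> 0" for \<tau> using that by (simp add: mod_deriv_def)
  show "(\<lambda>\<tau>. mod_deriv k F \<tau> $ i) holomorphic_on {\<tau>. Im \<tau> > 0}" for i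
    by (rule holomorphic_transform[OF serre_deriv_holomorphic[OF FD(2)]]) (simp add: mod_deriv_nth)
  show "mod_deriv k F (act \<gamma> \<tau>) = (aut \<gamma> \<tau> powi (k + 2)) *s (\<rho> \<gamma> *v mod_deriv k F \<tau>)"
    if \<gamma>: "\<gamma> \<in> SL2Z" and \<tau>: "Im \<tau> > 0" for \<gamma> \<tau>
  proof -
    have "serre_deriv k (\<lambda>z. F z $ i) (act \<gamma> \<tau>) =
            aut \<gamma> \<tau> powi (k + 2) * (\<Sum>l\<in>UNIV. \<rho> \<gamma> $ i $ l * serre_deriv k (\<lambda>z. F z $ l) \<tau>)" for i
      unfolding act_def aut_def
    proof (rule serre_deriv_moebius[OF SL2Z_det[OF \<gamma>] \<tau> FD(2) FD(2)], fold aut_def, fold act_def)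
      fix \<tau> :: complex assume "Im \<tau> > 0"
      from FD(3)[OF \<gamma> this] show "F (act \<gamma> \<tau>) $ i = aut \<gamma> \<tau> powi k * (\<Sum>l\<in>UNIV. \<rho> \<gamma> $ i $ l * F \<tau> $ l)"
        by (simp add: matrix_vector_mult_def)
    qed
    thus ?thesis
      by (simp add: vec_eq_iff mod_deriv_nth act_Im_pos \<gamma> \<tau> matrix_vector_mult_def)
  qed
  fix i
  define V where "V = (\<lambda>i \<tau>. (expm L (- \<tau>) *v F \<tau>) $ i)"
  have V: "cusp_regular (V i)" for i unfolding V_def by (rule FD(4))
  have "cusp_regular (\<lambda>\<tau>. deriv (V i) \<tau> / ?c + (\<Sum>l\<in>UNIV. L $ i $ l * V l \<tau>) - of_int k / 12 * E2 \<tau> * V i \<tau>)"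
    by (intro cusp_regular_add cusp_regular_diff cusp_regular_mult cusp_regular_sum cusp_regular_const
        cusp_regular_E2 cusp_regular_deriv V)
  thus "cusp_regular (\<lambda>\<tau>. (expm L (- \<tau>) *v mod_deriv k F \<tau>) $ i)"
  proof (rule cusp_regular_cong)
    fix \<tau> :: complex assume \<tau>: "Im \<tau> > 0"
    let ?E = "expm L (- \<tau>)"
    have neg: "((\<lambda>z. expm L (- z) $ i $ j) has_field_derivative - (?c * (L ** ?E) $ i $ j)) (at \<tau>)" for i j
      using DERIV_chain2[where g = uminus and x = \<tau> and s = UNIV, OF expm_deriv[of L i j "- \<tau>"] DERIV_minus[OF DERIV_ident]]
      by simp
    have dF: "((\<lambda>z. F z $ l) has_field_derivative deriv (\<lambda>z. F z $ l) \<tau>) (at \<tau>)" for l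
      using holomorphic_derivI[OF FD(2) open_upper_half_plane] \<tau> by simp
    have "((\<lambda>z. \<Sum>l\<in>UNIV. expm L (- z) $ i $ l * F z $ l) has_field_derivative
        (\<Sum>l\<in>UNIV. - (?c * (L ** ?E) $ i $ l) * F \<tau> $ l + deriv (\<lambda>z. F z $ l) \<tau> * ?E $ i $ l)) (at \<tau>)"
      by (intro DERIV_sum DERIV_mult neg dF)
    hence "deriv (V i) \<tau> =
        (\<Sum>l\<in>UNIV. - (?c * (L ** ?E) $ i $ l) * F \<tau> $ l + deriv (\<lambda>z. F z $ l) \<tau> * ?E $ i $ l)"
      unfolding V_def matrix_vector_mult_def by (simp add: DERIV_imp_deriv)
    also have "\<dots> = (\<Sum>l\<in>UNIV. ?c * (?E $ i $ l * (deriv (\<lambda>z. F z $ l) \<tau> / ?c))) - ?c * ((L ** ?E) *v F \<tau>) $ i"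
      by (simp add: matrix_vector_mult_def sum.distrib sum_negf sum_subtractf sum_distrib_left mult_ac)
    also have "(L ** ?E) *v F \<tau> = L *v (?E *v F \<tau>)" by (simp add: matrix_vector_mul_assoc)
    also have "(L *v (?E *v F \<tau>)) $ i = (\<Sum>l\<in>UNIV. L $ i $ l * V l \<tau>)"
      by (simp add: matrix_vector_mult_def[of L] V_def)
    finally have e: "deriv (V i) \<tau> = ?c * (\<Sum>l\<in>UNIV. ?E $ i $ l * (deriv (\<lambda>z. F z $ l) \<tau> / ?c)) -
                    ?c * (\<Sum>l\<in>UNIV. L $ i $ l * V l \<tau>)"
      by (simp only: sum_distrib_left)
    have "deriv (V i) \<tau> / ?c = (\<Sum>l\<in>UNIV. ?E $ i $ l * (deriv (\<lambda>z. F z $ l) \<tau> / ?c)) -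
                    (\<Sum>l\<in>UNIV. L $ i $ l * V l \<tau>)"
      unfolding e right_diff_distrib[symmetric] by (rule nonzero_mult_div_cancel_left) simp
    hence "deriv (V i) \<tau> / ?c + (\<Sum>l\<in>UNIV. L $ i $ l * V l \<tau>) - of_int k / 12 * E2 \<tau> * V i \<tau> =
        (\<Sum>l\<in>UNIV. ?E $ i $ l * (deriv (\<lambda>z. F z $ l) \<tau> / ?c)) - of_int k / 12 * E2 \<tau> * V i \<tau>"
      by simp
    also have "\<dots> = (?E *v mod_deriv k F \<tau>) $ i"
      using \<tau> by (simp add: matrix_vector_mult_def V_def mod_deriv_nth serre_deriv_def
          sum_distrib_left sum_subtractf algebra_simps)
    finally show "deriv (V i) \<tau> / ?c + (\<Sum>l\<in>UNIV. L $ i $ l * V l \<tau>) - of_int k / 12 * E2 \<tau> * V i \<tau> =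
        (?E *v mod_deriv k F \<tau>) $ i" .
  qed
qed

text \<open>The defining property of Sym3 is applied to two matrices: \<alpha>(\<gamma>) for the
  transformation law and e^(-2 pi i L tau) for the cusp.\<close>

lemma cubic_modular_forms:
  assumes A: "A \<in> modular_forms \<alpha> L k"
  shows "(\<lambda>\<tau>. cubic_monomials (A \<tau>)) \<in> modular_forms (\<lambda>\<gamma>. Sym3 (\<alpha> \<gamma>)) (Sym3_exponents L) (3 * k)"
proof -
  note AD = modular_formsD[OF A]
  have entry: "Q (\<lambda>\<tau>. cubic_monomials (v \<tau>) $ i)"
    if "\<And>f g. Q f \<Longrightarrow> Q g \<Longrightarrow> Q (\<lambda>z. f z * g z)" "\<And>i. Q (\<lambda>\<tau>. v \<tau> $ i)"
    for Q :: "(complex \<Rightarrow> complex) \<Rightarrow> bool" and v :: "complex \<Rightarrow> complex^2" and i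
    using exhaust_4[of i] by (elim disjE) (simp_all add: power2_eq_square power3_eq_cube that)
  show ?thesis unfolding modular_forms_iff
  proof (intro conjI allI ballI impI)
    show "cubic_monomials (A \<tau>) = 0" if "Im \<tau> \<le> 0" for \<tau>
      using AD(1)[OF that] by (simp add: vec_eq_iff forall_4)
    show "(\<lambda>\<tau>. cubic_monomials (A \<tau>) $ i) holomorphic_on {\<tau>. Im \<tau> > 0}" for i
      by (rule entry) (auto intro: holomorphic_on_mult AD(2))
    have scale: "cubic_monomials (c *s v) = c ^ 3 *s cubic_monomials v" for c v
      by (simp add: vec_eq_iff forall_4 power2_eq_square power3_eq_cube mult_ac)
    show "cubic_monomials (A (act \<gamma> \<tau>)) =
        (aut \<gamma> \<tau> powi (3 * k)) *s (Sym3 (\<alpha> \<gamma>) *v cubic_monomials (A \<tau>))"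
      if "\<gamma> \<in> SL2Z" "Im \<tau> > 0" for \<gamma> \<tau>
      unfolding AD(3)[OF that] scale Sym3_cubic_monomials
      by (simp add: power_int_mult mult.commute[of 3])
    show "cusp_regular (\<lambda>\<tau>. (expm (Sym3_exponents L) (- \<tau>) *v cubic_monomials (A \<tau>)) $ i)" for i
      unfolding Sym3_expm[symmetric] Sym3_cubic_monomials
      by (rule entry) (auto intro: cusp_regular_mult AD(4))
  qed
qed

definition S_mat :: "int^2^2" where "S_mat = vector [vector [0, -1], vector [1, 0]]"

lemma S_mat: "S_mat \<in> SL2Z" "act S_mat \<tau> = - 1 / \<tau>" "aut S_mat \<tau> = \<tau>"
  by (simp_all add: S_mat_def SL2Z_def det_2 act_def aut_def)

lemma T_mat: "T_mat \<in> SL2Z"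
  by (simp add: T_mat_def SL2Z_def det_2)

text \<open>Row i of \<open>Z\<close> behaves under S like a form of weight -w i with values in the
  dual representation, so its pairing with G is scalar. Inserting e^(2 pi i L tau) e^(-2 pi i L tau)
  = 1 between them splits the pairing into factors regular at the cusp, which also takes care of
  T.\<close>

lemma coordinates_level1:
  fixes Z :: "complex \<Rightarrow> complex^'d^'d" and G :: "complex \<Rightarrow> complex^'d"
  assumes G: "G \<in> modular_forms \<rho> L k"
    and Z: "\<And>\<tau> i l. Im \<tau> > 0 \<Longrightarrow> (Z (- 1 / \<tau>) ** \<rho> S_mat) $ i $ l = \<tau> powi (- w i) * Z \<tau> $ i $ l"
    and reg: "\<And>i l. cusp_regular (\<lambda>\<tau>. (Z \<tau> ** expm L \<tau>) $ i $ l)"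
  shows "level1 (k - w i) (\<lambda>\<tau>. (Z \<tau> *v G \<tau>) $ i)"
proof -
  have "cusp_regular (\<lambda>\<tau>. (Z \<tau> *v G \<tau>) $ i)"
  proof (rule cusp_regular_cong)
    show "cusp_regular (\<lambda>\<tau>. \<Sum>l\<in>UNIV. (Z \<tau> ** expm L \<tau>) $ i $ l * (expm L (- \<tau>) *v G \<tau>) $ l)"
      by (intro cusp_regular_sum cusp_regular_mult reg modular_formsD(4)[OF G])
    fix \<tau>
    have "(\<Sum>l\<in>UNIV. (Z \<tau> ** expm L \<tau>) $ i $ l * (expm L (- \<tau>) *v G \<tau>) $ l) =
        ((Z \<tau> ** expm L \<tau>) *v (expm L (- \<tau>) *v G \<tau>)) $ i"
      by (simp add: matrix_vector_mult_def[of "Z \<tau> ** expm L \<tau>"])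
    also have "(Z \<tau> ** expm L \<tau>) *v (expm L (- \<tau>) *v G \<tau>) = (Z \<tau> ** (expm L \<tau> ** expm L (- \<tau>))) *v G \<tau>"
      by (simp add: matrix_vector_mul_assoc matrix_mul_assoc)
    finally show "(\<Sum>l\<in>UNIV. (Z \<tau> ** expm L \<tau>) $ i $ l * (expm L (- \<tau>) *v G \<tau>) $ l) = (Z \<tau> *v G \<tau>) $ i"
      by (simp add: expm_minus)
  qed
  moreover have "(Z (- 1 / \<tau>) *v G (- 1 / \<tau>)) $ i = \<tau> powi (k - w i) * (Z \<tau> *v G \<tau>) $ i" if \<tau>: "Im \<tau> > 0" for \<tau>
  proof -
    have "G (- 1 / \<tau>) = (\<tau> powi k) *s (\<rho> S_mat *v G \<tau>)"
      using modular_formsD(3)[OF G S_mat(1) \<tau>] by (simp add: S_mat)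
    hence "Z (- 1 / \<tau>) *v G (- 1 / \<tau>) = (\<tau> powi k) *s ((Z (- 1 / \<tau>) ** \<rho> S_mat) *v G \<tau>)"
      by (simp add: vector_scalar_commute matrix_vector_mul_assoc)
    also have "\<dots> $ i = (\<Sum>l\<in>UNIV. \<tau> powi k * (\<tau> powi (- w i) * Z \<tau> $ i $ l * G \<tau> $ l))"
      by (simp only: vector_smult_component matrix_vector_mult_nth Z[OF \<tau>] sum_distrib_left)
    also have "\<dots> = \<tau> powi (k + - w i) * (Z \<tau> *v G \<tau>) $ i"
      using upper_half_plane_nonzero[OF \<tau>]
      by (subst power_int_add) (simp_all add: matrix_vector_mult_def sum_distrib_left mult_ac)
    finally show ?thesis by simp
  qed
  ultimately show ?thesis by (auto simp: level1_def cusp_regular_def)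
qed

subsection \<open>The Wronskian matrix of a form of minimal weight\<close>

text \<open>Cramer's rule written out, so that the entries of the inverse are visibly quotients by
  the determinant and inherit regularity at the cusp from its nonvanishing.\<close>

definition inv2 :: "complex^2^2 \<Rightarrow> complex^2^2" where
  "inv2 M = vector [vector [M $ 2 $ 2 / det M, - M $ 1 $ 2 / det M],
                    vector [- M $ 2 $ 1 / det M, M $ 1 $ 1 / det M]]"

definition diag2 :: "complex \<Rightarrow> complex \<Rightarrow> complex^2^2" where
  "diag2 a b = vector [vector [a, 0], vector [0, b]]"

lemma inv2:
  assumes "det M \<noteq> 0"
  shows "M ** inv2 M = mat 1" "inv2 M ** M = mat 1"
proof -
  have d: "M $ 1 $ 1 * M $ 2 $ 2 - M $ 1 $ 2 * M $ 2 $ 1 = det M" by (simp add: det_2)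
  have "M $ 1 $ 1 * (M $ 2 $ 2 / det M) - M $ 1 $ 2 * (M $ 2 $ 1 / det M) = 1"
    using assms by (simp add: d flip: diff_divide_distrib)
  thus "M ** inv2 M = mat 1" "inv2 M ** M = mat 1"
    by (simp_all add: vec_eq_iff forall_2 matrix_mult_nth sum_2 inv2_def mat_def algebra_simps)
qed

lemma inverse_unique:
  fixes M N :: "complex^2^2"
  assumes "N ** M = mat 1" "det M \<noteq> 0"
  shows "N = inv2 M"
proof -
  have "N = N ** (M ** inv2 M)" using assms(2) by (simp add: inv2)
  also have "\<dots> = inv2 M" by (simp add: matrix_mul_assoc assms(1))
  finally show ?thesis .
qed

lemma diag2_mult_nth: "(diag2 a b ** M) $ i $ l = (if i = 1 then a else b) * M $ i $ l"
  using exhaust_2[of i] by (auto simp: matrix_mult_nth sum_2 diag2_def)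

lemma mult_diag2_nth: "(M ** diag2 a b) $ i $ l = M $ i $ l * (if l = 1 then a else b)"
  for M :: "complex^2^'n"
  using exhaust_2[of l] by (auto simp: matrix_mult_nth sum_2 diag2_def)

lemma Sym3_diag2_mult_nth:
  "(Sym3 (diag2 a b) ** M) $ i $ l =
     (if i = 1 then a ^ 3 else if i = 2 then a ^ 2 * b else if i = 3 then a * b ^ 2 else b ^ 3) * M $ i $ l"
  using exhaust_4[of i] by (auto simp: matrix_mult_nth sum_4 Sym3_rows diag2_def)

lemma SL2Z_mult: "\<gamma> \<in> SL2Z \<Longrightarrow> \<delta> \<in> SL2Z \<Longrightarrow> \<gamma> ** \<delta> \<in> SL2Z"
  by (simp add: SL2Z_def det_mul)

text \<open>The relation \<open>(S T)\<^sup>3 = S\<^sup>2\<close> determines a character on \<open>S\<close> from its value on \<open>T\<close>.\<close>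

lemma det_rep_S:
  assumes rep: "representation \<alpha>" and T: "det (\<alpha> T_mat) ^ 6 = 1"
  shows "det (\<alpha> S_mat) ^ 6 = 1"
proof -
  have mult: "\<alpha> (\<gamma> ** \<delta>) = \<alpha> \<gamma> ** \<alpha> \<delta>" if "\<gamma> \<in> SL2Z" "\<delta> \<in> SL2Z" for \<gamma> \<delta>
    using rep that by (simp add: representation_def)
  define U where "U = S_mat ** T_mat"
  have U: "U \<in> SL2Z" unfolding U_def by (intro SL2Z_mult S_mat(1) T_mat)
  have "U ** (U ** U) = S_mat ** S_mat"
    by (simp add: U_def vec_eq_iff forall_2 matrix_mult_nth sum_2 S_mat_def T_mat_def)
  hence "\<alpha> (U ** (U ** U)) = \<alpha> (S_mat ** S_mat)" by simp
  hence "\<alpha> U ** (\<alpha> U ** \<alpha> U) = \<alpha> S_mat ** \<alpha> S_mat"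
    by (simp add: mult U SL2Z_mult S_mat)
  moreover have "\<alpha> U = \<alpha> S_mat ** \<alpha> T_mat" unfolding U_def by (rule mult[OF S_mat(1) T_mat])
  ultimately have "det (\<alpha> S_mat ** \<alpha> T_mat ** (\<alpha> S_mat ** \<alpha> T_mat ** (\<alpha> S_mat ** \<alpha> T_mat))) =
      det (\<alpha> S_mat ** \<alpha> S_mat)" by simp
  hence "(det (\<alpha> S_mat) * det (\<alpha> S_mat)) * (det (\<alpha> S_mat) * det (\<alpha> T_mat) ^ 3) =
         (det (\<alpha> S_mat) * det (\<alpha> S_mat)) * 1"
    by (simp add: det_mul power3_eq_cube mult_ac)
  moreover have "det (\<alpha> S_mat) \<noteq> 0"
    using rep S_mat(1) invertible_det_nz by (auto simp: representation_def)
  ultimately have "det (\<alpha> S_mat) * det (\<alpha> T_mat) ^ 3 = 1" unfolding mult_cancel_left by simp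
  hence "(det (\<alpha> S_mat) * det (\<alpha> T_mat) ^ 3) ^ 6 = 1" by simp
  hence "det (\<alpha> S_mat) ^ 6 * (det (\<alpha> T_mat) ^ 6) ^ 3 = 1"
    by (simp only: power_mult_distrib power_mult[symmetric]) (simp add: mult.commute)
  thus ?thesis by (simp add: T)
qed

text \<open>Where f does not vanish, g / f has derivative 0. It is therefore constant on a small
  ball, and the identity theorem spreads the linear relation over the half plane, across the zeros
  of f.\<close>

lemma Wronskian_zero_imp_dependent:
  assumes f: "f holomorphic_on {\<tau>. Im \<tau> > 0}" and g: "g holomorphic_on {\<tau>. Im \<tau> > 0}"
    and W: "\<And>\<tau>. Im \<tau> > 0 \<Longrightarrow> f \<tau> * deriv g \<tau> = g \<tau> * deriv f \<tau>"
  obtains x y :: complex where "x \<noteq> 0 \<or> y \<noteq> 0" "\<And>\<tau>. Im \<tau> > 0 \<Longrightarrow> x * f \<tau> + y * g \<tau> = 0"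
proof (cases "\<forall>\<tau>. Im \<tau> > 0 \<longrightarrow> f \<tau> = 0")
  case True
  thus ?thesis using that[of 1 0] by simp
next
  case False
  then obtain \<tau>0 where t0: "Im \<tau>0 > 0" "f \<tau>0 \<noteq> 0" by blast
  let ?H = "{\<tau>. Im \<tau> > 0}"
  have "isCont f \<tau>0"
    using holomorphic_on_imp_continuous_on[OF f] t0(1) by (simp add: continuous_on_eq_continuous_at)
  hence "eventually (\<lambda>z. f z \<noteq> 0) (nhds \<tau>0)"
    using t0(2) by (simp add: isCont_def tendsto_imp_eventually_ne eventually_nhds_conv_at)
  hence "eventually (\<lambda>z. f z \<noteq> 0 \<and> Im z > 0) (nhds \<tau>0)"
    using eventually_upper_half_plane[OF t0(1)] by eventually_elim simp
  then obtain e where e: "e > 0" "\<And>z. dist z \<tau>0 < e \<Longrightarrow> f z \<noteq> 0 \<and> Im z > 0"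
    unfolding eventually_nhds_metric by blast
  define B where "B = ball \<tau>0 e"
  have B: "f z \<noteq> 0" "Im z > 0" if "z \<in> B" for z
    using e(2)[of z] that by (auto simp: B_def dist_commute)
  have "((\<lambda>z. g z / f z) has_field_derivative 0) (at z within B)" if z: "z \<in> B" for z
  proof -
    have "(g has_field_derivative deriv g z) (at z)" "(f has_field_derivative deriv f z) (at z)"
      using holomorphic_derivI[OF g open_upper_half_plane] holomorphic_derivI[OF f open_upper_half_plane]
        B(2)[OF z] by auto
    from DERIV_divide[OF this B(1)[OF z]]
    have "((\<lambda>z. g z / f z) has_field_derivative 0) (at z)"
      using W[OF B(2)[OF z]] by (simp add: mult.commute)
    thus ?thesis by (rule has_field_derivative_at_within)
  qed
  hence "\<exists>c. \<forall>z\<in>B. g z / f z = c"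
    by (intro has_field_derivative_zero_constant) (auto simp: B_def)
  then obtain c where c: "\<And>z. z \<in> B \<Longrightarrow> g z / f z = c" by blast
  have eq: "g z = c * f z" if "z \<in> B" for z
    using c[OF that] B(1)[OF that] by (simp add: field_simps)
  have "g \<tau> = c * f \<tau>" if "Im \<tau> > 0" for \<tau>
  proof (rule analytic_continuation_open[of B ?H g "\<lambda>z. c * f z"])
    show "connected ?H" by (rule convex_connected) simp
  qed (use e(1) B(2) g f eq that in \<open>auto simp: B_def intro!: holomorphic_intros\<close>)
  thus ?thesis using that[of c "-1"] by simp
qed

locale minimal_form =
  fixes \<alpha> :: "int^2^2 \<Rightarrow> complex^2^2" and L :: "complex^2^2" and k :: int
    and A :: "complex \<Rightarrow> complex^2"
  assumes irred: "irreducible_rep \<alpha>"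
    and exponents: "choice_of_exponents \<alpha> L"
    and weight: "of_int k = 6 * trace L - 1"
    and A: "A \<in> modular_forms \<alpha> L k"
    and A_nonzero: "A \<noteq> (\<lambda>\<tau>. 0)"
begin

abbreviation DA :: "complex \<Rightarrow> complex^2" where "DA \<equiv> mod_deriv k A"

definition X :: "complex \<Rightarrow> complex^2^2" where
  "X \<tau> = (\<chi> i j. if j = 1 then A \<tau> $ i else DA \<tau> $ i)"

lemma rep: "representation \<alpha>"
  using irred by (simp add: irreducible_rep_def)

lemma DA: "DA \<in> modular_forms \<alpha> L (k + 2)"
  by (rule mod_deriv_modular_forms[OF A])

lemma X_inversion:
  assumes "Im \<tau> > 0"
  shows "X (- 1 / \<tau>) = \<alpha> S_mat ** X \<tau> ** diag2 (\<tau> powi k) (\<tau> powi (k + 2))"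
proof -
  have "A (- 1 / \<tau>) = (\<tau> powi k) *s (\<alpha> S_mat *v A \<tau>)"
    using modular_formsD(3)[OF A S_mat(1) assms] by (simp add: S_mat)
  moreover have "DA (- 1 / \<tau>) = (\<tau> powi (k + 2)) *s (\<alpha> S_mat *v DA \<tau>)"
    using modular_formsD(3)[OF DA S_mat(1) assms] by (simp add: S_mat)
  ultimately show ?thesis
    by (simp add: vec_eq_iff forall_2 mult_diag2_nth matrix_mult_nth[of "\<alpha> S_mat"] X_def
        matrix_vector_mult_nth mult_ac)
qed

lemma rep_mat_1: "\<alpha> (mat 1) = mat 1"
proof -
  have I: "mat 1 \<in> SL2Z" by (simp add: SL2Z_def)
  have "\<alpha> (mat 1 ** mat 1) = \<alpha> (mat 1) ** \<alpha> (mat 1)"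
    using rep I unfolding representation_def by blast
  hence "\<alpha> (mat 1) ** \<alpha> (mat 1) = \<alpha> (mat 1)" by simp
  moreover have "det (\<alpha> (mat 1)) \<noteq> 0"
    using rep I invertible_det_nz by (auto simp: representation_def)
  note inv2[OF this]
  ultimately show ?thesis by (metis matrix_mul_assoc matrix_mul_lid)
qed

text \<open>The vectors killed by \<open>v \<mapsto> x (\<alpha> \<gamma> v)\<^sub>1 + y (\<alpha> \<gamma> v)\<^sub>2\<close> for all \<open>\<gamma>\<close> form an invariant subspace.\<close>

lemma components_independent:
  assumes "\<And>\<tau>. Im \<tau> > 0 \<Longrightarrow> x * A \<tau> $ 1 + y * A \<tau> $ 2 = 0"
  shows "x = 0 \<and> y = 0"
proof -
  define W where "W = {v :: complex^2. \<forall>\<gamma>\<in>SL2Z. x * (\<alpha> \<gamma> *v v) $ 1 + y * (\<alpha> \<gamma> *v v) $ 2 = 0}"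
  have "vec.subspace W"
    unfolding vec.subspace_def
  proof (intro conjI allI ballI)
    show "0 \<in> W" by (simp add: W_def)
    have lin: "x * (\<alpha> \<gamma> *v (u + v)) $ 1 + y * (\<alpha> \<gamma> *v (u + v)) $ 2 =
        (x * (\<alpha> \<gamma> *v u) $ 1 + y * (\<alpha> \<gamma> *v u) $ 2) + (x * (\<alpha> \<gamma> *v v) $ 1 + y * (\<alpha> \<gamma> *v v) $ 2)"
      "x * (\<alpha> \<gamma> *v (c *s v)) $ 1 + y * (\<alpha> \<gamma> *v (c *s v)) $ 2 =
        c * (x * (\<alpha> \<gamma> *v v) $ 1 + y * (\<alpha> \<gamma> *v v) $ 2)" for u v :: "complex^2" and c \<gamma>
      by (simp_all add: matrix_vector_right_distrib vector_scalar_commute algebra_simps)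
    show "u + v \<in> W" if "u \<in> W" "v \<in> W" for u v
      using that unfolding W_def mem_Collect_eq lin by simp
    show "c *s v \<in> W" if "v \<in> W" for c v
      using that unfolding W_def mem_Collect_eq lin by simp
  qed
  moreover have "\<alpha> \<gamma> *v v \<in> W" if \<gamma>: "\<gamma> \<in> SL2Z" and v: "v \<in> W" for \<gamma> v
    unfolding W_def
  proof (intro CollectI ballI)
    fix \<delta> :: "int^2^2" assume \<delta>: "\<delta> \<in> SL2Z"
    have "\<alpha> \<delta> *v (\<alpha> \<gamma> *v v) = \<alpha> (\<delta> ** \<gamma>) *v v"
      using rep \<gamma> \<delta> by (simp add: representation_def matrix_vector_mul_assoc)
    thus "x * (\<alpha> \<delta> *v (\<alpha> \<gamma> *v v)) $ 1 + y * (\<alpha> \<delta> *v (\<alpha> \<gamma> *v v)) $ 2 = 0"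
      using v SL2Z_mult[OF \<delta> \<gamma>] by (simp add: W_def)
  qed
  ultimately have "W = {0} \<or> W = UNIV"
    using irred unfolding irreducible_rep_def by blast
  moreover obtain \<tau> where \<tau>: "A \<tau> \<noteq> 0" using A_nonzero by (auto simp: fun_eq_iff)
  have pos: "Im \<tau> > 0" using \<tau> modular_formsD(1)[OF A] by (meson not_le)
  \<comment> \<open>The assumed relation at \<open>act \<gamma> \<tau>\<close>, freed of the
    automorphy factor, is the condition that \<gamma> imposes in \<open>W\<close>.\<close>
  have "A \<tau> \<in> W"
    unfolding W_def
  proof (intro CollectI ballI)
    fix \<gamma> :: "int^2^2" assume \<gamma>: "\<gamma> \<in> SL2Z"
    have "x * A (act \<gamma> \<tau>) $ 1 + y * A (act \<gamma> \<tau>) $ 2 = 0"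
      by (rule assms[OF act_Im_pos[OF \<gamma> pos]])
    hence "aut \<gamma> \<tau> powi k * (x * (\<alpha> \<gamma> *v A \<tau>) $ 1 + y * (\<alpha> \<gamma> *v A \<tau>) $ 2) = 0"
      unfolding modular_formsD(3)[OF A \<gamma> pos] by (simp add: algebra_simps)
    thus "x * (\<alpha> \<gamma> *v A \<tau>) $ 1 + y * (\<alpha> \<gamma> *v A \<tau>) $ 2 = 0"
      using aut_nonzero[OF \<gamma> pos] by simp
  qed
  ultimately have "W = UNIV" using \<tau> by auto
  hence v: "x * v $ 1 + y * v $ 2 = 0" for v :: "complex^2"
  proof -
    have "v \<in> W" using \<open>W = UNIV\<close> by simp
    moreover have "mat 1 \<in> SL2Z" by (simp add: SL2Z_def)
    ultimately have "x * (\<alpha> (mat 1) *v v) $ 1 + y * (\<alpha> (mat 1) *v v) $ 2 = 0" by (simp add: W_def)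
    thus ?thesis by (simp add: rep_mat_1)
  qed
  show ?thesis using v[of "vector [1, 0]"] v[of "vector [0, 1]"] by simp
qed

lemma Wronskian_not_identically_zero: "\<exists>\<tau>. Im \<tau> > 0 \<and> det (X \<tau>) \<noteq> 0"
proof (rule ccontr)
  assume "\<not> ?thesis"
  hence 0: "det (X \<tau>) = 0" if "Im \<tau> > 0" for \<tau> using that by blast
  \<comment> \<open>The E_2 part of the second column of \<open>X\<close> is a multiple of the first
    column and drops out of the determinant.\<close>
  have "A \<tau> $ 1 * deriv (\<lambda>\<tau>. A \<tau> $ 2) \<tau> = A \<tau> $ 2 * deriv (\<lambda>\<tau>. A \<tau> $ 1) \<tau>" if "Im \<tau> > 0" for \<tau>
    using 0[OF that] by (simp add: det_2 X_def mod_deriv_nth that serre_deriv_def field_simps)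
  then obtain x y where "x \<noteq> 0 \<or> y \<noteq> 0" "\<And>\<tau>. Im \<tau> > 0 \<Longrightarrow> x * A \<tau> $ 1 + y * A \<tau> $ 2 = 0"
    using Wronskian_zero_imp_dependent[OF modular_formsD(2)[OF A, of 1] modular_formsD(2)[OF A, of 2]] by blast
  thus False using components_independent by blast
qed

definition Xreg :: "complex \<Rightarrow> complex^2^2" where
  "Xreg \<tau> = expm L (- \<tau>) ** X \<tau>"

lemma cusp_regular_Xreg: "cusp_regular (\<lambda>\<tau>. Xreg \<tau> $ i $ j)"
proof -
  have "Xreg \<tau> $ i $ j = (if j = 1 then (expm L (- \<tau>) *v A \<tau>) $ i else (expm L (- \<tau>) *v DA \<tau>) $ i)" for \<tau>
    by (simp add: Xreg_def matrix_mult_nth matrix_vector_mult_nth X_def)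
  thus ?thesis using modular_formsD(4)[OF A, of i] modular_formsD(4)[OF DA, of i]
    by (cases "j = 1") simp_all
qed

text \<open>\<open>det X\<^sup>6\<close> and \<open>\<Delta>\<^bsup>k+1\<^esup>\<close> have the same weight, character and order at the cusp.\<close>

lemma det_Xreg_nonvanishing:
  obtains g where "has_qexp (\<lambda>\<tau>. det (Xreg \<tau>)) g" "\<And>x. norm x < 1 \<Longrightarrow> g x \<noteq> 0"
proof -
  let ?c = "2 * of_real pi * \<i> :: complex"
  define m where "m = k + 1"
  have m: "6 * trace L = of_int m" using weight by (simp add: m_def)
  have detX: "det (Xreg \<tau>) = exp (- (?c * trace L * \<tau>)) * det (X \<tau>)" for \<tau>
    by (simp add: Xreg_def det_mul det_expm)
  have T6: "det (\<alpha> T_mat) ^ 6 = 1"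
  proof -
    have "\<alpha> T_mat = expm L 1" using exponents by (simp add: choice_of_exponents_def expm_def)
    hence "det (\<alpha> T_mat) ^ 6 = exp (of_nat 6 * (?c * trace L))"
      by (simp only: det_expm exp_of_nat_mult mult_1_right)
    also have "of_nat 6 * (?c * trace L) = ?c * of_int m" by (simp flip: m)
    also have "exp \<dots> = 1" using qpar_of_int[of m] by (simp add: qpar_def)
    finally show ?thesis .
  qed
  have S6: "det (\<alpha> S_mat) ^ 6 = 1" by (rule det_rep_S[OF rep T6])
  have "cusp_regular (\<lambda>\<tau>. det (Xreg \<tau>))"
    unfolding det_2 by (intro cusp_regular_diff cusp_regular_mult cusp_regular_Xreg)
  then obtain g where g: "has_qexp (\<lambda>\<tau>. det (Xreg \<tau>)) g" by (auto simp: cusp_regular_def)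
  obtain u where u: "has_qexp Disc (\<lambda>x. x * u x)" "u holomorphic_on ball 0 1" "\<And>x. u x \<noteq> 0" "u 0 = 1"
    by (rule has_qexp_Disc) (rule that; assumption)
  \<comment> \<open>The factor e^(-2 pi i Tr(L) tau) in det \<open>Xreg\<close> has sixth power
    q^(-m), which cancels the zero of the m-th power of the discriminant; this is why the disc
    function of \<open>R\<close> has \<open>u\<close> in place of x u. The integer m has no
    prescribed sign, hence \<open>powi\<close>.\<close>
  define R where "R = (\<lambda>\<tau>. det (X \<tau>) ^ 6 / Disc \<tau> powi m)"
  have R: "has_qexp R (\<lambda>x. g x ^ 6 / u x powi m)"
    unfolding has_qexp_def
  proof (intro conjI allI impI)
    show "(\<lambda>x. g x ^ 6 / u x powi m) holomorphic_on ball 0 1"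
      using g u by (intro holomorphic_intros holomorphic_on_power_int) (auto simp: has_qexp_def)
    fix \<tau> :: complex assume \<tau>: "Im \<tau> > 0"
    have "g (qpar \<tau>) = exp (- (?c * trace L * \<tau>)) * det (X \<tau>)"
      using g \<tau> by (simp add: has_qexp_def detX)
    hence "g (qpar \<tau>) ^ 6 = exp (of_nat 6 * (- (?c * trace L * \<tau>))) * det (X \<tau>) ^ 6"
      by (simp only: power_mult_distrib exp_of_nat_mult)
    also have "of_nat 6 * (- (?c * trace L * \<tau>)) = - (of_int m * (?c * \<tau>))" by (simp flip: m)
    also have "exp \<dots> = 1 / qpar \<tau> powi m"
      by (simp add: qpar_def exp_minus exp_power_int inverse_eq_divide)
    finally have "g (qpar \<tau>) ^ 6 = det (X \<tau>) ^ 6 / qpar \<tau> powi m" by simp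
    moreover have "Disc \<tau> = qpar \<tau> * u (qpar \<tau>)" using u(1) \<tau> by (simp add: has_qexp_def)
    ultimately show "R \<tau> = g (qpar \<tau>) ^ 6 / u (qpar \<tau>) powi m"
      by (simp add: R_def power_int_mult_distrib)
  qed
  have inv: "R (- 1 / \<tau>) = R \<tau>" if \<tau>: "Im \<tau> > 0" for \<tau>
  proof -
    have \<tau>0: "\<tau> \<noteq> 0" using \<tau> by auto
    have "det (X (- 1 / \<tau>)) = det (\<alpha> S_mat) * det (X \<tau>) * (\<tau> powi k * \<tau> powi (k + 2))"
      unfolding X_inversion[OF \<tau>] by (simp add: det_mul diag2_def det_2[of "vector _"])
    also have "\<tau> powi k * \<tau> powi (k + 2) = \<tau> powi (2 * m)"
      using \<tau>0 by (simp add: m_def flip: power_int_add)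
    finally have "det (X (- 1 / \<tau>)) ^ 6 = det (X \<tau>) ^ 6 * (\<tau> powi (2 * m)) ^ 6"
      by (simp add: power_mult_distrib S6)
    also have "(\<tau> powi (2 * m)) ^ 6 = (\<tau> ^ 12) powi m"
      by (simp only: power_int_power power_int_power') simp
    finally show ?thesis using \<tau>0 unfolding R_def Disc_inversion[OF \<tau>]
      by (simp add: power_int_mult_distrib)
  qed
  have const: "R \<tau> = g 0 ^ 6" if "Im \<tau> > 0" for \<tau>
    using weight_0_constant[OF R inv that] u(4) by simp
  \<comment> \<open>A zero at the cusp would make the constant \<open>R\<close> zero, and with it
    the whole Wronskian.\<close>
  have g0: "g 0 \<noteq> 0"
  proof
    assume "g 0 = 0"
    hence "det (X \<tau>) = 0" if "Im \<tau> > 0" for \<tau> using const[OF that] by (simp add: R_def)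
    thus False using Wronskian_not_identically_zero by blast
  qed
  have "g x \<noteq> 0" if x: "norm x < 1" for x
  proof (cases "x = 0")
    case False
    from False x obtain \<tau> where \<tau>: "Im \<tau> > 0" "qpar \<tau> = x" by (rule qpar_surj)
    have "det (X \<tau>) \<noteq> 0" using const[OF \<tau>(1)] g0 by (auto simp: R_def)
    moreover have "g x = det (Xreg \<tau>)" using g \<tau> by (auto simp: has_qexp_def)
    ultimately show ?thesis by (simp add: detX)
  qed (use g0 in simp)
  thus ?thesis using that g by blast
qed

lemma det_X_nonzero:
  assumes "Im \<tau> > 0"
  shows "det (Xreg \<tau>) \<noteq> 0" "det (X \<tau>) \<noteq> 0"
proof -
  obtain g where "has_qexp (\<lambda>\<tau>. det (Xreg \<tau>)) g" "\<And>x. norm x < 1 \<Longrightarrow> g x \<noteq> 0"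
    by (rule det_Xreg_nonvanishing) (rule that; assumption)
  thus "det (Xreg \<tau>) \<noteq> 0" using assms by (simp add: has_qexp_def norm_qpar_less_1)
  thus "det (X \<tau>) \<noteq> 0" by (auto simp: Xreg_def det_mul)
qed

definition Z :: "complex \<Rightarrow> complex^2^2" where "Z \<tau> = inv2 (X \<tau>)"

lemma XZ: "Im \<tau> > 0 \<Longrightarrow> X \<tau> ** Z \<tau> = mat 1" "Im \<tau> > 0 \<Longrightarrow> Z \<tau> ** X \<tau> = mat 1"
  unfolding Z_def by (rule inv2[OF det_X_nonzero(2)]; assumption)+

lemma Z_inversion:
  assumes \<tau>: "Im \<tau> > 0"
  shows "Z (- 1 / \<tau>) ** \<alpha> S_mat = diag2 (\<tau> powi (- k)) (\<tau> powi (- (k + 2))) ** Z \<tau>"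
proof -
  have \<tau>0: "\<tau> \<noteq> 0" using \<tau> by auto
  let ?D = "diag2 (\<tau> powi k) (\<tau> powi (k + 2))" and ?D' = "diag2 (\<tau> powi (- k)) (\<tau> powi (- (k + 2)))"
  have D: "?D ** ?D' = mat 1"
    using \<tau>0 by (simp add: vec_eq_iff forall_2 diag2_mult_nth) (simp add: diag2_def mat_def flip: power_int_add)
  have "X (- 1 / \<tau>) ** (?D' ** Z \<tau>) = \<alpha> S_mat ** (X \<tau> ** ((?D ** ?D') ** Z \<tau>))"
    unfolding X_inversion[OF \<tau>] by (simp only: matrix_mul_assoc)
  also have "\<dots> = \<alpha> S_mat" by (simp only: D XZ[OF \<tau>] matrix_mul_lid matrix_mul_rid)
  finally have "Z (- 1 / \<tau>) ** \<alpha> S_mat = (Z (- 1 / \<tau>) ** X (- 1 / \<tau>)) ** (?D' ** Z \<tau>)"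
    by (simp only: matrix_mul_assoc[symmetric])
  thus ?thesis by (simp only: XZ(2)[OF Im_minus_inverse_pos[OF \<tau>]] matrix_mul_lid)
qed

text \<open>The matrix in question is the inverse of \<open>Xreg\<close>, whose entries are regular
  at the cusp and whose determinant has no zero in the disc, q = 0 included.\<close>

lemma cusp_regular_Z: "cusp_regular (\<lambda>\<tau>. (Z \<tau> ** expm L \<tau>) $ i $ j)"
proof (rule cusp_regular_cong)
  obtain g where g: "has_qexp (\<lambda>\<tau>. det (Xreg \<tau>)) g" "\<And>x. norm x < 1 \<Longrightarrow> g x \<noteq> 0"
    by (rule det_Xreg_nonvanishing) (rule that; assumption)
  have quot: "cusp_regular (\<lambda>\<tau>. f \<tau> / det (Xreg \<tau>))" if "cusp_regular f" for f
    using that has_qexp_divide[OF _ g] unfolding cusp_regular_def by blast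
  have neg: "cusp_regular (\<lambda>\<tau>. - f \<tau>)" if "cusp_regular f" for f
    using cusp_regular_mult[OF cusp_regular_const[of "-1"] that] by simp
  show "cusp_regular (\<lambda>\<tau>. inv2 (Xreg \<tau>) $ i $ j)"
    using exhaust_2[of i] exhaust_2[of j]
    by (elim disjE) (simp_all add: inv2_def quot neg cusp_regular_Xreg del: minus_divide_left)
  fix \<tau> :: complex assume \<tau>: "Im \<tau> > 0"
  have "(Z \<tau> ** expm L \<tau>) ** Xreg \<tau> = Z \<tau> ** ((expm L \<tau> ** expm L (- \<tau>)) ** X \<tau>)"
    unfolding Xreg_def by (simp only: matrix_mul_assoc)
  also have "\<dots> = mat 1" by (simp add: expm_minus XZ[OF \<tau>])
  finally have "Z \<tau> ** expm L \<tau> = inv2 (Xreg \<tau>)"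
    by (rule inverse_unique) (rule det_X_nonzero(1)[OF \<tau>])
  thus "inv2 (Xreg \<tau>) $ i $ j = (Z \<tau> ** expm L \<tau>) $ i $ j" by simp
qed

lemma coordinates_rank_2:
  assumes "G \<in> modular_forms \<alpha> L l"
  shows "level1 (l - (if i = 1 then k else k + 2)) (\<lambda>\<tau>. (Z \<tau> *v G \<tau>) $ i)"
  by (rule coordinates_level1[where w = "\<lambda>i. if i = 1 then k else k + 2", OF assms _ cusp_regular_Z])
     (simp only: Z_inversion diag2_mult_nth split: if_splits, simp)

text \<open>Sym3 of the diagonal matrix with entries \<tau>^(-k), \<tau>^(-k-2) is diagonal with
  exponents -3k, -3k-2, -3k-4, -3k-6. At the cusp the exponential of S^3 L is absorbed as Sym3 (Z
  e^(2 pi i L tau)), whose entries are polynomials in regular functions.\<close>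

lemma coordinates_Sym3:
  assumes "G \<in> modular_forms (\<lambda>\<gamma>. Sym3 (\<alpha> \<gamma>)) (Sym3_exponents L) l"
  shows "level1 (l - 3 * k - (if i = 1 then 0 else if i = 2 then 2 else if i = 3 then 4 else 6))
           (\<lambda>\<tau>. (Sym3 (Z \<tau>) *v G \<tau>) $ i)"
proof -
  let ?w = "\<lambda>i :: 4. 3 * k + (if i = 1 then 0 else if i = 2 then 2 else if i = 3 then 4 else 6)"
  have "level1 (l - ?w i) (\<lambda>\<tau>. (Sym3 (Z \<tau>) *v G \<tau>) $ i)"
  proof (rule coordinates_level1[where w = ?w, OF assms])
    fix \<tau> :: complex and i j :: 4 assume \<tau>: "Im \<tau> > 0"
    have \<tau>0: "\<tau> \<noteq> 0" using \<tau> by auto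
    have "Sym3 (Z (- 1 / \<tau>)) ** Sym3 (\<alpha> S_mat) =
          Sym3 (diag2 (\<tau> powi (- k)) (\<tau> powi (- (k + 2)))) ** Sym3 (Z \<tau>)"
      by (simp only: Sym3_mult[symmetric] Z_inversion[OF \<tau>])
    moreover have "(\<tau> powi (- k)) ^ 3 = \<tau> powi (- (3 * k))"
      "(\<tau> powi (- k)) ^ 2 * \<tau> powi (- (k + 2)) = \<tau> powi (- (3 * k + 2))"
      "\<tau> powi (- k) * (\<tau> powi (- (k + 2))) ^ 2 = \<tau> powi (- (3 * k + 4))"
      "(\<tau> powi (- (k + 2))) ^ 3 = \<tau> powi (- (3 * k + 6))"
      using \<tau>0 by (simp_all only: power2_eq_square power3_eq_cube not_False_eq_True simp_thms flip: power_int_add)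
        (rule arg_cong[where f = "\<lambda>e. \<tau> powi e"], simp)+
    ultimately show "(Sym3 (Z (- 1 / \<tau>)) ** Sym3 (\<alpha> S_mat)) $ i $ j = \<tau> powi (- ?w i) * Sym3 (Z \<tau>) $ i $ j"
      using exhaust_4[of i] by (elim disjE) (simp_all only: Sym3_diag2_mult_nth if_True if_False refl, simp_all)
  next
    show "cusp_regular (\<lambda>\<tau>. (Sym3 (Z \<tau>) ** expm (Sym3_exponents L) \<tau>) $ i $ j)" for i j
      unfolding Sym3_expm[symmetric] Sym3_mult[symmetric]
      by (rule Sym3_entry_closed[where Q = cusp_regular])
         (rule cusp_regular_const cusp_regular_add cusp_regular_mult cusp_regular_Z; assumption?)+
  qed
  thus ?thesis by (simp add: algebra_simps)
qed

end

subsection \<open>The symmetric cube as a free module\<close>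

lemma mod_deriv_zero: "mod_deriv k (\<lambda>\<tau>. 0) = (\<lambda>\<tau>. 0)"
  by (auto simp: fun_eq_iff vec_eq_iff mod_deriv_def)

section \<open>Differentiation rules for the Serre derivative\<close>

lemma serre_deriv_cong:
  assumes "\<And>z. Im z > 0 \<Longrightarrow> f z = g z" "Im \<tau> > 0"
  shows "serre_deriv k f \<tau> = serre_deriv k g \<tau>"
proof -
  have "eventually (\<lambda>z. f z = g z) (nhds \<tau>)"
    using eventually_upper_half_plane[OF assms(2)] by eventually_elim (rule assms(1))
  hence "deriv f \<tau> = deriv g \<tau>" by (rule deriv_cong_ev) simp
  thus ?thesis using assms by (simp add: serre_deriv_def)
qed

text \<open>A relational form with differentiability built in, so that the Leibniz rule, with
  weights adding up, can be chained like \<open>has_field_derivative\<close> rules.\<close>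

definition has_serre_deriv :: "(complex \<Rightarrow> complex) \<Rightarrow> int \<Rightarrow> complex \<Rightarrow> complex \<Rightarrow> bool" where
  "has_serre_deriv f k P \<tau> \<longleftrightarrow>
     (f has_field_derivative 2 * of_real pi * \<i> * (P + of_int k / 12 * E2 \<tau> * f \<tau>)) (at \<tau>)"

lemma has_serre_deriv_serre_deriv:
  assumes "f holomorphic_on {\<tau>. Im \<tau> > 0}" "Im \<tau> > 0"
  shows "has_serre_deriv f k (serre_deriv k f \<tau>) \<tau>"
  using holomorphic_derivI[OF assms(1) open_upper_half_plane] assms(2)
  by (simp add: has_serre_deriv_def serre_deriv_def)

lemma has_serre_deriv_imp: "has_serre_deriv f k P \<tau> \<Longrightarrow> serre_deriv k f \<tau> = P"
  by (simp add: has_serre_deriv_def serre_deriv_def DERIV_imp_deriv)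

lemma has_serre_deriv_eqI: "has_serre_deriv f k P \<tau> \<Longrightarrow> P = Q \<Longrightarrow> has_serre_deriv f k Q \<tau>"
  by simp

lemma has_serre_deriv_add:
  "has_serre_deriv f k P \<tau> \<Longrightarrow> has_serre_deriv g k Q \<tau> \<Longrightarrow>
     has_serre_deriv (\<lambda>z. f z + g z) k (P + Q) \<tau>"
  unfolding has_serre_deriv_def by (rule DERIV_cong[OF DERIV_add]) (auto simp: field_simps)

lemma has_serre_deriv_cmult:
  "has_serre_deriv f k P \<tau> \<Longrightarrow> has_serre_deriv (\<lambda>z. c * f z) k (c * P) \<tau>"
  unfolding has_serre_deriv_def by (rule DERIV_cong[OF DERIV_cmult]) (auto simp: field_simps)

lemma has_serre_deriv_mult:
  assumes "has_serre_deriv f k P \<tau>" "has_serre_deriv g l Q \<tau>" "m = k + l"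
  shows "has_serre_deriv (\<lambda>z. f z * g z) m (P * g \<tau> + f \<tau> * Q) \<tau>"
  unfolding has_serre_deriv_def assms(3)
  by (rule DERIV_cong[OF DERIV_mult[OF assms(1,2)[unfolded has_serre_deriv_def]]])
     (simp add: field_simps)

lemma level1_weight_4:
  assumes "level1 4 f"
  obtains c where "\<And>\<tau>. Im \<tau> > 0 \<Longrightarrow> f \<tau> = c * E4 \<tau>"
proof -
  obtain c where c: "\<And>\<tau>. Im \<tau> > 0 \<Longrightarrow>
      f \<tau> = (\<Sum>(a, b) | 4 * int a + 6 * int b = 4. c (a, b) * E4 \<tau> ^ a * E6 \<tau> ^ b)"
    using level1_imp_E46_span[OF assms] unfolding E46_span_def by blast
  have "{(a, b). 4 * int a + 6 * int b = 4} = {(1, 0)}" by (auto; presburger)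
  thus ?thesis using c that[of "c (1, 0)"] by simp
qed

section \<open>Graded modules and differential operators\<close>

lemma homogeneous_in_graded_sum:
  assumes "F \<in> V k" "\<And>j. (\<lambda>\<tau>. 0) \<in> V j"
  shows "homogeneous k F \<in> graded_sum V"
proof -
  have "{j. homogeneous k F j \<noteq> (\<lambda>\<tau>. 0)} \<subseteq> {k}" by (auto simp: homogeneous_def)
  hence "finite {j. homogeneous k F j \<noteq> (\<lambda>\<tau>. 0)}" by (rule finite_subset) simp
  thus ?thesis using assms by (simp add: graded_sum_def homogeneous_def)
qed

lemma M1_scale_homogeneous:
  assumes "\<phi> \<in> M1"
  shows "M1_scale \<phi> (homogeneous j F) l \<tau> = \<phi> (l - j) \<tau> *s F \<tau>"
proof -
  have fin: "finite {i. \<phi> i \<noteq> (\<lambda>\<tau>. 0)}" using assms by (simp add: M1_def graded_sum_def)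
  have "M1_scale \<phi> (homogeneous j F) l \<tau> =
      (\<Sum>i | \<phi> i \<noteq> (\<lambda>\<tau>. 0). if l - j = i then \<phi> (l - j) \<tau> *s F \<tau> else 0)"
    unfolding M1_scale_def homogeneous_def by (intro sum.cong) auto
  also have "\<dots> = (if l - j \<in> {i. \<phi> i \<noteq> (\<lambda>\<tau>. 0)} then \<phi> (l - j) \<tau> *s F \<tau> else 0)"
    by (rule sum.delta'[OF fin])
  also have "\<dots> = \<phi> (l - j) \<tau> *s F \<tau>" by auto
  finally show ?thesis .
qed

lemma diff_ops_preserve_M_module:
  assumes "P \<in> diff_ops" "G \<in> M_module \<rho> L"
  shows "P G \<in> M_module \<rho> L"
  using assms
proof (induction arbitrary: G rule: diff_ops.induct)
  case (scale \<phi>)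
  define I J where "I = {i. \<phi> i \<noteq> (\<lambda>\<tau>. 0)}" and "J = {j. G j \<noteq> (\<lambda>\<tau>. 0)}"
  have \<phi>: "\<phi> i \<in> M1_weight i" "finite I" for i
    using scale.hyps by (auto simp: M1_def graded_sum_def I_def)
  have G: "G j \<in> modular_forms \<rho> L j" "finite J" for j
    using scale.prems by (auto simp: M_module_def graded_sum_def J_def)
  have "M1_scale \<phi> G l \<in> modular_forms \<rho> L l" for l
  proof -
    have "(\<lambda>\<tau>. \<phi> i \<tau> *s G (l - i) \<tau>) \<in> modular_forms \<rho> L l" for i
      using modular_forms_scale[OF \<phi>(1)[of i] G(1)[of "l - i"]] by simp
    thus ?thesis unfolding M1_scale_def by (rule modular_forms_sum)
  qed
  moreover have "{l. M1_scale \<phi> G l \<noteq> (\<lambda>\<tau>. 0)} \<subseteq> (\<lambda>(i, j). i + j) ` (I \<times> J)"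
  proof
    fix l assume "l \<in> {l. M1_scale \<phi> G l \<noteq> (\<lambda>\<tau>. 0)}"
    then obtain \<tau> where "M1_scale \<phi> G l \<tau> \<noteq> 0" by auto
    then obtain i where i: "i \<in> I" "\<phi> i \<tau> *s G (l - i) \<tau> \<noteq> 0"
      unfolding M1_scale_def I_def by (meson sum.not_neutral_contains_not_neutral)
    hence "G (l - i) \<tau> \<noteq> 0" by auto
    hence "l - i \<in> J" by (auto simp: J_def)
    thus "l \<in> (\<lambda>(i, j). i + j) ` (I \<times> J)" using i(1) by (intro image_eqI[of _ _ "(i, l - i)"]) auto
  qed
  hence "finite {l. M1_scale \<phi> G l \<noteq> (\<lambda>\<tau>. 0)}"
    by (rule finite_subset) (intro finite_imageI finite_cartesian_product \<phi> G)
  ultimately show ?case by (simp add: M_module_def graded_sum_def)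
next
  case deriv
  have G: "G j \<in> modular_forms \<rho> L j" for j using deriv by (simp add: M_module_def graded_sum_def)
  have "graded_deriv G l \<in> modular_forms \<rho> L l" for l
    using mod_deriv_modular_forms[OF G[of "l - 2"]] by (simp add: graded_deriv_def)
  moreover have "{l. graded_deriv G l \<noteq> (\<lambda>\<tau>. 0)} \<subseteq> (\<lambda>j. j + 2) ` {j. G j \<noteq> (\<lambda>\<tau>. 0)}"
  proof
    fix l assume "l \<in> {l. graded_deriv G l \<noteq> (\<lambda>\<tau>. 0)}"
    hence "G (l - 2) \<noteq> (\<lambda>\<tau>. 0)" by (auto simp: graded_deriv_def mod_deriv_zero)
    thus "l \<in> (\<lambda>j. j + 2) ` {j. G j \<noteq> (\<lambda>\<tau>. 0)}" by (intro image_eqI[of _ _ "l - 2"]) auto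
  qed
  hence "finite {l. graded_deriv G l \<noteq> (\<lambda>\<tau>. 0)}"
    by (rule finite_subset) (use deriv in \<open>simp add: M_module_def graded_sum_def\<close>)
  ultimately show ?case by (simp add: M_module_def graded_sum_def)
next
  case (add P Q)
  have PQ: "P G \<in> M_module \<rho> L" "Q G \<in> M_module \<rho> L" using add by auto
  have "{k. (\<lambda>\<tau>. P G k \<tau> + Q G k \<tau>) \<noteq> (\<lambda>\<tau>. 0)} \<subseteq>
      {k. P G k \<noteq> (\<lambda>\<tau>. 0)} \<union> {k. Q G k \<noteq> (\<lambda>\<tau>. 0)}" by (auto simp: fun_eq_iff)
  hence "finite {k. (\<lambda>\<tau>. P G k \<tau> + Q G k \<tau>) \<noteq> (\<lambda>\<tau>. 0)}"
    by (rule finite_subset) (use PQ in \<open>auto simp: M_module_def graded_sum_def\<close>)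
  thus ?case using PQ by (auto simp: M_module_def graded_sum_def intro: modular_forms_add)
next
  case (comp P Q)
  thus ?case by simp
qed

lemma diff_ops_scale_funpow:
  assumes "\<phi> \<in> M1"
  shows "(\<lambda>F :: int \<Rightarrow> complex \<Rightarrow> complex^'d. M1_scale \<phi> ((graded_deriv ^^ i) F)) \<in> diff_ops"
proof (induction i)
  case 0
  show ?case using diff_ops.scale[OF assms] by simp
next
  case (Suc i)
  have "(\<lambda>F :: int \<Rightarrow> complex \<Rightarrow> complex^'d. M1_scale \<phi> ((graded_deriv ^^ i) F)) \<circ> graded_deriv \<in> diff_ops"
    by (intro diff_ops.comp Suc diff_ops.deriv)
  thus ?case by (simp add: o_def funpow_Suc_right del: funpow.simps)
qed

lemma M1_zero: "(\<lambda>k \<tau>. 0) \<in> M1"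
  by (simp add: M1_def graded_sum_def M1_weight_iff level1_zero)

lemma diff_ops_sum:
  fixes P :: "nat \<Rightarrow> (int \<Rightarrow> complex \<Rightarrow> complex^'d) \<Rightarrow> int \<Rightarrow> complex \<Rightarrow> complex^'d"
  assumes "\<And>i. i < n \<Longrightarrow> P i \<in> diff_ops"
  shows "(\<lambda>F k \<tau>. \<Sum>i<n. P i F k \<tau>) \<in> diff_ops"
  using assms
proof (induction n)
  case 0
  have "M1_scale (\<lambda>k \<tau>. 0) = (\<lambda>F k \<tau>. (0 :: complex^'d))" by (simp add: M1_scale_def fun_eq_iff)
  moreover have "M1_scale (\<lambda>k \<tau>. 0) \<in> (diff_ops :: ((int \<Rightarrow> complex \<Rightarrow> complex^'d) \<Rightarrow> _) set)"
    by (rule diff_ops.scale[OF M1_zero])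
  ultimately show ?case by simp
next
  case (Suc n)
  have "(\<lambda>F k \<tau>. (\<Sum>i<n. P i F k \<tau>) + P n F k \<tau>) \<in> diff_ops"
    by (rule diff_ops.add) (auto intro!: Suc)
  thus ?case by simp
qed

section \<open>The derivatives of the cube as a basis\<close>

context minimal_form
begin

lemma X_mult_nth: "(X \<tau> *v v) $ i = A \<tau> $ i * v $ 1 + DA \<tau> $ i * v $ 2"
  by (simp add: matrix_vector_mult_nth sum_2 X_def)

text \<open>The coordinates of D^2 A with respect to A and D A are level one forms of weights 4 and
  2: a multiple of E_4, and 0.\<close>

lemma second_order_equation:
  obtains c where "\<And>\<tau>. Im \<tau> > 0 \<Longrightarrow> mod_deriv (k + 2) DA \<tau> = (c * E4 \<tau>) *s A \<tau>"
proof -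
  let ?G = "mod_deriv (k + 2) DA"
  have G: "?G \<in> modular_forms \<alpha> L (k + 4)"
  proof -
    have "k + 2 + 2 = k + 4" by simp
    thus ?thesis using mod_deriv_modular_forms[OF DA] by (simp only:)
  qed
  have "level1 4 (\<lambda>\<tau>. (Z \<tau> *v ?G \<tau>) $ 1)" using coordinates_rank_2[OF G, of 1] by simp
  then obtain c where c: "\<And>\<tau>. Im \<tau> > 0 \<Longrightarrow> (Z \<tau> *v ?G \<tau>) $ 1 = c * E4 \<tau>"
    by (rule level1_weight_4) blast
  have l2: "level1 2 (\<lambda>\<tau>. (Z \<tau> *v ?G \<tau>) $ 2)" using coordinates_rank_2[OF G, of 2] by simp
  have "?G \<tau> = (c * E4 \<tau>) *s A \<tau>" if \<tau>: "Im \<tau> > 0" for \<tau>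
  proof -
    have "?G \<tau> = X \<tau> *v (Z \<tau> *v ?G \<tau>)"
      by (simp add: matrix_vector_mul_assoc XZ[OF \<tau>])
    also have "\<dots> = (c * E4 \<tau>) *s A \<tau>"
      unfolding vec_eq_iff X_mult_nth by (simp add: c[OF \<tau>] level1_weight_2[OF l2 \<tau>])
    finally show ?thesis .
  qed
  thus ?thesis by (rule that)
qed

abbreviation "Sym3_rep \<equiv> (\<lambda>\<gamma>. Sym3 (\<alpha> \<gamma>))"

primrec frame :: "nat \<Rightarrow> complex \<Rightarrow> complex^4" where
  "frame 0 = (\<lambda>\<tau>. cubic_monomials (A \<tau>))"
| "frame (Suc i) = mod_deriv (3 * k + 2 * int i) (frame i)"

lemma frame_modular_forms: "frame i \<in> modular_forms Sym3_rep (Sym3_exponents L) (3 * k + 2 * int i)"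
proof (induction i)
  case 0
  show ?case using cubic_modular_forms[OF A] by simp
next
  case (Suc i)
  show ?case using mod_deriv_modular_forms[OF Suc] by (simp add: add.assoc add.commute[of 2])
qed

lemma graded_deriv_funpow_frame:
  "(graded_deriv ^^ i) (homogeneous (3 * k) (\<lambda>\<tau>. cubic_monomials (A \<tau>))) =
     homogeneous (3 * k + 2 * int i) (frame i)"
proof (induction i)
  case (Suc i)
  have "(graded_deriv ^^ Suc i) (homogeneous (3 * k) (\<lambda>\<tau>. cubic_monomials (A \<tau>))) =
      graded_deriv (homogeneous (3 * k + 2 * int i) (frame i))" by (simp add: Suc)
  also have "\<dots> = homogeneous (3 * k + 2 * int (Suc i)) (frame (Suc i))"
    by (auto simp: graded_deriv_def homogeneous_def fun_eq_iff mod_deriv_zero)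
  finally show ?case .
qed simp

text \<open>The columns of \<open>Sym3 (X \<tau>)\<close> are the coefficients of \<open>(s A + t DA)\<^sup>3\<close>; since \<open>D\<^sup>2 A = c E\<^sub>4 A\<close>, the
  derivatives of \<open>A\<^sup>3\<close> are unitriangular combinations of them up to nonzero constants.\<close>

lemma frame_combination:
  obtains c where "\<And>\<tau> \<phi>. Im \<tau> > 0 \<Longrightarrow>
    (\<Sum>i<4. \<phi> i *s frame i \<tau>) = Sym3 (X \<tau>) *v vector
      [\<phi> 0 + 3 * c * E4 \<tau> * \<phi> 2 + 3 * c * serre_deriv 4 E4 \<tau> * \<phi> 3,
       \<phi> 1 + 7 * c * E4 \<tau> * \<phi> 3, 2 * \<phi> 2, 6 * \<phi> 3]"
proof -
  obtain c where c: "\<And>\<tau>. Im \<tau> > 0 \<Longrightarrow> mod_deriv (k + 2) DA \<tau> = (c * E4 \<tau>) *s A \<tau>"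
    by (rule second_order_equation) blast
  let ?C = "\<lambda>i j z. Sym3 (X z) $ i $ j"
  let ?e = "\<lambda>\<tau>. serre_deriv 4 E4 \<tau>"
  have sA: "has_serre_deriv (\<lambda>z. A z $ i) k (DA \<tau> $ i) \<tau>" if "Im \<tau> > 0" for i \<tau>
    using has_serre_deriv_serre_deriv[OF modular_formsD(2)[OF A] that] by (simp add: mod_deriv_nth[OF that])
  have sDA: "has_serre_deriv (\<lambda>z. DA z $ i) (k + 2) (c * E4 \<tau> * A \<tau> $ i) \<tau>" if "Im \<tau> > 0" for i \<tau>
    using has_serre_deriv_serre_deriv[OF modular_formsD(2)[OF DA] that, where k = "k + 2"] c[OF that]
    by (simp add: mod_deriv_nth[OF that, symmetric])
  have sE4: "has_serre_deriv E4 4 (?e \<tau>) \<tau>" if "Im \<tau> > 0" for \<tau>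
  proof -
    obtain g where "has_qexp E4 g" using level1_E4 by (auto simp: level1_def)
    thus ?thesis using has_serre_deriv_serre_deriv has_qexp_imp_holomorphic that by blast
  qed
  have sX: "has_serre_deriv (\<lambda>z. X z $ i $ 1) k (X \<tau> $ i $ 2) \<tau>"
    "has_serre_deriv (\<lambda>z. X z $ i $ 2) (k + 2) (c * E4 \<tau> * X \<tau> $ i $ 1) \<tau>" if "Im \<tau> > 0" for i \<tau>
    using sA[OF that, of i] sDA[OF that, of i] by (simp_all add: X_def)
  note rules = has_serre_deriv_cmult has_serre_deriv_add has_serre_deriv_mult
  note expand = Sym3_rows vector_4_nth power2_eq_square power3_eq_cube mult.assoc
  \<comment> \<open>In each row the columns are like a^3, 3 a^2 b, 3 a b^2, b^3 with D a = b and D b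
    = c E_4 a. The Leibniz rule gives D C_1 = C_2, D C_2 = 2 C_3 + 3 c E_4 C_1 and D C_3 = 3 C_4 + 2
    c E_4 C_2.\<close>
  have "\<forall>i. has_serre_deriv (?C i 1) (3 * k) (?C i 2 \<tau>) \<tau>" if \<tau>: "Im \<tau> > 0" for \<tau>
    unfolding forall_4
    by (intro conjI; (simp only: expand, rule has_serre_deriv_eqI,
        (rule sX[OF \<tau>] rules refl | (simp add: algebra_simps; fail))+))
  hence C1: "has_serre_deriv (?C i 1) (3 * k) (?C i 2 \<tau>) \<tau>" if "Im \<tau> > 0" for i \<tau>
    using that by blast
  have "\<forall>i. has_serre_deriv (?C i 2) (3 * k + 2) (2 * ?C i 3 \<tau> + 3 * c * E4 \<tau> * ?C i 1 \<tau>) \<tau>" if \<tau>: "Im \<tau> > 0" for \<tau>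
    unfolding forall_4
    by (intro conjI; (simp only: expand, rule has_serre_deriv_eqI,
        (rule sX[OF \<tau>] rules refl | (simp add: algebra_simps; fail))+))
  hence C2: "has_serre_deriv (?C i 2) (3 * k + 2) (2 * ?C i 3 \<tau> + 3 * c * E4 \<tau> * ?C i 1 \<tau>) \<tau>" if "Im \<tau> > 0" for i \<tau>
    using that by blast
  have "\<forall>i. has_serre_deriv (?C i 3) (3 * k + 4) (3 * ?C i 4 \<tau> + 2 * c * E4 \<tau> * ?C i 2 \<tau>) \<tau>" if \<tau>: "Im \<tau> > 0" for \<tau>
    unfolding forall_4
    by (intro conjI; (simp only: expand, rule has_serre_deriv_eqI,
        (rule sX[OF \<tau>] rules refl | (simp add: algebra_simps; fail))+))
  hence C3: "has_serre_deriv (?C i 3) (3 * k + 4) (3 * ?C i 4 \<tau> + 2 * c * E4 \<tau> * ?C i 2 \<tau>) \<tau>" if "Im \<tau> > 0" for i \<tau>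
    using that by blast
  have F0: "frame 0 \<tau> $ i = ?C i 1 \<tau>" for \<tau> i
    using exhaust_4[of i] by (elim disjE) (simp_all add: Sym3_rows X_def)
  have F1: "frame 1 \<tau> $ i = ?C i 2 \<tau>" if \<tau>: "Im \<tau> > 0" for \<tau> i
    using has_serre_deriv_imp[OF C1[OF \<tau>]] mod_deriv_nth[OF \<tau>, of "3 * k" "frame 0" i] F0 by simp
  have F2: "frame 2 \<tau> $ i = 2 * ?C i 3 \<tau> + 3 * c * E4 \<tau> * ?C i 1 \<tau>" if \<tau>: "Im \<tau> > 0" for \<tau> i
  proof -
    have "frame 2 \<tau> $ i = serre_deriv (3 * k + 2) (\<lambda>z. frame 1 z $ i) \<tau>"
      by (simp add: numeral_2_eq_2 mod_deriv_nth[OF \<tau>])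
    also have "\<dots> = serre_deriv (3 * k + 2) (?C i 2) \<tau>" by (rule serre_deriv_cong[OF F1 \<tau>])
    also have "\<dots> = 2 * ?C i 3 \<tau> + 3 * c * E4 \<tau> * ?C i 1 \<tau>"
      by (rule has_serre_deriv_imp[OF C2[OF \<tau>]])
    finally show ?thesis .
  qed
  \<comment> \<open>6 = 2 * 3, and 7 = 2 * 2 + 3: the E_4 part of twice D C_3, plus 3 c E_4 times D
    C_1 = C_2.\<close>
  have F3: "frame 3 \<tau> $ i = 6 * ?C i 4 \<tau> + 7 * c * E4 \<tau> * ?C i 2 \<tau> + 3 * c * ?e \<tau> * ?C i 1 \<tau>"
    if \<tau>: "Im \<tau> > 0" for \<tau> i
  proof -
    have "frame 3 \<tau> $ i = serre_deriv (3 * k + 4) (\<lambda>z. frame 2 z $ i) \<tau>"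
      by (simp add: numeral_2_eq_2 numeral_3_eq_3 mod_deriv_nth[OF \<tau>])
    also have "\<dots> = serre_deriv (3 * k + 4) (\<lambda>z. 2 * ?C i 3 z + 3 * c * (E4 z * ?C i 1 z)) \<tau>"
      by (rule serre_deriv_cong[OF _ \<tau>]) (simp add: F2)
    also have "\<dots> = 2 * (3 * ?C i 4 \<tau> + 2 * c * E4 \<tau> * ?C i 2 \<tau>) +
        3 * c * (?e \<tau> * ?C i 1 \<tau> + E4 \<tau> * ?C i 2 \<tau>)"
      by (intro has_serre_deriv_imp has_serre_deriv_add has_serre_deriv_cmult C3[OF \<tau>]
          has_serre_deriv_mult[OF sE4[OF \<tau>] C1[OF \<tau>]]) simp
    also have "\<dots> = 6 * ?C i 4 \<tau> + 7 * c * E4 \<tau> * ?C i 2 \<tau> + 3 * c * ?e \<tau> * ?C i 1 \<tau>"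
      by (simp add: algebra_simps)
    finally show ?thesis .
  qed
  have sum4: "(\<Sum>i<4. f i) = f 0 + f 1 + f 2 + f (3::nat)" for f :: "nat \<Rightarrow> complex"
    by (simp add: eval_nat_numeral)
  show ?thesis
  proof (rule that)
    fix \<tau> :: complex and \<phi> :: "nat \<Rightarrow> complex" assume \<tau>: "Im \<tau> > 0"
    show "(\<Sum>i<4. \<phi> i *s frame i \<tau>) = Sym3 (X \<tau>) *v vector
      [\<phi> 0 + 3 * c * E4 \<tau> * \<phi> 2 + 3 * c * serre_deriv 4 E4 \<tau> * \<phi> 3,
       \<phi> 1 + 7 * c * E4 \<tau> * \<phi> 3, 2 * \<phi> 2, 6 * \<phi> 3]"
      unfolding vec_eq_iff sum_component vector_smult_component sum4 matrix_vector_mult_nth sum_4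
        vector_4_nth F0 F1[OF \<tau>] F2[OF \<tau>] F3[OF \<tau>]
      by (simp add: algebra_simps)
  qed
qed

lemma Sym3_XZ:
  assumes "Im \<tau> > 0"
  shows "Sym3 (X \<tau>) *v (Sym3 (Z \<tau>) *v v) = v" "Sym3 (Z \<tau>) *v (Sym3 (X \<tau>) *v v) = v"
  by (simp_all add: matrix_vector_mul_assoc XZ[OF assms] Sym3_1 flip: Sym3_mult)

text \<open>Sym3 (X \<tau>) is invertible and the triangular coefficients have diagonal 1, 1, 2, 6.
  Independence holds at each single point and for arbitrary scalars, so it can be used in every
  weight separately.\<close>

lemma frame_independent:
  assumes \<tau>: "Im \<tau> > 0" and 0: "(\<Sum>i<4. \<phi> i *s frame i \<tau>) = 0" and i: "i < 4"
  shows "\<phi> i = 0"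
proof -
  obtain c where c: "\<And>\<tau> \<phi>. Im \<tau> > 0 \<Longrightarrow>
    (\<Sum>i<4. \<phi> i *s frame i \<tau>) = Sym3 (X \<tau>) *v vector
      [\<phi> 0 + 3 * c * E4 \<tau> * \<phi> 2 + 3 * c * serre_deriv 4 E4 \<tau> * \<phi> 3,
       \<phi> 1 + 7 * c * E4 \<tau> * \<phi> 3, 2 * \<phi> 2, 6 * \<phi> 3]"
    by (rule frame_combination) blast
  define v :: "complex^4" where "v = vector
      [\<phi> 0 + 3 * c * E4 \<tau> * \<phi> 2 + 3 * c * serre_deriv 4 E4 \<tau> * \<phi> 3,
       \<phi> 1 + 7 * c * E4 \<tau> * \<phi> 3, 2 * \<phi> 2, 6 * \<phi> 3]"
  have "v = Sym3 (Z \<tau>) *v (\<Sum>i<4. \<phi> i *s frame i \<tau>)"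
    unfolding c[OF \<tau>] v_def[symmetric] Sym3_XZ[OF \<tau>] ..
  hence "v = 0" unfolding 0 by simp
  hence "v $ j = 0" for j by simp
  from this[of 1] this[of 2] this[of 3] this[of 4]
  have "\<phi> 3 = 0" "\<phi> 2 = 0" "\<phi> 1 = 0" "\<phi> 0 = 0" by (auto simp: v_def)
  moreover from i have "i = 0 \<or> i = 1 \<or> i = 2 \<or> i = 3" by auto
  ultimately show ?thesis by auto
qed

lemma frame_spans:
  assumes G: "G \<in> modular_forms Sym3_rep (Sym3_exponents L) l"
  shows "\<exists>\<phi>. (\<forall>i<4. \<phi> i \<in> M1_weight (l - (3 * k + 2 * int i))) \<and> G = (\<lambda>\<tau>. \<Sum>i<4. \<phi> i \<tau> *s frame i \<tau>)"
proof -
  obtain c where c: "\<And>\<tau> \<phi>. Im \<tau> > 0 \<Longrightarrow>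
    (\<Sum>i<4. \<phi> i *s frame i \<tau>) = Sym3 (X \<tau>) *v vector
      [\<phi> 0 + 3 * c * E4 \<tau> * \<phi> 2 + 3 * c * serre_deriv 4 E4 \<tau> * \<phi> 3,
       \<phi> 1 + 7 * c * E4 \<tau> * \<phi> 3, 2 * \<phi> 2, 6 * \<phi> 3]"
    by (rule frame_combination) blast
  define \<psi> where "\<psi> = (\<lambda>j \<tau>. (Sym3 (Z \<tau>) *v G \<tau>) $ j)"
  define m where "m = l - 3 * k"
  have \<psi>: "level1 m (\<psi> 1)" "level1 (m - 2) (\<psi> 2)" "level1 (m - 4) (\<psi> 3)" "level1 (m - 6) (\<psi> 4)"
    using coordinates_Sym3[OF G, of 1] coordinates_Sym3[OF G, of 2]
      coordinates_Sym3[OF G, of 3] coordinates_Sym3[OF G, of 4] by (simp_all add: \<psi>_def m_def)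
  \<comment> \<open>Back substitution in the triangular system of \<open>frame_combination\<close>.
    The weights match because E_4 has weight 4 and its Serre derivative is a level one form of
    weight 6.\<close>
  define \<phi>3 where "\<phi>3 = (\<lambda>\<tau>. 1 / 6 * \<psi> 4 \<tau>)"
  define \<phi>2 where "\<phi>2 = (\<lambda>\<tau>. 1 / 2 * \<psi> 3 \<tau>)"
  define \<phi>1 where "\<phi>1 = (\<lambda>\<tau>. \<psi> 2 \<tau> - 7 * c * (E4 \<tau> * \<phi>3 \<tau>))"
  define \<phi>0 where "\<phi>0 = (\<lambda>\<tau>. \<psi> 1 \<tau> - 3 * c * (E4 \<tau> * \<phi>2 \<tau>) - 3 * c * (serre_deriv 4 E4 \<tau> * \<phi>3 \<tau>))"
  have e6: "level1 6 (serre_deriv 4 E4)" using level1_serre_deriv[OF level1_E4] by simp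
  have l3: "level1 (m - 6) \<phi>3" and l2: "level1 (m - 4) \<phi>2"
    unfolding \<phi>3_def \<phi>2_def by (intro level1_cmult \<psi>)+
  have "level1 (m - 2) (\<lambda>\<tau>. E4 \<tau> * \<phi>3 \<tau>)" using level1_mult[OF level1_E4 l3] by simp
  hence l1: "level1 (m - 2) \<phi>1" unfolding \<phi>1_def by (intro level1_diff level1_cmult \<psi>)
  have "level1 m (\<lambda>\<tau>. E4 \<tau> * \<phi>2 \<tau>)" "level1 m (\<lambda>\<tau>. serre_deriv 4 E4 \<tau> * \<phi>3 \<tau>)"
    using level1_mult[OF level1_E4 l2] level1_mult[OF e6 l3] by simp_all
  hence l0: "level1 m \<phi>0" unfolding \<phi>0_def by (intro level1_diff level1_cmult \<psi>)
  define \<phi> where "\<phi> = (\<lambda>(i::nat) \<tau>. if Im \<tau> > 0 then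
     (if i = 0 then \<phi>0 \<tau> else if i = 1 then \<phi>1 \<tau> else if i = 2 then \<phi>2 \<tau> else \<phi>3 \<tau>) else 0)"
  have "\<phi> i \<in> M1_weight (l - (3 * k + 2 * int i))" if "i < 4" for i
  proof -
    from that have "i = 0 \<or> i = 1 \<or> i = 2 \<or> i = 3" by auto
    hence "level1 (m - 2 * int i) (\<phi> i)"
      by (elim disjE)
         (auto simp: \<phi>_def intro: level1_cong[OF l0] level1_cong[OF l1] level1_cong[OF l2] level1_cong[OF l3])
    thus ?thesis by (simp add: M1_weight_iff m_def \<phi>_def algebra_simps)
  qed
  moreover have "G \<tau> = (\<Sum>i<4. \<phi> i \<tau> *s frame i \<tau>)" for \<tau>
  proof (cases "Im \<tau> > 0")
    case \<tau>: True
    have "vector [\<psi> 1 \<tau>, \<psi> 2 \<tau>, \<psi> 3 \<tau>, \<psi> 4 \<tau>] = Sym3 (Z \<tau>) *v G \<tau>"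
      unfolding vec_eq_iff forall_4 vector_4_nth by (simp add: \<psi>_def)
    moreover have "(\<Sum>i<4. \<phi> i \<tau> *s frame i \<tau>) = Sym3 (X \<tau>) *v vector [\<psi> 1 \<tau>, \<psi> 2 \<tau>, \<psi> 3 \<tau>, \<psi> 4 \<tau>]"
      unfolding c[OF \<tau>] using \<tau> by (simp add: \<phi>_def \<phi>0_def \<phi>1_def \<phi>2_def \<phi>3_def)
    ultimately show ?thesis by (simp add: Sym3_XZ[OF \<tau>])
  next
    case False
    thus ?thesis using modular_formsD(1)[OF G, of \<tau>] by (simp add: \<phi>_def)
  qed
  ultimately show ?thesis by (intro exI[of _ \<phi>]) (simp add: fun_eq_iff)
qed

abbreviation "gen \<equiv> homogeneous (3 * k) (\<lambda>\<tau>. cubic_monomials (A \<tau>))"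

lemma frame_combination_graded:
  assumes "\<And>i. i < 4 \<Longrightarrow> \<Phi> i \<in> M1"
  shows "(\<Sum>i<4. M1_scale (\<Phi> i) ((graded_deriv ^^ i) gen) l \<tau>) =
         (\<Sum>i<4. \<Phi> i (l - (3 * k + 2 * int i)) \<tau> *s frame i \<tau>)"
  by (intro sum.cong) (simp_all add: graded_deriv_funpow_frame M1_scale_homogeneous assms)

text \<open>Coefficients are chosen weight by weight. That each family has finite support is where
  independence is needed: in a weight where G vanishes all chosen coefficients are forced to be
  0.\<close>

lemma frame_spans_graded:
  assumes G: "G \<in> M_module Sym3_rep (Sym3_exponents L)"
  shows "\<exists>\<Phi>. (\<forall>i<4. \<Phi> i \<in> M1) \<and> G = (\<lambda>l \<tau>. \<Sum>i<4. M1_scale (\<Phi> i) ((graded_deriv ^^ i) gen) l \<tau>)"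
proof -
  have Gl: "G l \<in> modular_forms Sym3_rep (Sym3_exponents L) l" for l
    using G by (simp add: M_module_def graded_sum_def)
  have fin: "finite {l. G l \<noteq> (\<lambda>\<tau>. 0)}" using G by (simp add: M_module_def graded_sum_def)
  have "\<exists>\<phi>. \<forall>l. (\<forall>i<4. \<phi> l i \<in> M1_weight (l - (3 * k + 2 * int i))) \<and>
      G l = (\<lambda>\<tau>. \<Sum>i<4. \<phi> l i \<tau> *s frame i \<tau>)"
    by (intro choice allI frame_spans Gl)
  then obtain \<phi> where
    \<phi>: "\<And>l i. i < 4 \<Longrightarrow> \<phi> l i \<in> M1_weight (l - (3 * k + 2 * int i))"
    and eq: "\<And>l. G l = (\<lambda>\<tau>. \<Sum>i<4. \<phi> l i \<tau> *s frame i \<tau>)" by blast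
  \<comment> \<open>A coefficient of weight j multiplies \<open>frame i\<close>, of weight 3k + 2i,
    into weight j + 3k + 2i.\<close>
  define \<Phi> where "\<Phi> = (\<lambda>i j. \<phi> (j + (3 * k + 2 * int i)) i)"
  have \<Phi>: "\<Phi> i \<in> M1" if i: "i < 4" for i
  proof -
    have "\<Phi> i j \<in> M1_weight j" for j
      using \<phi>[OF i, of "j + (3 * k + 2 * int i)"] by (simp add: \<Phi>_def)
    moreover have "{j. \<Phi> i j \<noteq> (\<lambda>\<tau>. 0)} \<subseteq> (\<lambda>l. l - (3 * k + 2 * int i)) ` {l. G l \<noteq> (\<lambda>\<tau>. 0)}"
    proof
      fix j assume j: "j \<in> {j. \<Phi> i j \<noteq> (\<lambda>\<tau>. 0)}"
      define l where "l = j + (3 * k + 2 * int i)"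
      have "G l \<noteq> (\<lambda>\<tau>. 0)"
      proof
        assume 0: "G l = (\<lambda>\<tau>. 0)"
        have "\<phi> l i \<tau> = 0" for \<tau>
        proof (cases "Im \<tau> > 0")
          case True
          have "(\<Sum>i<4. \<phi> l i \<tau> *s frame i \<tau>) = 0" using eq[of l] 0 by (simp add: fun_eq_iff)
          from frame_independent[OF True this i] show ?thesis .
        next
          case False
          thus ?thesis using \<phi>[OF i, of l] by (simp add: M1_weight_iff)
        qed
        thus False using j by (simp add: \<Phi>_def l_def fun_eq_iff)
      qed
      thus "j \<in> (\<lambda>l. l - (3 * k + 2 * int i)) ` {l. G l \<noteq> (\<lambda>\<tau>. 0)}"
        by (intro image_eqI[of _ _ l]) (auto simp: l_def)
    qed
    hence "finite {j. \<Phi> i j \<noteq> (\<lambda>\<tau>. 0)}" by (rule finite_subset) (rule finite_imageI[OF fin])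
    ultimately show ?thesis by (simp add: M1_def graded_sum_def)
  qed
  have "G l \<tau> = (\<Sum>i<4. M1_scale (\<Phi> i) ((graded_deriv ^^ i) gen) l \<tau>)" for l \<tau>
  proof -
    have "(\<Sum>i<4. M1_scale (\<Phi> i) ((graded_deriv ^^ i) gen) l \<tau>) =
        (\<Sum>i<4. \<Phi> i (l - (3 * k + 2 * int i)) \<tau> *s frame i \<tau>)"
      by (rule frame_combination_graded) (rule \<Phi>)
    also have "\<dots> = G l \<tau>" by (simp add: eq[of l] \<Phi>_def)
    finally show ?thesis ..
  qed
  thus ?thesis using \<Phi> by (intro exI[of _ \<Phi>]) (simp add: fun_eq_iff)
qed

lemma gen_in_M_module: "(graded_deriv ^^ i) gen \<in> M_module Sym3_rep (Sym3_exponents L)"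
  unfolding graded_deriv_funpow_frame M_module_def
  by (intro homogeneous_in_graded_sum frame_modular_forms modular_forms_zero)

lemma frame_basis:
  "M1_basis (M_module Sym3_rep (Sym3_exponents L)) 4 (\<lambda>i. (graded_deriv ^^ i) gen)"
  unfolding M1_basis_def
proof (intro conjI allI impI ballI)
  show "(graded_deriv ^^ i) gen \<in> M_module Sym3_rep (Sym3_exponents L)" for i
    by (rule gen_in_M_module)
  show "\<exists>\<phi>. (\<forall>i<4. \<phi> i \<in> M1) \<and> G = (\<lambda>k' \<tau>. \<Sum>i<4. M1_scale (\<phi> i) ((graded_deriv ^^ i) gen) k' \<tau>)"
    if "G \<in> M_module Sym3_rep (Sym3_exponents L)" for G
    by (rule frame_spans_graded[OF that])
  fix \<Phi> :: "nat \<Rightarrow> int \<Rightarrow> complex \<Rightarrow> complex" and i :: nat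
  assume \<Phi>: "(\<forall>i<4. \<Phi> i \<in> M1) \<and> (\<lambda>k' \<tau>. \<Sum>i<4. M1_scale (\<Phi> i) ((graded_deriv ^^ i) gen) k' \<tau>) = (\<lambda>k' \<tau>. 0)"
    and i: "i < 4"
  have "\<Phi> i j \<tau> = 0" for j \<tau>
  proof (cases "Im \<tau> > 0")
    case True
    define l where "l = j + (3 * k + 2 * int i)"
    have "(\<Sum>i<4. M1_scale (\<Phi> i) ((graded_deriv ^^ i) gen) l \<tau>) = 0"
      using \<Phi> by (simp add: fun_eq_iff)
    hence "(\<Sum>i<4. \<Phi> i (l - (3 * k + 2 * int i)) \<tau> *s frame i \<tau>) = 0"
      using \<Phi> by (simp add: frame_combination_graded)
    from frame_independent[OF True this i] show ?thesis by (simp add: l_def)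
  next
    case False
    have "\<Phi> i j \<in> M1_weight j" using \<Phi> i by (simp add: M1_def graded_sum_def)
    thus ?thesis using False by (simp add: M1_weight_iff)
  qed
  thus "\<Phi> i = (\<lambda>k \<tau>. 0)" by (simp add: fun_eq_iff)
qed

text \<open>The basis consists of derivatives of one form, so a combination of it is an operator sum
  of \<Phi>_i D^i applied to that form.\<close>

lemma Sym3_cyclic: "cyclic_module (M_module Sym3_rep (Sym3_exponents L))"
  unfolding cyclic_module_def
proof (intro bexI[of _ gen] equalityI subsetI)
  show "gen \<in> M_module Sym3_rep (Sym3_exponents L)" using gen_in_M_module[of 0] by simp
  show "G \<in> M_module Sym3_rep (Sym3_exponents L)" if "G \<in> (\<lambda>P. P gen) ` diff_ops" for G
    using that diff_ops_preserve_M_module \<open>gen \<in> _\<close> by blast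
  fix G assume "G \<in> M_module Sym3_rep (Sym3_exponents L)"
  then obtain \<Phi> where \<Phi>: "\<And>i. i < 4 \<Longrightarrow> \<Phi> i \<in> M1"
    and G: "G = (\<lambda>l \<tau>. \<Sum>i<4. M1_scale (\<Phi> i) ((graded_deriv ^^ i) gen) l \<tau>)"
    using frame_spans_graded by blast
  have "(\<lambda>(F :: int \<Rightarrow> complex \<Rightarrow> complex^4) l \<tau>. \<Sum>i<4. M1_scale (\<Phi> i) ((graded_deriv ^^ i) F) l \<tau>) \<in> diff_ops"
    by (intro diff_ops_sum diff_ops_scale_funpow \<Phi>)
  thus "G \<in> (\<lambda>P. P gen) ` diff_ops" unfolding G by (rule rev_image_eqI) simp
qed

text \<open>Below weight 3k all coefficients with respect to the basis have negative weight and
  vanish.\<close>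

lemma Sym3_minimal_weight: "minimal_weight Sym3_rep (Sym3_exponents L) (3 * k)"
  unfolding minimal_weight_def
proof (intro conjI allI impI)
  obtain \<tau> where "A \<tau> \<noteq> 0" using A_nonzero by (auto simp: fun_eq_iff)
  hence "cubic_monomials (A \<tau>) \<noteq> 0" by (simp add: vec_eq_iff forall_2 forall_4)
  hence "(\<lambda>\<tau>. cubic_monomials (A \<tau>)) \<noteq> (\<lambda>\<tau>. 0)" by (auto simp: fun_eq_iff)
  thus "modular_forms Sym3_rep (Sym3_exponents L) (3 * k) \<noteq> {\<lambda>\<tau>. 0}"
    using cubic_modular_forms[OF A] by auto
  fix j assume j: "j < 3 * k"
  have "G = (\<lambda>\<tau>. 0)" if G: "G \<in> modular_forms Sym3_rep (Sym3_exponents L) j" for G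
  proof -
    obtain \<phi> where \<phi>: "\<And>i. i < 4 \<Longrightarrow> \<phi> i \<in> M1_weight (j - (3 * k + 2 * int i))"
      and eq: "G = (\<lambda>\<tau>. \<Sum>i<4. \<phi> i \<tau> *s frame i \<tau>)" using frame_spans[OF G] by blast
    have "\<phi> i \<tau> = 0" if i: "i < 4" for i \<tau>
    proof (cases "Im \<tau> > 0")
      case True
      show ?thesis
        by (rule level1_neg_weight[OF _ _ True, of "j - (3 * k + 2 * int i)"])
           (use \<phi>[OF i] j in \<open>auto simp: M1_weight_iff\<close>)
    next
      case False
      thus ?thesis using \<phi>[OF i] by (simp add: M1_weight_iff)
    qed
    thus ?thesis unfolding eq by (simp add: fun_eq_iff)
  qed
  thus "modular_forms Sym3_rep (Sym3_exponents L) j = {\<lambda>\<tau>. 0}"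
    using modular_forms_zero by blast
qed

end

theorem theorem30:
  fixes \<alpha> :: "int^2^2 \<Rightarrow> complex^2^2"
    and L :: "complex^2^2"
    and k\<^sub>1 :: int
    and A :: "complex \<Rightarrow> complex^2"
  assumes "irreducible_rep \<alpha>"
    and "irreducible_rep (\<lambda>\<gamma>. Sym3 (\<alpha> \<gamma>))"
    and "choice_of_exponents \<alpha> L"
    and "of_int k\<^sub>1 = 6 * trace L - 1"
    and "A \<in> modular_forms \<alpha> L k\<^sub>1"
    and "A \<noteq> (\<lambda>\<tau>. 0)"
  shows "cyclic_module (M_module (\<lambda>\<gamma>. Sym3 (\<alpha> \<gamma>)) (Sym3_exponents L)) \<and>
    minimal_weight (\<lambda>\<gamma>. Sym3 (\<alpha> \<gamma>)) (Sym3_exponents L) (3 * k\<^sub>1) \<and>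
    M1_basis (M_module (\<lambda>\<gamma>. Sym3 (\<alpha> \<gamma>)) (Sym3_exponents L)) 4
      (\<lambda>i. (graded_deriv ^^ i) (homogeneous (3 * k\<^sub>1) (\<lambda>\<tau>. cubic_monomials (A \<tau>))))"
proof -
  interpret minimal_form \<alpha> L k\<^sub>1 A
    using assms by unfold_locales
  show ?thesis
    by (intro conjI Sym3_cyclic Sym3_minimal_weight frame_basis)
qed

end
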